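(* Let $G$ be a locally compact Abelian group with dual group $\widehat G$, let $n\ge1$, and let $g=(g_1,\dots,g_n)\in G^n$ and $h=(h_1,\dots,h_n)\in G^n$. For $\gamma\in\widehat G$ and $z=(z_1,\dots,z_n)\in\mathbb{T}^n$ put $$\Phi^g_\gamma(z)=(z_1\gamma(g_1),\dots,z_n\gamma(g_n)),\qquad \Phi^h_\gamma(z)=(z_1\gamma(h_1),\dots,z_n\gamma(h_n)).$$ Assume that both $\widehat G$-actions $(\Phi^g_\gamma)_{\gamma\in\widehat G}$ and $(\Phi^h_\gamma)_{\gamma\in\widehat G}$ are minimal on $\mathbb{T}^n$. Then the following are equivalent: (1) The two actions are topologically conjugate, i.e. there exists a homeomorphism $H:\mathbb{T}^n\to\mathbb{T}^n$ such that $H\circ\Phi^g_\gamma=\Phi^h_\gamma\circ H$ for all $\gamma\in\widehat G$. (2) There exists a matrix $P=(p_{ij})\in GL(n,\mathbb{Z})$ such that $h_i=\sum_{j=1}^n p_{ij}g_j$ for $1\le i\le n$. Moreover, every conjugacy $H$ (i.e. every homeomorphism as in (1)) is affine: there exist $P\in GL(n,\mathbb{Z})$ and $c\in\mathbb{T}^n$ such that $H(z)=c\cdot\Psi_P(z)$ for all $z\in\mathbb{T}^n$, where $\Psi_P:\mathbb{T}^n\to\mathbb{T}^n$ is the torus automorphism $$\Psi_P(z_1,\dots,z_n)=\Big(\prod_{j=1}^n z_j^{p_{1j}},\ \dots,\ \prod_{j=1}^n z_j^{p_{nj}}\Big).$$ The matrix $P$ satisfying $h_i=\sum_{j=1}^n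 p_{ij}g_j$ for $1\le i\le n$ (i.e. $h=Pg$) is unique.
   Context: $\mathbb{T}=\{z\in\mathbb{C}:|z|=1\}$, and $\mathbb{T}^n$ carries coordinatewise multiplication, denoted $z\cdot z'$. $G$ is written additively and $\widehat G$ is the group of continuous characters $\gamma:G\to\mathbb{T}$. $GL(n,\mathbb{Z})$ is the group of $n\times n$ integer matrices with determinant $\pm1$. An action on $\mathbb{T}^n$ is minimal if every orbit is dense in $\mathbb{T}^n$. *)

theory Defs
  imports "HOL-Analysis.Analysis"
begin

(* The n-torus, n = CARD('n), with its topology inherited from complex^'n. The library's
   multiplication on vectors is coordinatewise, hence is the group operation of the torus. *)
definition torus :: "(complex ^ 'n) set" where
  "torus = {z. \<forall>i. norm (z $ i) = 1}"

(* Continuous homomorphisms from G to the unit circle, as functions into the complex numbers. *)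
definition dual_group :: "('g::topological_ab_group_add \<Rightarrow> complex) set" where
  "dual_group = {\<gamma>. continuous_on UNIV \<gamma> \<and> (\<forall>x. norm (\<gamma> x) = 1) \<and>
                     (\<forall>x y. \<gamma> (x + y) = \<gamma> x * \<gamma> y)}"

definition Phi :: "'g ^ 'n \<Rightarrow> ('g \<Rightarrow> complex) \<Rightarrow> complex ^ 'n \<Rightarrow> complex ^ 'n" where
  "Phi g \<gamma> z = (\<chi> i. z $ i * \<gamma> (g $ i))"

(* Density of the orbits in X; it is meant for actions that map X into itself. *)
definition minimal_action :: "'c set \<Rightarrow> ('c \<Rightarrow> 'x \<Rightarrow> 'x) \<Rightarrow> ('x::topological_space) set \<Rightarrow> bool" where
  "minimal_action \<Gamma> \<Phi> X \<longleftrightarrow> (\<forall>x\<in>X. X \<subseteq> closure ((\<lambda>\<gamma>. \<Phi> \<gamma> x) ` \<Gamma>))"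

(* H is a function on complex^'n of which only the restriction to the torus matters. *)
definition conjugacy ::
  "'g::topological_ab_group_add ^ 'n \<Rightarrow> 'g ^ 'n \<Rightarrow> (complex ^ 'n \<Rightarrow> complex ^ 'n) \<Rightarrow> bool" where
  "conjugacy g h H \<longleftrightarrow> (\<exists>H'. homeomorphism torus torus H H') \<and>
     (\<forall>\<gamma>\<in>dual_group. \<forall>z\<in>torus. H (Phi g \<gamma> z) = Phi h \<gamma> (H z))"

definition GL_int :: "(int ^ 'n ^ 'n) set" where
  "GL_int = {P. det P = 1 \<or> det P = -1}"

(* The integer multiple k x in an abelian group; "nat" truncates negative integers to 0,
   so one of the two sums is always empty. *)
definition int_mult :: "int \<Rightarrow> 'g::ab_group_add \<Rightarrow> 'g" where
  "int_mult k x = (\<Sum>_<nat k. x) - (\<Sum>_<nat (- k). x)"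

definition mat_act :: "int ^ 'n ^ 'n \<Rightarrow> 'g::ab_group_add ^ 'n \<Rightarrow> 'g ^ 'n" where
  "mat_act P g = (\<chi> i. \<Sum>j\<in>UNIV. int_mult (P $ i $ j) (g $ j))"

definition Psi :: "int ^ 'n ^ 'n \<Rightarrow> complex ^ 'n \<Rightarrow> complex ^ 'n" where
  "Psi P z = (\<chi> i. \<Prod>j\<in>UNIV. (z $ j) powi (P $ i $ j))"

end

theory Submission
  imports Defs
begin

text \<open>
  Write \<open>e_\<gamma>\<close> for the torus element with coordinates \<open>\<gamma> (g $ i)\<close>; the action of \<open>\<gamma>\<close> is
  multiplication by it. A conjugacy \<open>H\<close> satisfies \<open>H (z * w) * H 1 = H z * H w\<close> whenever \<open>w\<close>
  is some \<open>e_\<gamma>\<close>. Both sides are continuous in \<open>w\<close>, and minimality says that the \<open>e_\<gamma>\<close> are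
  dense, so the identity holds for all \<open>w\<close>: up to the constant \<open>H 1\<close>, \<open>H\<close> is a
  continuous automorphism of the torus. Continuous endomorphisms of the torus are given by
  integer matrices, and invertibility makes the determinant a unit (\<open>conjugacy_affine\<close>). Evaluating
  at \<open>z = 1\<close> yields \<open>\<gamma> (h $ i) = \<gamma> (mat_act P g $ i)\<close> for every continuous character \<open>\<gamma>\<close>.
  Density also gives the uniqueness of \<open>P\<close> (\<open>mat_act_unique\<close>), and the converse is a
  computation (\<open>conjugacy_of_GL\<close>).

  What turns the equality of character values into \<open>h = mat_act P g\<close> is that the continuous
  characters of a locally compact Hausdorff abelian group separate points. Most of the text proves
  this theorem (\<open>continuous_characters_separate_points\<close>), without Haar measure. Let
  \<open>x \<noteq> 0\<close>.

  Topological part. Let \<open>U\<close> be a relatively compact neighbourhood of \<open>x\<close> that does not contain \<open>0\<close>. A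
  subgroup \<open>H\<close> that is maximal among those avoiding \<open>U\<close> has the property that every cyclic group
  is relatively compact modulo \<open>H\<close>, because every subgroup strictly larger than \<open>H\<close> meets \<open>U\<close>. Hence there is an open subgroup \<open>D\<close>
  containing \<open>x\<close> and \<open>H\<close> which is compact modulo \<open>H\<close>. Making a bump function at \<open>0\<close> periodic
  under \<open>H\<close> gives a uniformly continuous \<open>f\<close> with \<open>f x \<noteq> f 0\<close> whose translates by \<open>D\<close> are
  totally bounded: \<open>f\<close> is almost periodic on \<open>D\<close>.

  Algebraic part (\<open>almost_periodic_separation\<close>). Let \<open>g t = f t - f (t + x)\<close>, and let \<open>\<theta>\<close> be its
  autocorrelation with respect to an invariant mean on \<open>D\<close>. Among all positive definite functions
  \<open>\<psi>\<close> with \<open>\<psi> 0 = 1\<close>, consider those for which no average of \<open>\<psi> \<theta>\<close> over Fejer kernels falls below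
  \<open>c\<close>, for the largest possible \<open>c\<close>. Almost periodicity makes \<open>c\<close> positive, since \<open>\<theta>\<close> itself,
  normalized at \<open>0\<close>, is a candidate. These \<open>\<psi>\<close> form a closed extremal set in a compact set, so
  one of them is an extreme point, and extreme points are characters. A character \<open>\<gamma>\<close> with positive Fejer means
  against \<open>\<theta>\<close> cannot be \<open>1\<close> at \<open>x\<close>, and it is as continuous as \<open>g\<close> is. Since positive definite
  functions on \<open>D\<close> extend by zero to the whole group, \<open>\<gamma>\<close> is a character of the whole group
  from the start.
\<close>

section \<open>Subgroups, integer multiples and characters\<close>

definition add_subgroup :: "'g::ab_group_add set \<Rightarrow> bool" where
  "add_subgroup D \<longleftrightarrow> 0 \<in> D \<and> (\<forall>a\<in>D. \<forall>b\<in>D. a - b \<in> D)"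

lemma add_subgroup_0: "add_subgroup D \<Longrightarrow> 0 \<in> D"
  by (auto simp: add_subgroup_def)

lemma add_subgroup_diff: "add_subgroup D \<Longrightarrow> a \<in> D \<Longrightarrow> b \<in> D \<Longrightarrow> a - b \<in> D"
  by (auto simp: add_subgroup_def)

lemma add_subgroup_minus: "add_subgroup D \<Longrightarrow> a \<in> D \<Longrightarrow> - a \<in> D"
  using add_subgroup_diff[of D 0 a] by (simp add: add_subgroup_0)

lemma add_subgroup_add: "add_subgroup D \<Longrightarrow> a \<in> D \<Longrightarrow> b \<in> D \<Longrightarrow> a + b \<in> D"
  using add_subgroup_diff[of D a "- b"] by (simp add: add_subgroup_minus)

lemma int_mult_0 [simp]: "int_mult 0 x = 0"
  by (simp add: int_mult_def)

lemma int_mult_plus_1: "int_mult (k + 1) x = int_mult k x + x"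
proof (cases "k \<ge> 0")
  case True
  then have "nat (k + 1) = Suc (nat k)" "nat (- k) = 0" "nat (- (k + 1)) = 0" by auto
  then show ?thesis unfolding int_mult_def by (simp only:) simp
next
  case False
  then have "nat (- k) = Suc (nat (- (k + 1)))" "nat k = 0" "nat (k + 1) = 0" by auto
  then show ?thesis unfolding int_mult_def by (simp only:) simp
qed

lemma int_mult_minus_1: "int_mult (k - 1) x = int_mult k x - x"
  using int_mult_plus_1[of "k - 1" x] by simp

lemma int_mult_1 [simp]: "int_mult 1 x = x"
  using int_mult_plus_1[of 0 x] by simp

lemma int_mult_add_left: "int_mult (k + l) x = int_mult k x + int_mult l x"
proof (induction l rule: int_induct[where k = 0])
  case (step1 i)
  then show ?case using int_mult_plus_1[of "k + i" x] int_mult_plus_1[of i x]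
    by (simp add: algebra_simps)
next
  case (step2 i)
  then show ?case using int_mult_minus_1[of "k + i" x] int_mult_minus_1[of i x]
    by (simp add: add_diff_eq)
qed simp

lemma int_mult_minus_left: "int_mult (- k) x = - int_mult k x"
  using int_mult_add_left[of k "- k" x] by (simp add: eq_neg_iff_add_eq_0 add.commute)

lemma int_mult_diff_left: "int_mult (k - l) x = int_mult k x - int_mult l x"
  using int_mult_add_left[of k "- l" x] by (simp add: int_mult_minus_left)

lemma int_mult_mult: "int_mult (k * l) x = int_mult k (int_mult l x)"
proof (induction k rule: int_induct[where k = 0])
  case (step1 i)
  then show ?case
    by (simp add: int_mult_plus_1 distrib_right int_mult_add_left)
next
  case (step2 i)
  then show ?case
    by (simp add: int_mult_minus_1 left_diff_distrib int_mult_diff_left)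
qed simp

lemma add_subgroup_int_mult:
  assumes "add_subgroup D" "x \<in> D" shows "int_mult k x \<in> D"
proof (induction k rule: int_induct[where k = 0])
  case (step1 i)
  then show ?case using assms by (simp add: int_mult_plus_1 add_subgroup_add)
next
  case (step2 i)
  then show ?case using assms by (simp add: int_mult_minus_1 add_subgroup_diff)
qed (simp add: assms add_subgroup_0)

text \<open>
  Continuity is left out on purpose: characters first arise as extreme points of a set of functions
  without any continuity, and are shown to be continuous afterwards.
\<close>

definition is_character :: "('g::ab_group_add \<Rightarrow> complex) \<Rightarrow> bool" where
  "is_character \<gamma> \<longleftrightarrow> (\<forall>x. norm (\<gamma> x) = 1) \<and> (\<forall>x y. \<gamma> (x + y) = \<gamma> x * \<gamma> y)"

lemma character_nz: "is_character \<gamma> \<Longrightarrow> \<gamma> x \<noteq> 0"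
  unfolding is_character_def by (metis norm_zero zero_neq_one)

lemma character_0: "is_character \<gamma> \<Longrightarrow> \<gamma> 0 = 1"
  using character_nz[of \<gamma> 0] unfolding is_character_def
  by (metis add_0 mult_cancel_left1)

lemma character_diff: assumes "is_character \<gamma>" shows "\<gamma> (x - y) = \<gamma> x * cnj (\<gamma> y)"
proof -
  have "\<gamma> (x - y) * \<gamma> y = \<gamma> x"
    using assms unfolding is_character_def by (metis diff_add_cancel)
  moreover have "\<gamma> y * cnj (\<gamma> y) = 1"
    using assms unfolding is_character_def by (metis complex_norm_square of_real_1 one_power2)
  ultimately show ?thesis by (metis mult.assoc mult.right_neutral)
qed

lemma character_int_mult: assumes "is_character \<gamma>" shows "\<gamma> (int_mult k x) = \<gamma> x powi k"
proof (induction k rule: int_induct[where k = 0])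
  case base
  then show ?case using character_0[OF assms] by simp
next
  case (step1 i)
  then show ?case using assms character_nz[OF assms, of x]
    by (simp add: int_mult_plus_1 is_character_def power_int_add)
next
  case (step2 i)
  have "\<gamma> (int_mult i x) = \<gamma> (int_mult (i - 1) x) * \<gamma> x"
    using assms int_mult_plus_1[of "i - 1" x] by (simp add: is_character_def)
  then show ?case using step2 character_nz[OF assms, of x]
    by (simp add: power_int_diff field_simps)
qed

section \<open>Invariant means\<close>

text \<open>
  Means are applied to functions on the whole group, but positivity looks only at values on \<open>D\<close>,
  so that the mean is carried by \<open>D\<close>.
\<close>

definition mean_on :: "'g::ab_group_add set \<Rightarrow> (('g \<Rightarrow> real) \<Rightarrow> real) \<Rightarrow> bool" where
  "mean_on D M \<longleftrightarrow>
     (\<forall>u v. bounded (range u) \<longrightarrow> bounded (range v) \<longrightarrow> M (\<lambda>t. u t + v t) = M u + M v) \<and>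
     (\<forall>c u. bounded (range u) \<longrightarrow> M (\<lambda>t. c * u t) = c * M u) \<and>
     (\<forall>u. bounded (range u) \<longrightarrow> (\<forall>t\<in>D. 0 \<le> u t) \<longrightarrow> 0 \<le> M u) \<and>
     M (\<lambda>_. 1) = 1"

lemma bounded_range_real: "bounded (range (u :: 'a \<Rightarrow> real)) \<longleftrightarrow> (\<exists>C. \<forall>t. \<bar>u t\<bar> \<le> C)"
  by (auto simp: bounded_iff)

lemma bounded_range_add: 
  "bounded (range u) \<Longrightarrow> bounded (range v) \<Longrightarrow> bounded (range (\<lambda>t. u t + v t :: real))"
  by (rule bounded_plus_comp)

lemma bounded_range_mult: 
  assumes "bounded (range u)" "bounded (range v)" shows "bounded (range (\<lambda>t. u t * v t :: real))"
proof -
  obtain C1 C2 where C: "\<And>t. \<bar>u t\<bar> \<le> C1" "\<And>t. \<bar>v t\<bar> \<le> C2"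
    using assms by (auto simp: bounded_range_real)
  have "\<bar>u t * v t\<bar> \<le> C1 * C2" for t
    unfolding abs_mult by (intro mult_mono C) (use C(1)[of t] in linarith, simp)
  then show ?thesis by (auto simp: bounded_range_real)
qed

lemma bounded_range_const: "bounded (range (\<lambda>_. c))"
  by simp

lemma bounded_range_shift: "bounded (range u) \<Longrightarrow> bounded (range (\<lambda>t. u (t + y)))"
  by (rule bounded_subset) auto

lemma bounded_range_sum: 
  "(\<And>i. i \<in> I \<Longrightarrow> bounded (range (u i))) \<Longrightarrow> bounded (range (\<lambda>t. \<Sum>i\<in>I. u i t :: real))"
proof (induction I rule: infinite_finite_induct)
  case (insert x F)
  then show ?case by (simp add: bounded_range_add)
qed simp_all

lemmas bounded_range_intros = bounded_range_add bounded_range_mult bounded_range_const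
  bounded_range_shift bounded_range_sum

lemma mean_add: "mean_on D M \<Longrightarrow> bounded (range u) \<Longrightarrow> bounded (range v) \<Longrightarrow> 
    M (\<lambda>t. u t + v t) = M u + M v"
  by (simp add: mean_on_def)

lemma mean_scale: "mean_on D M \<Longrightarrow> bounded (range u) \<Longrightarrow> M (\<lambda>t. c * u t) = c * M u"
  by (simp add: mean_on_def)

lemma mean_nonneg: "mean_on D M \<Longrightarrow> bounded (range u) \<Longrightarrow> (\<And>t. t \<in> D \<Longrightarrow> 0 \<le> u t) \<Longrightarrow> 0 \<le> M u"
  by (simp add: mean_on_def)

lemma mean_const: "mean_on D M \<Longrightarrow> M (\<lambda>_. c) = c"
  using mean_scale[of D M "\<lambda>_. 1" c] by (simp add: mean_on_def)

lemma mean_sum: assumes M: "mean_on D M" and "\<And>i. i \<in> I \<Longrightarrow> bounded (range (u i))" 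
  shows "M (\<lambda>t. \<Sum>i\<in>I. u i t) = (\<Sum>i\<in>I. M (u i))"
  using assms(2)
proof (induction I rule: infinite_finite_induct)
  case (insert x F)
  then show ?case by (simp add: mean_add[OF M] bounded_range_intros)
qed (simp_all add: mean_const[OF M])

lemma mean_diff: assumes "mean_on D M" "bounded (range u)" "bounded (range v)"
  shows "M (\<lambda>t. u t - v t) = M u - M v"
proof -
  have "bounded (range (\<lambda>t. (- 1) * v t))" using assms by (intro bounded_range_intros)
  then show ?thesis using mean_add[OF assms(1,2), of "\<lambda>t. (- 1) * v t"] mean_scale[OF assms(1,3), of "-1"]
    by simp
qed

lemma mean_mono: assumes "mean_on D M" "bounded (range u)" "bounded (range v)"
   "\<And>t. t \<in> D \<Longrightarrow> u t \<le> v t"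
 shows "M u \<le> M v"
proof -
  have "bounded (range (\<lambda>t. (- 1) * u t))" using assms by (intro bounded_range_intros)
  then have "bounded (range (\<lambda>t. v t - u t))" using bounded_range_add[OF assms(3), of "\<lambda>t. (- 1) * u t"] by simp
  then show ?thesis using mean_nonneg[OF assms(1), of "\<lambda>t. v t - u t"] assms mean_diff[OF assms(1,3,2)]
    by simp
qed

lemma mean_abs_le: assumes "mean_on D M" "bounded (range u)" "\<And>t. t \<in> D \<Longrightarrow> \<bar>u t\<bar> \<le> C"
 shows "\<bar>M u\<bar> \<le> C"
proof -
  have "M u \<le> M (\<lambda>_. C)" 
    by (rule mean_mono[OF assms(1,2) bounded_range_const]) (use assms(3) in \<open>auto simp: abs_le_iff\<close>)
  moreover have "M (\<lambda>_. - C) \<le> M u" 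
    by (rule mean_mono[OF assms(1) bounded_range_const assms(2)]) (use assms(3) in \<open>fastforce simp: abs_le_iff\<close>)
  ultimately show ?thesis by (simp add: mean_const[OF assms(1)])
qed

lemma closed_mean_on: "closed {M. mean_on D M}"
  unfolding mean_on_def
  by (intro closed_Collect_conj closed_Collect_all closed_Collect_imp closed_Collect_eq 
       closed_Collect_le continuous_intros continuous_on_product_coordinates) simp_all

definition invariant_mean :: "'g::ab_group_add set \<Rightarrow> (('g \<Rightarrow> real) \<Rightarrow> real) \<Rightarrow> bool" where
  "invariant_mean D M \<longleftrightarrow> mean_on D M \<and> (\<forall>u. \<forall>y\<in>D. bounded (range u) \<longrightarrow> M (\<lambda>t. u (t + y)) = M u)"

lemma mean_shift: "invariant_mean D M \<Longrightarrow> bounded (range u) \<Longrightarrow> y \<in> D \<Longrightarrow> M (\<lambda>t. u (t + y)) = M u"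
  by (simp add: invariant_mean_def)

lemma mean_on_invariant_mean: "invariant_mean D M \<Longrightarrow> mean_on D M"
  by (simp add: invariant_mean_def)

text \<open>
  Composing a mean with the average over \<open>0, y, \<dots>, n y\<close> makes it almost invariant under \<open>y\<close>, by
  telescoping. This preserves what was achieved for other elements, because averages commute with
  translations.
\<close>

lemma approximately_invariant_mean:
  fixes D :: "'g::ab_group_add set"
  assumes D: "add_subgroup D" and "finite J" "J \<subseteq> D \<times> (UNIV :: nat set)"
  shows "\<exists>M. mean_on D M \<and> (\<forall>(y, n)\<in>J. \<forall>u. (\<forall>t. \<bar>u t\<bar> \<le> 1) \<longrightarrow>
           \<bar>M (\<lambda>t. u (t + y)) - M u\<bar> \<le> 2 / Suc n)"
  using assms(2,3)
proof (induction J rule: finite_induct)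
  case empty
  have "mean_on D (\<lambda>u. u 0)" using add_subgroup_0[OF D] by (simp add: mean_on_def)
  then show ?case by auto
next
  case (insert p J)
  obtain y n where p: "p = (y, n)" by force
  then have y: "y \<in> D" using insert by auto
  obtain M where M: "mean_on D M" and inv: "\<And>z m u. (z, m) \<in> J \<Longrightarrow> (\<forall>t. \<bar>u t\<bar> \<le> 1) \<Longrightarrow>
           \<bar>M (\<lambda>t. u (t + z)) - M u\<bar> \<le> 2 / Suc m"
    using insert by fastforce
  define A where "A u = (\<lambda>t. (\<Sum>i<Suc n. u (t + int_mult (int i) y)) / Suc n)" for u :: "'g \<Rightarrow> real"
  have A': "A u = (\<lambda>t. (1 / Suc n) * (\<Sum>i<Suc n. u (t + int_mult (int i) y)))" for u
    by (simp add: A_def)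
  have bA: "bounded (range (A u))" if "bounded (range u)" for u
    unfolding A' by (intro bounded_range_intros that)
  have A1: "\<forall>t. \<bar>A u t\<bar> \<le> 1" if "\<forall>t. \<bar>u t\<bar> \<le> 1" for u
  proof
    fix t
    have "\<bar>\<Sum>i<Suc n. u (t + int_mult (int i) y)\<bar> \<le> (\<Sum>i<Suc n. 1)"
      using that by (intro order.trans[OF sum_abs] sum_mono) auto
    then show "\<bar>A u t\<bar> \<le> 1" by (simp add: A_def divide_le_eq)
  qed
  have shift: "A (\<lambda>t. u (t + z)) = (\<lambda>t. A u (t + z))" for u z
    by (simp add: A_def fun_eq_iff add.assoc add.commute add.left_commute)
  have "mean_on D (\<lambda>u. M (A u))"
    unfolding mean_on_def
  proof (intro conjI allI impI)
    fix u v :: "'g \<Rightarrow> real" assume u: "bounded (range u)"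
    { assume v: "bounded (range v)"
      have "A (\<lambda>t. u t + v t) = (\<lambda>t. A u t + A v t)"
        by (simp add: A_def sum.distrib add_divide_distrib)
      then show "M (A (\<lambda>t. u t + v t)) = M (A u) + M (A v)"
        using mean_add[OF M bA[OF u] bA[OF v]] by simp }
    { fix c
      have "A (\<lambda>t. c * u t) = (\<lambda>t. c * A u t)"
        unfolding A_def by (simp only: sum_distrib_left[symmetric] times_divide_eq_right)
      then show "M (A (\<lambda>t. c * u t)) = c * M (A u)"
        using mean_scale[OF M bA[OF u]] by simp }
    { assume "\<forall>t\<in>D. 0 \<le> u t"
      then have "0 \<le> A u t" if "t \<in> D" for t
        unfolding A_def using D that y
        by (intro divide_nonneg_nonneg sum_nonneg) (auto intro: add_subgroup_add add_subgroup_int_mult)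
      then show "0 \<le> M (A u)" by (rule mean_nonneg[OF M bA[OF u]]) }
  next
    show "M (A (\<lambda>_. 1)) = 1" by (simp add: A_def mean_const[OF M])
  qed
  moreover have "\<bar>M (A (\<lambda>t. u (t + z))) - M (A u)\<bar> \<le> 2 / Suc m" 
    if "(z, m) \<in> insert p J" and u: "\<forall>t. \<bar>u t\<bar> \<le> 1" for z m u
  proof (cases "(z, m) \<in> J")
    case True
    show ?thesis using inv[OF True A1[OF u]] by (simp add: shift)
  next
    case False
    then have [simp]: "z = y" "m = n" using that p by auto
    have bu: "bounded (range u)" using u by (auto simp: bounded_range_real)
    have tele: "A (\<lambda>t. u (t + y)) t - A u t = (u (t + int_mult (int (Suc n)) y) - u t) / Suc n" for t
    proof -
      define w where "w i = u (t + int_mult (int i) y)" for i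
      have "w (Suc i) = u (t + int_mult (int i) y + y)" for i
        using int_mult_plus_1[of "int i" y] by (simp add: w_def add.assoc add.commute add.left_commute)
      then have "A (\<lambda>t. u (t + y)) t = (\<Sum>i<Suc n. w (Suc i)) / Suc n" by (simp add: A_def)
      moreover have "A u t = (\<Sum>i<Suc n. w i) / Suc n" by (simp add: A_def w_def)
      ultimately have "A (\<lambda>t. u (t + y)) t - A u t = (\<Sum>i<Suc n. w (Suc i) - w i) / Suc n"
        by (simp add: sum_subtractf diff_divide_distrib)
      also have "(\<Sum>i<Suc n. w (Suc i) - w i) = w (Suc n) - w 0" by (rule sum_lessThan_telescope)
      finally show ?thesis by (simp add: w_def)
    qed
    have "\<bar>M (\<lambda>t. A (\<lambda>t. u (t + y)) t - A u t)\<bar> \<le> 2 / Suc n"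
    proof (rule mean_abs_le[OF M])
      have "bounded (range (\<lambda>t. A (\<lambda>t. u (t + y)) t + (- 1) * A u t))"
        using bu by (intro bounded_range_intros bA) 
      then show "bounded (range (\<lambda>t. A (\<lambda>t. u (t + y)) t - A u t))" by simp
      fix t
      have "\<bar>u (t + int_mult (int (Suc n)) y) - u t\<bar> \<le> 2"
        using u[rule_format, of "t + int_mult (int (Suc n)) y"] u[rule_format, of t] by linarith
      then show "\<bar>A (\<lambda>t. u (t + y)) t - A u t\<bar> \<le> 2 / Suc n"
        unfolding tele by (simp add: divide_right_mono)
    qed
    then show ?thesis using mean_diff[OF M bA[OF bounded_range_shift[OF bu, of y]] bA[OF bu]] by simp
  qed
  ultimately show ?case by (intro exI[of _ "\<lambda>u. M (A u)"]) auto
qed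

text \<open>
  Tychonoff's theorem for the product topology on functions.
\<close>

lemma compact_box: 
  fixes N :: "'a \<Rightarrow> 'b::t2_space set"
  assumes "\<And>u. compact (N u)" shows "compact {m. \<forall>u. m u \<in> N u}"
proof -
  have "compactin (product_topology (\<lambda>_. euclidean) UNIV) (PiE UNIV N)"
    unfolding compactin_PiE using assms by simp
  moreover have "PiE UNIV N = {m. \<forall>u. m u \<in> N u}" by (auto simp: PiE_def Pi_def)
  ultimately show ?thesis by (simp add: euclidean_product_topology)
qed

text \<open>
  Abelian groups are amenable: the approximate invariance conditions are closed, any finitely many
  of them can be met, and the means form a closed subset of a product of compact intervals.
\<close>

lemma invariant_mean_exists:
  fixes D :: "'g::ab_group_add set"
  assumes D: "add_subgroup D"
  shows "\<exists>M. invariant_mean D M"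
proof -
  define N where "N u = (if bounded (range u) then {- (SUP t. \<bar>u t\<bar>)..SUP t. \<bar>u t\<bar>} else {0})" 
    for u :: "'g \<Rightarrow> real"
  define K where "K = {m. \<forall>u. m u \<in> N u}"
  define F where "F = (\<lambda>(y, n). {M. mean_on D M \<and> (\<forall>u. (\<forall>t. \<bar>u t\<bar> \<le> 1) \<longrightarrow>
           \<bar>M (\<lambda>t. u (t + y)) - M u\<bar> \<le> 2 / Suc n)})"
  have "K \<inter> (\<Inter>p\<in>D \<times> UNIV. F p) \<noteq> {}"
  proof (rule compact_imp_fip_image)
    show "compact K" unfolding K_def by (rule compact_box) (simp add: N_def)
    show "closed (F p)" for p
      unfolding F_def split_def
      by (intro closed_Collect_conj closed_mean_on closed_Collect_all closed_Collect_imp 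
            closed_Collect_le continuous_intros continuous_on_product_coordinates) simp
    fix J assume J: "finite J" "J \<subseteq> D \<times> (UNIV :: nat set)"
    obtain M where M: "mean_on D M" and inv: "\<And>z m u. (z, m) \<in> J \<Longrightarrow> (\<forall>t. \<bar>u t\<bar> \<le> 1) \<Longrightarrow>
           \<bar>M (\<lambda>t. u (t + z)) - M u\<bar> \<le> 2 / Suc m"
      using approximately_invariant_mean[OF D J] by fastforce
    \<comment> \<open>The box \<open>K\<close> prescribes the value 0 at unbounded functions.\<close>
    define M' where "M' u = (if bounded (range u) then M u else 0)" for u :: "'g \<Rightarrow> real"
    have "mean_on D M'" using M unfolding mean_on_def M'_def 
      by (auto simp: bounded_range_intros)
    moreover have "M' \<in> K"
    proof -
      have "M u \<in> N u" if u: "bounded (range u)" for u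
      proof -
        have "bdd_above (range (\<lambda>t. \<bar>u t\<bar>))" using u by (auto simp: bounded_range_real bdd_above_def)
        then have "\<bar>M u\<bar> \<le> (SUP t. \<bar>u t\<bar>)"
          by (intro mean_abs_le[OF M u] cSUP_upper) auto
        then show ?thesis using u by (auto simp: N_def abs_le_iff)
      qed
      then show ?thesis by (auto simp: K_def M'_def N_def)
    qed
    moreover have "\<bar>M' (\<lambda>t. u (t + z)) - M' u\<bar> \<le> 2 / Suc m" 
      if "(z, m) \<in> J" "\<forall>t. \<bar>u t\<bar> \<le> 1" for z m u
    proof -
      have "bounded (range u)" using that by (auto simp: bounded_range_real)
      then show ?thesis using inv[OF that] bounded_range_shift[of u z] by (simp add: M'_def)
    qed
    ultimately have "M' \<in> K \<inter> (\<Inter>p\<in>J. F p)" by (auto simp: F_def)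
    then show "K \<inter> (\<Inter>p\<in>J. F p) \<noteq> {}" by blast
  qed
  then obtain M where MF: "\<And>y n. y \<in> D \<Longrightarrow> M \<in> F (y, n)" by auto
  have M: "mean_on D M" using MF[OF add_subgroup_0[OF D], of 0] by (simp add: F_def)
  moreover have "M (\<lambda>t. u (t + y)) = M u" if y: "y \<in> D" and u: "bounded (range u)" for u y
  proof -
    obtain C where C: "\<And>t. \<bar>u t\<bar> \<le> C" using u by (auto simp: bounded_range_real)
    define B where "B = max C 1"
    have B: "B > 0" "\<And>t. \<bar>u t\<bar> \<le> B" using C by (auto simp: B_def max.coboundedI1)
    have "\<bar>M (\<lambda>t. u (t + y)) - M u\<bar> \<le> B * (2 / Suc n)" for n
    proof -
      have "\<bar>M (\<lambda>t. (1 / B) * u (t + y)) - M (\<lambda>t. (1 / B) * u t)\<bar> \<le> 2 / Suc n"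
      proof -
        have "\<forall>t. \<bar>(1 / B) * u t\<bar> \<le> 1" using B by (simp add: abs_mult)
        then show ?thesis using MF[OF y, of n] unfolding F_def by fast
      qed
      then have "\<bar>(M (\<lambda>t. u (t + y)) - M u) / B\<bar> \<le> 2 / Suc n"
        using mean_scale[OF M u, of "1 / B"] mean_scale[OF M bounded_range_shift[OF u, of y], of "1 / B"]
        by (simp add: diff_divide_distrib)
      then show ?thesis using B by (simp add: field_simps)
    qed
    moreover have "(\<lambda>n. B * (2 / Suc n)) \<longlonglongrightarrow> B * 0"
      by (intro tendsto_intros LIMSEQ_Suc lim_const_over_n)
    ultimately have "\<bar>M (\<lambda>t. u (t + y)) - M u\<bar> \<le> B * 0"
      by (intro LIMSEQ_le_const) auto
    then show ?thesis by simp
  qed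
  ultimately show ?thesis unfolding invariant_mean_def by blast
qed

section \<open>Positive definite functions\<close>

text \<open>
  Membership of the quadratic form in \<open>\<real>\<^sub>\<ge>\<^sub>0\<close> states that it is real as well as nonnegative; this
  gives \<open>\<psi> (- y) = cnj (\<psi> y)\<close> as a consequence.
\<close>

definition pd_on :: "'g::ab_group_add set \<Rightarrow> ('g \<Rightarrow> complex) \<Rightarrow> bool" where
  "pd_on D \<psi> \<longleftrightarrow> (\<forall>(n::nat) s c. (\<forall>i<n. s i \<in> D) \<longrightarrow>
     (\<Sum>i<n. \<Sum>j<n. c i * cnj (c j) * \<psi> (s i - s j)) \<in> \<real>\<^sub>\<ge>\<^sub>0)"

text \<open>
  Quadratic forms over pairs of indices occur below; this frees the definition from its indexing
  by initial segments of the natural numbers.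
\<close>

lemma pd_on_family:
  assumes pd: "pd_on D \<psi>" and "finite I" and s: "\<And>i. i \<in> I \<Longrightarrow> s i \<in> D"
  shows "(\<Sum>i\<in>I. \<Sum>j\<in>I. c i * cnj (c j) * \<psi> (s i - s j)) \<in> \<real>\<^sub>\<ge>\<^sub>0"
proof -
  obtain h where h: "bij_betw h {..<card I} I"
    using ex_bij_betw_nat_finite[OF \<open>finite I\<close>] by (auto simp: atLeast0LessThan)
  have "s (h i) \<in> D" if "i < card I" for i
    using h that s by (auto simp: bij_betw_def)
  then have "(\<Sum>i<card I. \<Sum>j<card I. (c \<circ> h) i * cnj ((c \<circ> h) j) * \<psi> ((s \<circ> h) i - (s \<circ> h) j)) \<in> \<real>\<^sub>\<ge>\<^sub>0"
    using pd unfolding pd_on_def by auto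
  also have "(\<Sum>i<card I. \<Sum>j<card I. (c \<circ> h) i * cnj ((c \<circ> h) j) * \<psi> ((s \<circ> h) i - (s \<circ> h) j)) =
      (\<Sum>i<card I. \<Sum>j\<in>I. c (h i) * cnj (c j) * \<psi> (s (h i) - s j))"
    by (intro sum.cong refl) (simp add: sum.reindex_bij_betw[OF h, symmetric])
  also have "\<dots> = (\<Sum>i\<in>I. \<Sum>j\<in>I. c i * cnj (c j) * \<psi> (s i - s j))"
    by (rule sum.reindex_bij_betw[OF h])
  finally show ?thesis .
qed

lemma nonneg_Reals_sum: "(\<And>i. i \<in> I \<Longrightarrow> f i \<in> \<real>\<^sub>\<ge>\<^sub>0) \<Longrightarrow> sum f I \<in> \<real>\<^sub>\<ge>\<^sub>0"
  by (induction I rule: infinite_finite_induct) auto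

lemma pd_on_two_points:
  assumes "pd_on D \<psi>" "0 \<in> D" "y \<in> D"
  shows "(a * cnj a + b * cnj b) * \<psi> 0 + a * cnj b * \<psi> y + b * cnj a * \<psi> (- y) \<in> \<real>\<^sub>\<ge>\<^sub>0"
proof -
  have "(\<Sum>i\<in>{True, False}. \<Sum>j\<in>{True, False}. (if i then a else b) * cnj (if j then a else b) * 
          \<psi> ((if i then y else 0) - (if j then y else 0))) \<in> \<real>\<^sub>\<ge>\<^sub>0"
    by (rule pd_on_family[OF assms(1)]) (use assms in auto)
  then show ?thesis by (simp add: algebra_simps)
qed

lemma pd_on_0: assumes "pd_on D \<psi>" "0 \<in> D" shows "\<psi> 0 \<in> \<real>\<^sub>\<ge>\<^sub>0"
  using pd_on_two_points[OF assms(1,2,2), of 1 0] by simp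

lemma pd_on_minus:
  assumes "pd_on D \<psi>" "0 \<in> D" "y \<in> D" shows "\<psi> (- y) = cnj (\<psi> y)"
  using pd_on_0[OF assms(1,2)] pd_on_two_points[OF assms, of 1 1] pd_on_two_points[OF assms, of \<i> 1]
  by (auto simp: complex_eq_iff complex_nonneg_Reals_iff)

lemma pd_on_norm_le:
  assumes "pd_on D \<psi>" "0 \<in> D" "y \<in> D" shows "norm (\<psi> y) \<le> Re (\<psi> 0)"
proof (cases "\<psi> y = 0")
  case True
  then show ?thesis using pd_on_0[OF assms(1,2)] by (simp add: complex_nonneg_Reals_iff)
next
  case False
  \<comment> \<open>The phase \<open>a\<close> makes both off-diagonal terms of the form for \<open>y\<close>, \<open>0\<close> equal to \<open>- norm (\<psi> y)\<close>.\<close>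
  define a where "a = - (cnj (\<psi> y) / norm (\<psi> y))"
  have a1: "a * \<psi> y = - of_real (norm (\<psi> y))"
    using False complex_norm_square[of "\<psi> y"] by (simp add: a_def mult.commute power2_eq_square divide_eq_eq)
  then have a2: "cnj a * cnj (\<psi> y) = - of_real (norm (\<psi> y))"
    by (metis complex_cnj_complex_of_real complex_cnj_minus complex_cnj_mult)
  have a3: "a * cnj a = 1" using False complex_norm_square[of "\<psi> y"]
    by (simp add: a_def mult.commute power2_eq_square divide_eq_eq)
  have "(1 + 1) * \<psi> 0 + a * \<psi> y + cnj a * cnj (\<psi> y) \<in> \<real>\<^sub>\<ge>\<^sub>0"
    using pd_on_two_points[OF assms, of a 1] pd_on_minus[OF assms] by (simp add: a3)
  then show ?thesis by (simp add: a1 a2 complex_nonneg_Reals_iff)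
qed

text \<open>
  Points in different cosets of \<open>D\<close> do not interact, so the quadratic form splits into one form for
  each coset; moving a coset into \<open>D\<close> by a representative leaves all differences unchanged.
\<close>

lemma pd_on_extend_zero:
  fixes D :: "'g::ab_group_add set"
  assumes D: "add_subgroup D" and pd: "pd_on D \<psi>"
  shows "pd_on UNIV (\<lambda>y. if y \<in> D then \<psi> y else 0)"
  unfolding pd_on_def
proof (intro allI impI)
  fix n :: nat and s :: "nat \<Rightarrow> 'g" and c :: "nat \<Rightarrow> complex"
  define \<rho> where "\<rho> a = (SOME b. a - b \<in> D)" for a :: 'g
  have \<rho>: "a - \<rho> a \<in> D" for a
    unfolding \<rho>_def by (rule someI[of _ a]) (simp add: add_subgroup_0[OF D])
  have \<rho>_eq: "\<rho> a = \<rho> b \<longleftrightarrow> a - b \<in> D" for a b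
  proof
    assume ab: "a - b \<in> D"
    have "a - x \<in> D \<longleftrightarrow> b - x \<in> D" for x
      using add_subgroup_add[OF D ab, of "b - x"] add_subgroup_diff[OF D _ ab, of "a - x"] by auto
    then show "\<rho> a = \<rho> b" by (simp add: \<rho>_def)
  next
    assume "\<rho> a = \<rho> b"
    then show "a - b \<in> D" using add_subgroup_diff[OF D \<rho>[of a] \<rho>[of b]] by simp
  qed
  define Q where "Q = (\<rho> \<circ> s) ` {..<n}"
  define d where "d q i = (if \<rho> (s i) = q then c i else 0)" for q i
  have "(\<Sum>i<n. \<Sum>j<n. c i * cnj (c j) * (if s i - s j \<in> D then \<psi> (s i - s j) else 0)) =
      (\<Sum>i<n. \<Sum>j<n. \<Sum>q\<in>Q. d q i * cnj (d q j) * \<psi> ((s i - \<rho> (s i)) - (s j - \<rho> (s j))))"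
  proof (intro sum.cong refl)
    fix i j assume ij: "i \<in> {..<n}" "j \<in> {..<n}"
    have "(\<Sum>q\<in>Q. d q i * cnj (d q j) * \<psi> ((s i - \<rho> (s i)) - (s j - \<rho> (s j)))) =
          (\<Sum>q\<in>Q. if q = \<rho> (s i) then c i * cnj (d (\<rho> (s i)) j) * \<psi> ((s i - \<rho> (s i)) - (s j - \<rho> (s j))) else 0)"
      by (intro sum.cong refl) (auto simp: d_def)
    also have "\<dots> = c i * cnj (d (\<rho> (s i)) j) * \<psi> ((s i - \<rho> (s i)) - (s j - \<rho> (s j)))"
      using ij by (subst sum.delta) (auto simp: Q_def)
    also have "\<dots> = c i * cnj (c j) * (if s i - s j \<in> D then \<psi> (s i - s j) else 0)"
      using \<rho>_eq[of "s j" "s i"] \<rho>_eq[of "s i" "s j"] by (auto simp: d_def)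
    finally show "c i * cnj (c j) * (if s i - s j \<in> D then \<psi> (s i - s j) else 0) =
      (\<Sum>q\<in>Q. d q i * cnj (d q j) * \<psi> ((s i - \<rho> (s i)) - (s j - \<rho> (s j))))" by simp
  qed
  also have "\<dots> = (\<Sum>q\<in>Q. \<Sum>i<n. \<Sum>j<n. d q i * cnj (d q j) * \<psi> ((s i - \<rho> (s i)) - (s j - \<rho> (s j))))"
    by (simp only: sum.swap[of _ Q "{..<n}"])
  also have "\<dots> \<in> \<real>\<^sub>\<ge>\<^sub>0"
    by (intro nonneg_Reals_sum pd_on_family[OF pd] finite_lessThan \<rho>)
  finally show "(\<Sum>i<n. \<Sum>j<n. c i * cnj (c j) * (if s i - s j \<in> D then \<psi> (s i - s j) else 0)) \<in> \<real>\<^sub>\<ge>\<^sub>0" .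
qed

text \<open>
  Convolution with the Fejer kernel of length \<open>n + 1\<close> in the direction \<open>y\<close>, where the argument is
  the pair \<open>(y, n)\<close>: the average of the translates of \<open>\<theta>\<close> by all differences of two of the points
  \<open>0, y, \<dots>, n y\<close>.
\<close>

definition fejer :: "'g::ab_group_add \<times> nat \<Rightarrow> ('g \<Rightarrow> complex) \<Rightarrow> 'g \<Rightarrow> complex" where
  "fejer p \<theta> r = (\<Sum>i<Suc (snd p). \<Sum>j<Suc (snd p). \<theta> (r + int_mult (int i - int j) (fst p))) / (Suc (snd p))\<^sup>2"

lemma pd_on_fejer:
  fixes D :: "'g::ab_group_add set"
  assumes D: "add_subgroup D" and pd: "pd_on D \<theta>" and y: "fst p \<in> D"
  shows "pd_on D (fejer p \<theta>)"
  unfolding pd_on_def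
proof (intro allI impI)
  fix n :: nat and s :: "nat \<Rightarrow> 'g" and c :: "nat \<Rightarrow> complex" assume s: "\<forall>i<n. s i \<in> D"
  define m where "m = Suc (snd p)"
  define a where "a i = int_mult (int i) (fst p)" for i
  have aD: "a i \<in> D" for i unfolding a_def by (rule add_subgroup_int_mult[OF D y])
  have f: "fejer p \<theta> (s k - s l) = (\<Sum>i<m. \<Sum>j<m. \<theta> ((s k + a i) - (s l + a j))) / m\<^sup>2" for k l
    by (simp add: fejer_def m_def a_def int_mult_diff_left algebra_simps del: sum.lessThan_Suc)
  have "(\<Sum>k<n. \<Sum>l<n. c k * cnj (c l) * fejer p \<theta> (s k - s l)) =
     (\<Sum>k<n. \<Sum>l<n. \<Sum>i<m. \<Sum>j<m. c k * cnj (c l) * \<theta> ((s k + a i) - (s l + a j))) / m\<^sup>2"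
    by (simp add: f sum_distrib_left sum_divide_distrib)
  also have "(\<Sum>k<n. \<Sum>l<n. \<Sum>i<m. \<Sum>j<m. c k * cnj (c l) * \<theta> ((s k + a i) - (s l + a j))) =
     (\<Sum>k<n. \<Sum>i<m. \<Sum>l<n. \<Sum>j<m. c k * cnj (c l) * \<theta> ((s k + a i) - (s l + a j)))"
    by (intro sum.cong refl sum.swap)
  also have "\<dots> = (\<Sum>p\<in>{..<n}\<times>{..<m}. \<Sum>q\<in>{..<n}\<times>{..<m}. 
       c (fst p) * cnj (c (fst q)) * \<theta> ((s (fst p) + a (snd p)) - (s (fst q) + a (snd q))))"
    by (simp add: sum.cartesian_product')
  also have "\<dots> / m\<^sup>2 \<in> \<real>\<^sub>\<ge>\<^sub>0"
  proof (rule nonneg_Reals_divide_I)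
    show "(\<Sum>p\<in>{..<n}\<times>{..<m}. \<Sum>q\<in>{..<n}\<times>{..<m}. 
       c (fst p) * cnj (c (fst q)) * \<theta> ((s (fst p) + a (snd p)) - (s (fst q) + a (snd q)))) \<in> \<real>\<^sub>\<ge>\<^sub>0"
      by (rule pd_on_family[OF pd]) (use s in \<open>auto intro!: add_subgroup_add[OF D] aD\<close>)
  qed (metis nonneg_Reals_of_nat_I)
  finally show "(\<Sum>k<n. \<Sum>l<n. c k * cnj (c l) * fejer p \<theta> (s k - s l)) \<in> \<real>\<^sub>\<ge>\<^sub>0" .
qed

text \<open>
  A positive definite function is largest at \<open>0\<close>, and the value of \<open>fejer\<close> at \<open>0\<close> is an average of
  values.
\<close>

lemma fejer_zero_le:
  assumes D: "add_subgroup D" and pd: "pd_on D \<theta>" and y: "fst p \<in> D"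
  shows "Re (fejer p \<theta> 0) \<le> Re (\<theta> 0)"
proof -
  define m where "m = Suc (snd p)"
  have "norm (\<Sum>i<m. \<Sum>j<m. \<theta> (0 + int_mult (int i - int j) (fst p))) \<le> (\<Sum>i<m. \<Sum>j<m. Re (\<theta> 0))"
    by (intro order.trans[OF norm_sum] sum_mono pd_on_norm_le[OF pd add_subgroup_0[OF D]])
       (simp add: add_subgroup_int_mult[OF D y])
  moreover have "norm (complex_of_nat (m\<^sup>2)) = (real m)\<^sup>2" by (metis norm_of_nat of_nat_power)
  moreover have "(real m)\<^sup>2 > 0" by (simp add: m_def)
  ultimately have "norm (fejer p \<theta> 0) \<le> Re (\<theta> 0)"
    unfolding fejer_def m_def[symmetric] norm_divide
    by (simp add: divide_le_eq power2_eq_square mult_ac)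
  then show ?thesis using complex_Re_le_cmod order.trans by blast
qed

lemma fejer_commute: "fejer p (fejer q \<theta>) = fejer q (fejer p \<theta>)"
proof
  fix r
  define m n where "m = Suc (snd p)" and "n = Suc (snd q)"
  define a b where "a i j = int_mult (int i - int j) (fst p)" 
     and "b i j = int_mult (int i - int j) (fst q)" for i j
  have "(\<Sum>i<m. \<Sum>j<m. \<Sum>k<n. \<Sum>l<n. \<theta> (r + a i j + b k l)) = 
        (\<Sum>i<m. \<Sum>k<n. \<Sum>j<m. \<Sum>l<n. \<theta> (r + a i j + b k l))"
    by (intro sum.cong refl sum.swap)
  also have "\<dots> = (\<Sum>k<n. \<Sum>i<m. \<Sum>l<n. \<Sum>j<m. \<theta> (r + a i j + b k l))"
    by (subst sum.swap) (intro sum.cong refl sum.swap)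
  also have "\<dots> = (\<Sum>k<n. \<Sum>l<n. \<Sum>i<m. \<Sum>j<m. \<theta> (r + a i j + b k l))"
    by (intro sum.cong refl sum.swap)
  finally have "(\<Sum>i<m. \<Sum>j<m. \<Sum>k<n. \<Sum>l<n. \<theta> (r + a i j + b k l)) = 
      (\<Sum>k<n. \<Sum>l<n. \<Sum>i<m. \<Sum>j<m. \<theta> (r + b k l + a i j))"
    by (simp add: add.assoc add.commute add.left_commute)
  then show "fejer p (fejer q \<theta>) r = fejer q (fejer p \<theta>) r"
    unfolding fejer_def m_def[symmetric] n_def[symmetric] a_def[symmetric] b_def[symmetric]
    by (simp add: sum_divide_distrib[symmetric] mult.commute)
qed

lemma foldr_fejer_commute: "foldr fejer xs (foldr fejer ys \<theta>) = foldr fejer ys (foldr fejer xs \<theta>)"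
proof -
  have 1: "fejer p (foldr fejer ys \<theta>) = foldr fejer ys (fejer p \<theta>)" for p ys \<theta>
    by (induction ys) (simp_all add: fejer_commute)
  show ?thesis by (induction xs) (simp_all add: 1)
qed

lemma pd_on_foldr_fejer:
  assumes "add_subgroup D" "pd_on D \<theta>" "fst ` set xs \<subseteq> D"
  shows "pd_on D (foldr fejer xs \<theta>)"
  using assms(3) by (induction xs) (auto intro!: pd_on_fejer assms)

lemma foldr_fejer_zero_le:
  assumes "add_subgroup D" "pd_on D \<theta>" "fst ` set xs \<subseteq> D"
  shows "Re (foldr fejer xs \<theta> 0) \<le> Re (\<theta> 0)"
  using assms(3)
proof (induction xs)
  case (Cons p xs)
  then show ?case using fejer_zero_le[OF assms(1) pd_on_foldr_fejer[OF assms(1,2), of xs], of p] by auto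
qed simp

lemma fejer_linear: "fejer p (\<lambda>r. a * \<theta> r + b * \<theta>' r) = (\<lambda>r. a * fejer p \<theta> r + b * fejer p \<theta>' r)"
  by (simp add: fejer_def sum.distrib sum_distrib_left[symmetric] add_divide_distrib fun_eq_iff del: sum.lessThan_Suc)

lemma foldr_fejer_linear:
  "foldr fejer xs (\<lambda>r. a * \<theta> r + b * \<theta>' r) = (\<lambda>r. a * foldr fejer xs \<theta> r + b * foldr fejer xs \<theta>' r)"
  by (induction xs) (simp_all add: fejer_linear)

lemma continuous_on_foldr_fejer: 
  assumes "\<And>r. continuous_on A (\<lambda>\<psi>. F \<psi> r)"
  shows "continuous_on A (\<lambda>\<psi>. foldr fejer xs (F \<psi>) r)"
proof (induction xs arbitrary: r)
  case (Cons p xs)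
  show ?case unfolding foldr.simps o_def fejer_def[of p]
    by (intro continuous_intros Cons) (simp del: of_nat_power)
qed (simp add: assms)

section \<open>Extreme positive definite functions are characters\<close>

definition normalized_pd :: "('g::ab_group_add \<Rightarrow> complex) set" where
  "normalized_pd = {\<psi>. pd_on UNIV \<psi> \<and> \<psi> 0 = 1}"

text \<open>
  Extremal subsets in the sense of the Krein-Milman theorem. Asking for the membership of \<open>\<psi>1\<close> alone
  suffices because \<open>t\<close> may be replaced by \<open>1 - t\<close>.
\<close>

definition extremal :: "('a \<Rightarrow> complex) set \<Rightarrow> ('a \<Rightarrow> complex) set \<Rightarrow> bool" where
  "extremal P F \<longleftrightarrow> F \<subseteq> P \<and> (\<forall>\<psi>\<in>F. \<forall>\<psi>1\<in>P. \<forall>\<psi>2\<in>P. \<forall>t. 0 < t \<longrightarrow> t < 1 \<longrightarrow>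
     \<psi> = (\<lambda>y. of_real t * \<psi>1 y + of_real (1 - t) * \<psi>2 y) \<longrightarrow> \<psi>1 \<in> F)"

lemma extremalD:
  assumes "extremal P F" "\<psi> \<in> F" "\<psi>1 \<in> P" "\<psi>2 \<in> P" "0 < t" "t < 1"
    "\<psi> = (\<lambda>y. of_real t * \<psi>1 y + of_real (1 - t) * \<psi>2 y)"
  shows "\<psi>1 \<in> F" "\<psi>2 \<in> F"
proof -
  show "\<psi>1 \<in> F" using assms unfolding extremal_def by blast
  have "\<psi> = (\<lambda>y. of_real (1 - t) * \<psi>2 y + of_real (1 - (1 - t)) * \<psi>1 y)"
    using assms(7) by (simp add: add.commute)
  moreover have "0 < 1 - t" "1 - t < 1" using assms by auto
  ultimately show "\<psi>2 \<in> F" using assms(1-4) unfolding extremal_def by blast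
qed

lemma extremal_maximizers:
  assumes F: "extremal P F" 
    and lin: "\<And>t \<psi>1 \<psi>2. l (\<lambda>y. of_real t * \<psi>1 y + of_real (1 - t) * \<psi>2 y) = t * l \<psi>1 + (1 - t) * (l \<psi>2 :: real)"
  shows "extremal P {\<psi>\<in>F. \<forall>\<phi>\<in>F. l \<phi> \<le> l \<psi>}"
  unfolding extremal_def
proof (intro conjI ballI allI impI)
  show "{\<psi>\<in>F. \<forall>\<phi>\<in>F. l \<phi> \<le> l \<psi>} \<subseteq> P" using F by (auto simp: extremal_def)
  fix \<psi> \<psi>1 \<psi>2 t assume \<psi>: "\<psi> \<in> {\<psi>\<in>F. \<forall>\<phi>\<in>F. l \<phi> \<le> l \<psi>}" and P: "\<psi>1 \<in> P" "\<psi>2 \<in> P"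
    and t: "0 < t" "t < 1" and eq: "\<psi> = (\<lambda>y. of_real t * \<psi>1 y + of_real (1 - t) * \<psi>2 y)"
  have F12: "\<psi>1 \<in> F" "\<psi>2 \<in> F" using extremalD[OF F _ P t eq] \<psi> by auto
  have "l \<psi> = t * l \<psi>1 + (1 - t) * l \<psi>2" unfolding eq by (rule lin)
  moreover have "(1 - t) * l \<psi>2 \<le> (1 - t) * l \<psi>" using \<psi> F12 t by (intro mult_left_mono) auto
  ultimately have "t * l \<psi> \<le> t * l \<psi>1" by (simp add: algebra_simps)
  then have "l \<psi> \<le> l \<psi>1" using t by simp
  then show "\<psi>1 \<in> {\<psi>\<in>F. \<forall>\<phi>\<in>F. l \<phi> \<le> l \<psi>}" using \<psi> F12 by (auto intro: order.trans)
qed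

text \<open>
  A minimal nonempty closed extremal subset is a single point: real and imaginary parts of the
  evaluations are continuous and affine, the maximizers of such a functional form a smaller closed
  extremal set, and so every evaluation is constant on a minimal one.
\<close>

lemma extreme_point_exists:
  fixes P :: "('a \<Rightarrow> complex) set"
  assumes P: "compact P" and F0: "closed F0" "F0 \<noteq> {}" "extremal P F0"
  shows "\<exists>\<psi>\<in>F0. extremal P {\<psi>}"
proof -
  define \<A> where "\<A> = {F. closed F \<and> F \<noteq> {} \<and> F \<subseteq> F0 \<and> extremal P F}"
  \<comment> \<open>Zorn's lemma is applied to complements, which turns minimal into maximal sets.\<close>
  have "\<exists>M\<in>uminus ` \<A>. \<forall>X\<in>uminus ` \<A>. M \<subseteq> X \<longrightarrow> X = M"
  proof (rule subset_Zorn_nonempty)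
    show "uminus ` \<A> \<noteq> {}" using F0 by (auto simp: \<A>_def)
    fix \<C> assume ne: "\<C> \<noteq> {}" and ch: "subset.chain (uminus ` \<A>) \<C>"
    have mem: "- C \<in> \<A>" if "C \<in> \<C>" for C
    proof -
      have "C \<in> uminus ` \<A>" using ch that unfolding subset.chain_def by blast
      then show ?thesis by auto
    qed
    define F where "F = (\<Inter>C\<in>\<C>. - C)"
    have "P \<inter> F \<noteq> {}" unfolding F_def
    proof (rule compact_imp_fip_image[OF P])
      show "closed (- C)" if "C \<in> \<C>" for C using mem[OF that] by (simp add: \<A>_def)
      fix I assume I: "finite I" "I \<subseteq> \<C>"
      show "P \<inter> (\<Inter>C\<in>I. - C) \<noteq> {}"
      proof (cases "I = {}")
        case True
        then show ?thesis using F0 by (auto simp: extremal_def)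
      next
        case False
        have "subset.chain (uminus ` \<A>) I" 
          using ch I(2) unfolding subset_chain_def by (meson order.trans subsetD)
        then have "\<Union>I \<in> I" using I False by (intro Union_in_chain)
        then have "- \<Union>I \<in> \<A>" using mem I by blast
        then obtain \<psi> where "\<psi> \<in> - \<Union>I" "\<psi> \<in> P" unfolding \<A>_def extremal_def by blast
        then have "\<psi> \<in> P \<inter> (\<Inter>C\<in>I. - C)" by simp
        then show ?thesis by (metis empty_iff)
      qed
    qed
    then have "F \<noteq> {}" by blast
    moreover have "closed F" using mem unfolding F_def by (intro closed_INT) (auto simp: \<A>_def)
    moreover have "F \<subseteq> F0" using mem ne by (auto simp: F_def \<A>_def)
    moreover have "extremal P F" unfolding extremal_def
    proof (intro conjI ballI allI impI)
      show "F \<subseteq> P" using \<open>F \<subseteq> F0\<close> F0 by (auto simp: extremal_def)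
      fix \<psi> \<psi>1 \<psi>2 t assume "\<psi> \<in> F" "\<psi>1 \<in> P" "\<psi>2 \<in> P" "0 < t" "t < 1"
        "\<psi> = (\<lambda>y. of_real t * \<psi>1 y + of_real (1 - t) * \<psi>2 y)"
      then have "\<psi>1 \<in> - C" if "C \<in> \<C>" for C
        using mem[OF that] that extremalD(1)[of P "- C" \<psi> \<psi>1 \<psi>2 t] by (auto simp: F_def \<A>_def)
      then show "\<psi>1 \<in> F" by (simp add: F_def)
    qed
    ultimately have "F \<in> \<A>" by (simp add: \<A>_def)
    moreover have "\<Union>\<C> = - F" by (auto simp: F_def)
    ultimately show "\<Union>\<C> \<in> uminus ` \<A>" by blast
  qed
  then obtain F where F: "F \<in> \<A>" and min: "\<And>X. X \<in> \<A> \<Longrightarrow> X \<subseteq> F \<Longrightarrow> X = F"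
    by auto
  have FF: "closed F" "F \<noteq> {}" "F \<subseteq> F0" "extremal P F" using F by (auto simp: \<A>_def)
  have "F \<subseteq> P" using FF(4) unfolding extremal_def by (rule conjunct1)
  then have cF: "compact F" using closed_Int_compact[OF FF(1) P] by (simp add: Int_absorb2)
  have const: "l \<psi> = l \<phi>" if "continuous_on UNIV l" 
      and lin: "\<And>t \<psi>1 \<psi>2. l (\<lambda>y. of_real t * \<psi>1 y + of_real (1 - t) * \<psi>2 y) = t * l \<psi>1 + (1 - t) * (l \<psi>2 :: real)"
      and "\<psi> \<in> F" "\<phi> \<in> F" for l \<psi> \<phi>
  proof -
    define X where "X = {\<psi>\<in>F. \<forall>\<phi>\<in>F. l \<phi> \<le> l \<psi>}"
    have "X \<noteq> {}" 
      using continuous_attains_sup[OF cF FF(2) continuous_on_subset[OF that(1)]] by (auto simp: X_def)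
    moreover have "closed (F \<inter> (\<Inter>\<phi>\<in>F. {\<psi>. l \<phi> \<le> l \<psi>}))"
      by (intro closed_Int FF(1) closed_INT ballI closed_Collect_le[OF continuous_on_const that(1)])
    then have "closed X" unfolding X_def by (rule back_subst) auto
    moreover have "extremal P X" unfolding X_def by (rule extremal_maximizers[OF FF(4) lin])
    moreover have "X \<subseteq> F" by (auto simp: X_def)
    ultimately have "X = F" using FF(3) by (intro min) (auto simp: \<A>_def)
    then show ?thesis using that(3,4) by (auto simp: X_def intro: order.antisym)
  qed
  obtain \<psi> where \<psi>: "\<psi> \<in> F" using FF by auto
  have "\<phi> = \<psi>" if \<phi>: "\<phi> \<in> F" for \<phi>
  proof
    fix y
    have "Re (\<phi> y) = Re (\<psi> y)"
      by (rule const[of "\<lambda>\<psi>. Re (\<psi> y)", OF _ _ \<phi> \<psi>])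
         (intro continuous_intros continuous_on_product_coordinates, simp)
    moreover have "Im (\<phi> y) = Im (\<psi> y)"
      by (rule const[of "\<lambda>\<psi>. Im (\<psi> y)", OF _ _ \<phi> \<psi>])
         (intro continuous_intros continuous_on_product_coordinates, simp)
    ultimately show "\<phi> y = \<psi> y" by (simp add: complex_eq_iff)
  qed
  then have "F \<subseteq> {\<psi>}" by (metis singletonI subsetI)
  moreover have "{\<psi>} \<subseteq> F" using \<psi> by simp
  ultimately have "F = {\<psi>}" by (rule equalityI)
  moreover have "\<psi> \<in> F0" using FF(3) \<psi> by (rule subsetD)
  ultimately show ?thesis using FF(4) by metis
qed

lemma closed_normalized_pd: "closed (normalized_pd :: ('g::ab_group_add \<Rightarrow> complex) set)"
  unfolding normalized_pd_def pd_on_def complex_nonneg_Reals_iff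
  by (intro closed_Collect_conj closed_Collect_all closed_Collect_imp closed_Collect_eq 
       closed_Collect_le continuous_intros continuous_on_product_coordinates) simp_all

lemma compact_normalized_pd: "compact (normalized_pd :: ('g::ab_group_add \<Rightarrow> complex) set)"
proof -
  have "compact {\<psi> :: 'g \<Rightarrow> complex. \<forall>y. \<psi> y \<in> cball 0 1}"
    by (rule compact_box) simp
  moreover have "(normalized_pd :: ('g \<Rightarrow> complex) set) \<subseteq> {\<psi>. \<forall>y. \<psi> y \<in> cball 0 1}"
    using pd_on_norm_le[of "UNIV :: 'g set"] by (fastforce simp: normalized_pd_def)
  ultimately show ?thesis using closed_Int_compact[OF closed_normalized_pd] by (metis Int_absorb2)
qed

lemma pd_on_scale: assumes "pd_on D \<psi>" "0 \<le> a" shows "pd_on D (\<lambda>r. of_real a * \<psi> r)"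
  unfolding pd_on_def
proof (intro allI impI)
  fix n :: nat and s c assume "\<forall>i<n. s i \<in> D"
  then have "of_real a * (\<Sum>i<n. \<Sum>j<n. c i * cnj (c j) * \<psi> (s i - s j)) \<in> \<real>\<^sub>\<ge>\<^sub>0"
    using assms unfolding pd_on_def by (intro nonneg_Reals_mult_I) auto
  also have "of_real a * (\<Sum>i<n. \<Sum>j<n. c i * cnj (c j) * \<psi> (s i - s j)) =
     (\<Sum>i<n. \<Sum>j<n. c i * cnj (c j) * (of_real a * \<psi> (s i - s j)))"
    unfolding sum_distrib_left by (intro sum.cong refl) (simp add: mult_ac)
  finally show "(\<Sum>i<n. \<Sum>j<n. c i * cnj (c j) * (of_real a * \<psi> (s i - s j))) \<in> \<real>\<^sub>\<ge>\<^sub>0" .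
qed

text \<open>
  If \<open>\<psi> = Q1 + Q2\<close>, then normalizing the two summands displays \<open>\<psi>\<close> as a convex combination, so both
  are multiples of \<open>\<psi>\<close>. A summand vanishing at \<open>0\<close> is identically zero.
\<close>

lemma extreme_pd_summand:
  fixes \<psi> :: "'g::ab_group_add \<Rightarrow> complex"
  assumes ext: "extremal normalized_pd {\<psi>}" and Q: "pd_on UNIV Q1" "pd_on UNIV Q2"
    and sum: "\<And>r. Q1 r + Q2 r = \<psi> r"
  shows "Q1 r = Q1 0 * \<psi> r"
proof -
  have \<psi>: "\<psi> 0 = 1" using ext by (simp add: extremal_def normalized_pd_def)
  define l m where "l = Re (Q1 0)" and "m = Re (Q2 0)"
  have l: "Q1 0 = of_real l" "0 \<le> l" and m: "Q2 0 = of_real m" "0 \<le> m"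
    using pd_on_0[OF Q(1)] pd_on_0[OF Q(2)] by (auto simp: l_def m_def complex_nonneg_Reals_iff complex_eq_iff)
  have lm: "l + m = 1" using sum[of 0] by (simp add: \<psi> l m flip: of_real_add)
  consider "l = 0" | "m = 0" | "0 < l" "0 < m" using l m by linarith
  then show ?thesis
  proof cases
    case 1
    then show ?thesis using pd_on_norm_le[OF Q(1), of r] by (simp add: l)
  next
    case 2
    then have "Q2 r = 0" using pd_on_norm_le[OF Q(2), of r] by (simp add: m)
    then show ?thesis using sum[of r] 2 lm by (simp add: l)
  next
    case 3
    have ml: "1 - l = m" using lm by simp
    have "(\<lambda>r. of_real (1 / l) * Q1 r) \<in> {\<psi>}"
    proof (rule extremalD(1)[OF ext])
      show "(\<lambda>r. of_real (1 / l) * Q1 r) \<in> normalized_pd" "(\<lambda>r. of_real (1 / m) * Q2 r) \<in> normalized_pd"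
        using 3 pd_on_scale[OF Q(1), of "1 / l"] pd_on_scale[OF Q(2), of "1 / m"] 
        by (auto simp: normalized_pd_def l m)
      show "\<psi> = (\<lambda>y. of_real l * (of_real (1 / l) * Q1 y) + of_real (1 - l) * (of_real (1 / m) * Q2 y))"
        unfolding ml using 3 sum by (simp add: fun_eq_iff)
    qed (use 3 lm in auto)
    then have "of_real (1 / l) * Q1 r = \<psi> r" by (metis singletonD)
    then show ?thesis using 3 by (auto simp: l field_simps)
  qed
qed

text \<open>
  This is \<open>\<psi>\<close> convolved with the measure \<open>(\<delta>\<^sub>0 + u \<delta>\<^sub>y) / 2\<close> and its adjoint. The functions belonging to
  \<open>u\<close> and \<open>- u\<close> add up to \<open>\<psi>\<close>.
\<close>

lemma pd_on_two_translates:
  fixes \<psi> :: "'g::ab_group_add \<Rightarrow> complex"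
  assumes "pd_on UNIV \<psi>" "u * cnj u = 1"
  shows "pd_on UNIV (\<lambda>r. (2 * \<psi> r + u * \<psi> (r + y) + cnj u * \<psi> (r - y)) / 4)"
  unfolding pd_on_def
proof (intro allI impI)
  fix n :: nat and s :: "nat \<Rightarrow> 'g" and c :: "nat \<Rightarrow> complex"
  \<comment> \<open>A point of the convolved form is an index together with a choice of one of the two atoms.\<close>
  define d where "d p = c (fst p) * (if snd p then u else 1) / 2" for p
  define t where "t p = s (fst p) + (if snd p then y else 0)" for p
  have "(\<Sum>p\<in>{..<n} \<times> UNIV. \<Sum>q\<in>{..<n} \<times> UNIV. d p * cnj (d q) * \<psi> (t p - t q)) \<in> \<real>\<^sub>\<ge>\<^sub>0"
    by (rule pd_on_family[OF assms(1)]) auto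
  also have "(\<Sum>p\<in>{..<n} \<times> UNIV. \<Sum>q\<in>{..<n} \<times> UNIV. d p * cnj (d q) * \<psi> (t p - t q)) =
     (\<Sum>i<n. \<Sum>j<n. c i * cnj (c j) * ((2 * \<psi> (s i - s j) + u * \<psi> (s i - s j + y) + cnj u * \<psi> (s i - s j - y)) / 4))"
  proof -
    have pt: "c i * cnj (c j) * ((2 * \<psi> (s i - s j) + u * \<psi> (s i - s j + y) + cnj u * \<psi> (s i - s j - y)) / 4) =
        (d (i, False) * cnj (d (j, False)) * \<psi> (t (i, False) - t (j, False)) +
         d (i, False) * cnj (d (j, True)) * \<psi> (t (i, False) - t (j, True))) +
        (d (i, True) * cnj (d (j, False)) * \<psi> (t (i, True) - t (j, False)) +
         d (i, True) * cnj (d (j, True)) * \<psi> (t (i, True) - t (j, True)))" for i j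
    proof -
      have t: "t (i, False) - t (j, False) = s i - s j" "t (i, False) - t (j, True) = s i - s j - y"
        "t (i, True) - t (j, False) = s i - s j + y" "t (i, True) - t (j, True) = s i - s j"
        by (simp_all add: t_def algebra_simps)
      have "d (i, True) * cnj (d (j, True)) = c i * cnj (c j) * (u * cnj u) / 4"
        by (simp add: d_def)
      also have "\<dots> = c i * cnj (c j) / 4" by (simp add: assms(2))
      finally show ?thesis unfolding t by (simp add: d_def field_simps assms(2))
    qed
    show ?thesis
      unfolding sum.cartesian_product' UNIV_bool pt by (simp add: sum.distrib)
  qed
  finally show "(\<Sum>i<n. \<Sum>j<n. c i * cnj (c j) * ((2 * \<psi> (s i - s j) + u * \<psi> (s i - s j + y) + cnj u * \<psi> (s i - s j - y)) / 4)) \<in> \<real>\<^sub>\<ge>\<^sub>0" .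
qed

text \<open>
  For an extreme \<open>\<psi>\<close>, the decompositions into convolved functions for \<open>u = 1\<close> and \<open>u = \<i>\<close> must be
  trivial. They express \<open>\<psi> (r + y) + \<psi> (r - y)\<close> and \<open>\<psi> (r + y) - \<psi> (r - y)\<close> as multiples of \<open>\<psi> r\<close>; the sum
  of the two is multiplicativity.
\<close>

lemma extreme_pd_is_character:
  fixes \<psi> :: "'g::ab_group_add \<Rightarrow> complex"
  assumes ext: "extremal normalized_pd {\<psi>}"
  shows "is_character \<psi>"
proof -
  have pd: "pd_on UNIV \<psi>" and \<psi>: "\<psi> 0 = 1" using ext by (auto simp: extremal_def normalized_pd_def)
  have *: "u * \<psi> (r + y) + cnj u * \<psi> (r - y) = (u * \<psi> y + cnj u * \<psi> (- y)) * \<psi> r" 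
    if "u * cnj u = 1" for u r y
  proof -
    have "4 * (u * \<psi> (r + y) + cnj u * \<psi> (r - y)) = 4 * ((u * \<psi> y + cnj u * \<psi> (- y)) * \<psi> r)" 
      using extreme_pd_summand[OF ext pd_on_two_translates[OF pd that, of y] 
          pd_on_two_translates[OF pd, of "- u" y], of r] that
      by (simp add: \<psi> field_simps)
    then show ?thesis by (simp only: mult_cancel_left) simp
  qed
  have mult: "\<psi> (r + y) = \<psi> r * \<psi> y" for r y
  proof -
    have "\<i> * (\<psi> (r + y) - \<psi> (r - y)) = \<i> * ((\<psi> y - \<psi> (- y)) * \<psi> r)"
      using *[of \<i> r y] by (simp add: algebra_simps)
    then have minus: "\<psi> (r + y) - \<psi> (r - y) = (\<psi> y - \<psi> (- y)) * \<psi> r"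
      by (simp only: mult_cancel_left) simp
    have plus: "\<psi> (r + y) + \<psi> (r - y) = (\<psi> y + \<psi> (- y)) * \<psi> r"
      using *[of 1 r y] by simp
    have "2 * \<psi> (r + y) = (\<psi> (r + y) - \<psi> (r - y)) + (\<psi> (r + y) + \<psi> (r - y))" by simp
    also have "\<dots> = 2 * (\<psi> r * \<psi> y)" unfolding minus plus by (simp add: algebra_simps)
    finally have "2 * \<psi> (r + y) = 2 * (\<psi> r * \<psi> y)" .
    then show ?thesis by simp
  qed
  moreover have "norm (\<psi> y) = 1" for y
  proof -
    have le: "norm (\<psi> z) \<le> 1" for z using pd_on_norm_le[OF pd, of z] \<psi> by simp
    have "\<psi> y * \<psi> (- y) = 1" using mult[of y "- y"] \<psi> by simp
    then have "norm (\<psi> y) * norm (\<psi> (- y)) = 1" by (metis norm_mult norm_one)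
    moreover have "norm (\<psi> y) * norm (\<psi> (- y)) \<le> norm (\<psi> y) * 1"
      by (intro mult_left_mono le) simp
    ultimately show ?thesis using le[of y] by simp
  qed
  ultimately show ?thesis by (simp add: is_character_def)
qed

section \<open>Almost periodic functions and autocorrelation\<close>

text \<open>
  Almost periodicity in the sense of Bohr: the translates of \<open>f\<close> by \<open>D\<close> form a totally bounded set
  in the supremum norm over \<open>D\<close>.
\<close>

definition almost_periodic_on :: "'g::ab_group_add set \<Rightarrow> ('g \<Rightarrow> real) \<Rightarrow> bool" where
  "almost_periodic_on D f \<longleftrightarrow> (\<forall>e>0. \<exists>B. finite B \<and> B \<subseteq> D \<and>
     (\<forall>t\<in>D. \<exists>b\<in>B. \<forall>s\<in>D. \<bar>f (s + t) - f (s + b)\<bar> \<le> e))"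

text \<open>
  For every \<open>t\<close>, some \<open>b\<close> from a finite set brings \<open>f (t + b)\<close> close to \<open>f 0\<close>. Therefore a finite
  sum of translates of \<open>f\<^sup>2\<close> is bounded below by a positive constant, and all these translates have the
  same mean.
\<close>

lemma mean_square_pos:
  assumes D: "add_subgroup D" and M: "invariant_mean D M" and bdd: "bounded (range f)"
    and ap: "almost_periodic_on D f" and nz: "f 0 \<noteq> 0"
  shows "0 < M (\<lambda>t. f t * f t)"
proof -
  define e where "e = \<bar>f 0\<bar> / 2"
  have e: "e > 0" using nz by (simp add: e_def)
  obtain B where B: "finite B" "B \<subseteq> D" "\<And>t. t \<in> D \<Longrightarrow> \<exists>b\<in>B. \<forall>s\<in>D. \<bar>f (s + t) - f (s + b)\<bar> \<le> e"
    using ap[unfolded almost_periodic_on_def, rule_format, OF e] by auto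
  note Mm = mean_on_invariant_mean[OF M]
  have "M (\<lambda>_. e * e) \<le> M (\<lambda>t. \<Sum>b\<in>B. f (t + b) * f (t + b))"
  proof (rule mean_mono[OF Mm])
    fix t assume t: "t \<in> D"
    obtain b where b: "b \<in> B" "\<And>s. s \<in> D \<Longrightarrow> \<bar>f (s - t) - f (s + b)\<bar> \<le> e"
      \<comment> \<open>The net is applied to \<open>- t\<close>; taking \<open>s = t\<close> then compares \<open>f 0\<close> with \<open>f (t + b)\<close>.\<close>
      using B(3)[OF add_subgroup_minus[OF D t]] by auto
    have "\<bar>f 0 - f (t + b)\<bar> \<le> e" using b(2)[OF t] by simp
    then have "e \<le> \<bar>f (t + b)\<bar>" unfolding e_def by linarith
    then have "e * e \<le> \<bar>f (t + b)\<bar> * \<bar>f (t + b)\<bar>" using e by (intro mult_mono) auto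
    also have "\<dots> = f (t + b) * f (t + b)" by simp
    also have "\<dots> \<le> (\<Sum>b\<in>B. f (t + b) * f (t + b))"
      using b(1) B(1) by (intro member_le_sum) auto
    finally show "e * e \<le> (\<Sum>b\<in>B. f (t + b) * f (t + b))" .
  qed (intro bounded_range_intros bdd)+
  also have "\<dots> = (\<Sum>b\<in>B. M (\<lambda>t. f (t + b) * f (t + b)))"
    by (rule mean_sum[OF Mm]) (intro bounded_range_intros bdd)
  also have "\<dots> = (\<Sum>b\<in>B. M (\<lambda>t. f t * f t))"
    using B(2) mean_shift[OF M bounded_range_mult[OF bdd bdd]] by (intro sum.cong refl) auto
  also have "\<dots> = card B * M (\<lambda>t. f t * f t)" by simp
  finally have "e * e \<le> card B * M (\<lambda>t. f t * f t)" by (simp add: mean_const[OF Mm])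
  moreover have "0 < e * e" using e by simp
  ultimately have "0 < card B * M (\<lambda>t. f t * f t)" by linarith
  then show ?thesis by (simp add: zero_less_mult_iff)
qed

definition autocorr :: "(('g::ab_group_add \<Rightarrow> real) \<Rightarrow> real) \<Rightarrow> ('g \<Rightarrow> real) \<Rightarrow> 'g \<Rightarrow> real" where
  "autocorr M g y = M (\<lambda>t. g t * g (t + y))"

lemma autocorr_diff:
  assumes M: "invariant_mean D M" and g: "bounded (range g)" and "b \<in> D"
  shows "autocorr M g (a - b) = M (\<lambda>t. g (t + a) * g (t + b))"
proof -
  have "M (\<lambda>t. g (t + b) * g (t + b + (a - b))) = M (\<lambda>t. g t * g (t + (a - b)))"
    by (rule mean_shift[OF M _ \<open>b \<in> D\<close>]) (intro bounded_range_intros g)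
  then show ?thesis by (simp add: autocorr_def mult.commute)
qed

lemma autocorr_quadratic_form:
  assumes M: "invariant_mean D M" and g: "bounded (range g)" and s: "\<And>i. i \<in> I \<Longrightarrow> s i \<in> D" 
  shows "(\<Sum>i\<in>I. \<Sum>j\<in>I. a i j * autocorr M g (s i - s j)) = 
         M (\<lambda>t. \<Sum>i\<in>I. \<Sum>j\<in>I. a i j * (g (t + s i) * g (t + s j)))"
proof -
  note Mm = mean_on_invariant_mean[OF M]
  have "(\<Sum>i\<in>I. \<Sum>j\<in>I. a i j * autocorr M g (s i - s j)) = 
        (\<Sum>i\<in>I. \<Sum>j\<in>I. M (\<lambda>t. a i j * (g (t + s i) * g (t + s j))))"
    using s by (intro sum.cong refl)
      (simp add: autocorr_diff[OF M g] mean_scale[OF Mm bounded_range_mult[OF bounded_range_shift[OF g] bounded_range_shift[OF g]]])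
  also have "\<dots> = (\<Sum>i\<in>I. M (\<lambda>t. \<Sum>j\<in>I. a i j * (g (t + s i) * g (t + s j))))"
    by (intro sum.cong refl mean_sum[OF Mm, symmetric]) (intro bounded_range_intros g)
  also have "\<dots> = M (\<lambda>t. \<Sum>i\<in>I. \<Sum>j\<in>I. a i j * (g (t + s i) * g (t + s j)))"
    by (intro mean_sum[OF Mm, symmetric]) (intro bounded_range_intros g)
  finally show ?thesis .
qed

text \<open>
  The Schur product theorem for a factor that is an autocorrelation: the form of the product is the
  mean over \<open>t\<close> of the form of \<open>\<psi>\<close> with coefficients \<open>c i * g (t + s i)\<close>.
\<close>

lemma pd_on_times_autocorr:
  fixes D :: "'g::ab_group_add set"
  assumes M: "invariant_mean D M" and g: "bounded (range g)" and pd: "pd_on D \<psi>"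
  shows "pd_on D (\<lambda>r. \<psi> r * of_real (autocorr M g r))"
  unfolding pd_on_def
proof (intro allI impI)
  fix n :: nat and s :: "nat \<Rightarrow> 'g" and c :: "nat \<Rightarrow> complex" assume s: "\<forall>i<n. s i \<in> D"
  define a where "a i j = c i * cnj (c j) * \<psi> (s i - s j)" for i j
  define G where "G t = (\<Sum>i<n. \<Sum>j<n. a i j * of_real (g (t + s i) * g (t + s j)))" for t
  have G: "G t \<in> \<real>\<^sub>\<ge>\<^sub>0" for t
  proof -
    have "(\<Sum>i<n. \<Sum>j<n. (c i * g (t + s i)) * cnj (c j * g (t + s j)) * \<psi> (s i - s j)) \<in> \<real>\<^sub>\<ge>\<^sub>0"
      by (rule pd_on_family[OF pd finite_lessThan]) (use s in simp)
    also have "(\<Sum>i<n. \<Sum>j<n. (c i * g (t + s i)) * cnj (c j * g (t + s j)) * \<psi> (s i - s j)) = G t"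
      unfolding G_def a_def by (intro sum.cong refl) (simp add: mult_ac)
    finally show ?thesis .
  qed
  have bG: "bounded (range (\<lambda>t. \<Sum>i<n. \<Sum>j<n. Re (a i j) * (g (t + s i) * g (t + s j))))"
    by (intro bounded_range_intros g)
  have Gre: "Re (G t) = (\<Sum>i<n. \<Sum>j<n. Re (a i j) * (g (t + s i) * g (t + s j)))"
    and Gim: "Im (G t) = (\<Sum>i<n. \<Sum>j<n. Im (a i j) * (g (t + s i) * g (t + s j)))" for t
    by (simp_all add: G_def)
  let ?S = "\<Sum>i<n. \<Sum>j<n. c i * cnj (c j) * (\<psi> (s i - s j) * of_real (autocorr M g (s i - s j)))"
  have S: "?S = (\<Sum>i<n. \<Sum>j<n. a i j * of_real (autocorr M g (s i - s j)))"
    by (simp add: a_def mult_ac)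
  have "Re ?S = (\<Sum>i<n. \<Sum>j<n. Re (a i j) * autocorr M g (s i - s j))" unfolding S by simp
  also have "\<dots> = M (\<lambda>t. Re (G t))"
    unfolding Gre using s by (intro autocorr_quadratic_form[OF M g]) auto
  also have "\<dots> \<ge> 0"
    using G bG by (intro mean_nonneg[OF mean_on_invariant_mean[OF M]]) (simp_all add: Gre[symmetric] complex_nonneg_Reals_iff)
  finally have 1: "Re ?S \<ge> 0" .
  have "Im ?S = (\<Sum>i<n. \<Sum>j<n. Im (a i j) * autocorr M g (s i - s j))" unfolding S by simp
  also have "\<dots> = M (\<lambda>t. Im (G t))"
    unfolding Gim using s by (intro autocorr_quadratic_form[OF M g]) auto
  also have "(\<lambda>t. Im (G t)) = (\<lambda>_. 0)" using G by (simp add: complex_nonneg_Reals_iff)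
  also have "M (\<lambda>_. 0) = 0" by (rule mean_const[OF mean_on_invariant_mean[OF M]])
  finally show "?S \<in> \<real>\<^sub>\<ge>\<^sub>0" using 1 by (simp add: complex_nonneg_Reals_iff)
qed

lemma pd_on_1: "pd_on D (\<lambda>_. 1)"
  unfolding pd_on_def
proof (intro allI impI)
  fix n :: nat and s and c :: "nat \<Rightarrow> complex"
  have "(\<Sum>i<n. \<Sum>j<n. c i * cnj (c j) * 1) = (\<Sum>i<n. c i) * cnj (\<Sum>j<n. c j)"
    by (simp add: sum_product)
  also have "\<dots> = of_real ((norm (\<Sum>i<n. c i))\<^sup>2)" by (simp only: complex_norm_square)
  also have "\<dots> \<in> \<real>\<^sub>\<ge>\<^sub>0" by (simp only: nonneg_Reals_of_real_iff zero_le_power2)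
  finally show "(\<Sum>i<n. \<Sum>j<n. c i * cnj (c j) * 1) \<in> \<real>\<^sub>\<ge>\<^sub>0" .
qed

lemma pd_on_autocorr:
  "invariant_mean D M \<Longrightarrow> bounded (range g) \<Longrightarrow> pd_on D (\<lambda>r. of_real (autocorr M g r))"
  using pd_on_times_autocorr[OF _ _ pd_on_1, of D M g] by simp

lemma mean_product_abs_le:
  assumes M: "invariant_mean D M" and g: "bounded (range g)" "bounded (range h)" 
    and C: "\<And>t. \<bar>g t\<bar> \<le> C" and e: "\<And>t. t \<in> D \<Longrightarrow> \<bar>h t\<bar> \<le> e"
  shows "\<bar>M (\<lambda>t. g t * h t)\<bar> \<le> C * e"
proof (rule mean_abs_le[OF mean_on_invariant_mean[OF M]])
  show "bounded (range (\<lambda>t. g t * h t))" by (intro bounded_range_intros g)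
  fix t assume "t \<in> D"
  have "0 \<le> C" using C[of t] by linarith
  then show "\<bar>g t * h t\<bar> \<le> C * e"
    unfolding abs_mult using C e[OF \<open>t \<in> D\<close>] by (intro mult_mono) auto
qed

lemma autocorr_abs_le:
  assumes M: "invariant_mean D M" and C: "\<And>t. \<bar>g t\<bar> \<le> C"
  shows "\<bar>autocorr M g y\<bar> \<le> C * C"
proof -
  have g: "bounded (range g)" using C by (auto simp: bounded_range_real)
  show ?thesis unfolding autocorr_def
    by (rule mean_product_abs_le[OF M g bounded_range_shift[OF g] C]) (rule C)
qed

lemma almost_periodic_on_autocorr:
  assumes D: "add_subgroup D" and M: "invariant_mean D M" and g: "bounded (range g)"
    and ap: "almost_periodic_on D g"
  shows "almost_periodic_on D (autocorr M g)"
  unfolding almost_periodic_on_def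
proof (intro allI impI)
  fix e :: real assume e: "e > 0"
  obtain C' where C': "\<And>t. \<bar>g t\<bar> \<le> C'" using g by (auto simp: bounded_range_real)
  define C where "C = max C' 1"
  have C: "C > 0" "\<And>t. \<bar>g t\<bar> \<le> C" using C' by (auto simp: C_def max.coboundedI1)
  obtain B where B: "finite B" "B \<subseteq> D" "\<And>t. t \<in> D \<Longrightarrow> \<exists>b\<in>B. \<forall>s\<in>D. \<bar>g (s + t) - g (s + b)\<bar> \<le> e / C"
    using ap[unfolded almost_periodic_on_def, rule_format, of "e / C"] e C by auto
  have "\<exists>b\<in>B. \<forall>s\<in>D. \<bar>autocorr M g (s + t) - autocorr M g (s + b)\<bar> \<le> e" if t: "t \<in> D" for t
  proof -
    obtain b where b: "b \<in> B" "\<And>s. s \<in> D \<Longrightarrow> \<bar>g (s + t) - g (s + b)\<bar> \<le> e / C"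
      using B(3)[OF t] by auto
    have "\<bar>autocorr M g (s + t) - autocorr M g (s + b)\<bar> \<le> e" if s: "s \<in> D" for s
    proof -
      have "bounded (range (\<lambda>r. g (r + (s + t)) + (-1) * g (r + (s + b))))"
        by (intro bounded_range_intros g)
      then have h: "bounded (range (\<lambda>r. g (r + (s + t)) - g (r + (s + b))))" by simp
      have "autocorr M g (s + t) - autocorr M g (s + b) = M (\<lambda>r. g r * g (r + (s + t)) - g r * g (r + (s + b)))"
        unfolding autocorr_def
        by (rule mean_diff[OF mean_on_invariant_mean[OF M], symmetric]; intro bounded_range_intros g)
      also have "\<dots> = M (\<lambda>r. g r * (g (r + (s + t)) - g (r + (s + b))))" by (simp add: algebra_simps)
      also have "\<bar>\<dots>\<bar> \<le> C * (e / C)"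
      proof (rule mean_product_abs_le[OF M g h C(2)])
        fix r assume "r \<in> D"
        then show "\<bar>g (r + (s + t)) - g (r + (s + b))\<bar> \<le> e / C"
          using b(2)[OF add_subgroup_add[OF D \<open>r \<in> D\<close> s]] by (simp add: add.assoc)
      qed
      finally show ?thesis using C by simp
    qed
    then show ?thesis using b(1) by blast
  qed
  then show "\<exists>B. finite B \<and> B \<subseteq> D \<and> (\<forall>t\<in>D. \<exists>b\<in>B. \<forall>s\<in>D. \<bar>autocorr M g (s + t) - autocorr M g (s + b)\<bar> \<le> e)"
    using B by blast
qed

lemma bounded_fejer:
  assumes "bounded (range \<theta>)" shows "bounded (range (fejer p \<theta>))"
proof -
  obtain C where C: "\<And>r. norm (\<theta> r) \<le> C" using assms by (auto simp: bounded_iff)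
  define m where "m = Suc (snd p)"
  have "norm (fejer p \<theta> r) \<le> C" for r
  proof -
    have "norm (\<Sum>i<m. \<Sum>j<m. \<theta> (r + int_mult (int i - int j) (fst p))) \<le> (\<Sum>i<m. \<Sum>j<m. C)"
      by (intro order.trans[OF norm_sum] sum_mono C)
    moreover have "norm (complex_of_nat (m\<^sup>2)) = (real m)\<^sup>2" by (metis norm_of_nat of_nat_power)
    moreover have "(real m)\<^sup>2 > 0" by (simp add: m_def)
    ultimately show ?thesis
      unfolding fejer_def m_def[symmetric] norm_divide
      by (simp add: divide_le_eq power2_eq_square mult_ac)
  qed
  then show ?thesis by (auto simp: bounded_iff)
qed

lemma bounded_Re: "bounded (range \<theta>) \<Longrightarrow> bounded (range (\<lambda>r. Re (\<theta> r)))"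
  using bounded_linear_image[of "range \<theta>" Re, OF _ bounded_linear_Re] by (simp add: image_image)

lemma mean_fejer:
  assumes D: "add_subgroup D" and M: "invariant_mean D M" and b: "bounded (range \<theta>)" and y: "fst p \<in> D"
  shows "M (\<lambda>r. Re (fejer p \<theta> r)) = M (\<lambda>r. Re (\<theta> r))"
proof -
  define m where "m = Suc (snd p)"
  note Mm = mean_on_invariant_mean[OF M] 
  note bR = bounded_Re[OF b]
  have Ref: "Re (fejer p \<theta> r) = (1 / (real m)\<^sup>2) * (\<Sum>i<m. \<Sum>j<m. Re (\<theta> (r + int_mult (int i - int j) (fst p))))" for r
  proof -
    have "fejer p \<theta> r = of_real (1 / (real m)\<^sup>2) * (\<Sum>i<m. \<Sum>j<m. \<theta> (r + int_mult (int i - int j) (fst p)))"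
    proof -
      have "of_real (1 / (real m)\<^sup>2) * z = z / of_nat (m\<^sup>2)" for z :: complex by simp
      then show ?thesis unfolding fejer_def m_def[symmetric] by (simp only:)
    qed
    moreover have "Re (of_real a * z) = a * Re z" for a z by simp
    ultimately show ?thesis by (simp only: Re_sum)
  qed
  have "M (\<lambda>r. Re (fejer p \<theta> r)) = (1 / (real m)\<^sup>2) * M (\<lambda>r. \<Sum>i<m. \<Sum>j<m. Re (\<theta> (r + int_mult (int i - int j) (fst p))))"
    unfolding Ref by (rule mean_scale[OF Mm]) (intro bounded_range_sum bounded_range_shift bR)
  also have "M (\<lambda>r. \<Sum>i<m. \<Sum>j<m. Re (\<theta> (r + int_mult (int i - int j) (fst p)))) =
      (\<Sum>i<m. M (\<lambda>r. \<Sum>j<m. Re (\<theta> (r + int_mult (int i - int j) (fst p)))))"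
    by (rule mean_sum[OF Mm]) (intro bounded_range_sum bounded_range_shift bR)
  also have "\<dots> = (\<Sum>i<m. \<Sum>j<m. M (\<lambda>r. Re (\<theta> (r + int_mult (int i - int j) (fst p)))))"
    by (intro sum.cong refl mean_sum[OF Mm]) (intro bounded_range_shift bR)
  also have "\<dots> = (\<Sum>i<m. \<Sum>j<m. M (\<lambda>r. Re (\<theta> r)))"
    by (intro sum.cong refl mean_shift[OF M bR] add_subgroup_int_mult[OF D y])
  also have "\<dots> = (real m)\<^sup>2 * M (\<lambda>r. Re (\<theta> r))" by (simp add: power2_eq_square mult.assoc)
  finally have "M (\<lambda>r. Re (fejer p \<theta> r)) = 1 / (real m)\<^sup>2 * ((real m)\<^sup>2 * M (\<lambda>r. Re (\<theta> r)))" .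
  moreover have "(real m)\<^sup>2 \<noteq> 0" by (simp add: m_def)
  ultimately show ?thesis by (metis mult.assoc mult_1 nonzero_divide_eq_eq)
qed

text \<open>
  The mean of a function does not change under \<open>fejer\<close>, and a positive definite function is largest
  at \<open>0\<close>. This bound is uniform in the number and length of the kernels.
\<close>

lemma mean_le_foldr_fejer:
  assumes D: "add_subgroup D" and M: "invariant_mean D M" and b: "bounded (range \<theta>)" 
    and pd: "pd_on D \<theta>" and xs: "fst ` set xs \<subseteq> D"
  shows "M (\<lambda>r. Re (\<theta> r)) \<le> Re (foldr fejer xs \<theta> 0)"
proof -
  have "bounded (range (foldr fejer xs \<theta>)) \<and> M (\<lambda>r. Re (foldr fejer xs \<theta> r)) = M (\<lambda>r. Re (\<theta> r))"
    using xs by (induction xs) (auto simp: bounded_fejer mean_fejer[OF D M] b)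
  then have bd: "bounded (range (foldr fejer xs \<theta>))" and eq: "M (\<lambda>r. Re (foldr fejer xs \<theta> r)) = M (\<lambda>r. Re (\<theta> r))"
    by auto
  note Mm = mean_on_invariant_mean[OF M]
  have "M (\<lambda>r. Re (foldr fejer xs \<theta> r)) \<le> M (\<lambda>_. Re (foldr fejer xs \<theta> 0))"
    using pd_on_norm_le[OF pd_on_foldr_fejer[OF D pd xs] add_subgroup_0[OF D]]
    by (intro mean_mono[OF Mm bounded_Re[OF bd] bounded_range_const])
       (rule order.trans[OF complex_Re_le_cmod])
  then show ?thesis by (simp add: eq mean_const[OF Mm])
qed

section \<open>Characters separate the values of almost periodic functions\<close>

text \<open>
  The left-hand side is the mean over \<open>t\<close> of the squared modulus of the average of
  \<open>\<gamma> (i y) * g (t + i y)\<close>, \<open>i \<le> n\<close>. A lower bound on it thus forces these averages to be large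
  somewhere.
\<close>

lemma fejer_character_autocorr_le:
  fixes D :: "'g::ab_group_add set"
  assumes D: "add_subgroup D" and M: "invariant_mean D M" and g: "bounded (range g)"
    and \<gamma>: "is_character \<gamma>" and y: "y \<in> D"
    and E: "\<And>t. t \<in> D \<Longrightarrow> norm (\<Sum>i<Suc n. \<gamma> (int_mult (int i) y) * of_real (g (t + int_mult (int i) y))) \<le> E"
  shows "Re (fejer (y, n) (\<lambda>r. \<gamma> r * of_real (autocorr M g r)) 0) \<le> (E / Suc n)\<^sup>2"
proof -
  define m where "m = Suc n"
  define s where "s i = int_mult (int i) y" for i
  define a where "a i = \<gamma> (s i)" for i
  define V where "V t = (\<Sum>i<m. a i * of_real (g (t + s i)))" for t
  have sD: "s i \<in> D" for i unfolding s_def by (rule add_subgroup_int_mult[OF D y])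
  have sij: "int_mult (int i - int j) y = s i - s j" for i j
    by (simp add: s_def int_mult_diff_left)
  have "fejer (y, n) (\<lambda>r. \<gamma> r * of_real (autocorr M g r)) 0 =
        (\<Sum>i<m. \<Sum>j<m. a i * cnj (a j) * of_real (autocorr M g (s i - s j))) / of_nat (m\<^sup>2)"
    unfolding fejer_def fst_conv snd_conv m_def[symmetric] add_0 sij a_def character_diff[OF \<gamma>] by (rule refl)
  also have "Re \<dots> = (\<Sum>i<m. \<Sum>j<m. Re (a i * cnj (a j)) * autocorr M g (s i - s j)) / (real m)\<^sup>2"
  proof -
    have "Re (z / of_nat (m\<^sup>2)) = Re z / (real m)\<^sup>2" for z
      by (metis Re_divide_of_nat of_nat_power)
    then show ?thesis by (simp add: Re_sum)
  qed
  also have "(\<Sum>i<m. \<Sum>j<m. Re (a i * cnj (a j)) * autocorr M g (s i - s j)) =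
     M (\<lambda>t. \<Sum>i<m. \<Sum>j<m. Re (a i * cnj (a j)) * (g (t + s i) * g (t + s j)))"
    by (rule autocorr_quadratic_form[OF M g sD])
  also have "\<dots> \<le> E\<^sup>2"
  proof -
    have eq: "(\<Sum>i<m. \<Sum>j<m. Re (a i * cnj (a j)) * (g (t + s i) * g (t + s j))) = (norm (V t))\<^sup>2" for t
    proof -
      have "of_real ((norm (V t))\<^sup>2) = V t * cnj (V t)" by (rule complex_norm_square)
      also have "\<dots> = (\<Sum>i<m. \<Sum>j<m. (a i * cnj (a j)) * of_real (g (t + s i) * g (t + s j)))"
        unfolding V_def cnj_sum sum_product by (intro sum.cong refl) (simp add: mult_ac)
      finally have "(norm (V t))\<^sup>2 = Re (\<Sum>i<m. \<Sum>j<m. (a i * cnj (a j)) * of_real (g (t + s i) * g (t + s j)))"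
        by (metis Re_complex_of_real)
      also have "\<dots> = (\<Sum>i<m. \<Sum>j<m. Re (a i * cnj (a j)) * (g (t + s i) * g (t + s j)))"
        unfolding Re_sum by (intro sum.cong refl) simp
      finally show ?thesis by simp
    qed
    have b: "bounded (range (\<lambda>t. \<Sum>i<m. \<Sum>j<m. Re (a i * cnj (a j)) * (g (t + s i) * g (t + s j))))"
      by (intro bounded_range_intros g)
    have "\<bar>M (\<lambda>t. \<Sum>i<m. \<Sum>j<m. Re (a i * cnj (a j)) * (g (t + s i) * g (t + s j)))\<bar> \<le> E\<^sup>2"
    proof (rule mean_abs_le[OF mean_on_invariant_mean[OF M] b])
      fix t assume "t \<in> D"
      then have "norm (V t) \<le> E" unfolding V_def a_def s_def m_def by (rule E)
      then show "\<bar>\<Sum>i<m. \<Sum>j<m. Re (a i * cnj (a j)) * (g (t + s i) * g (t + s j))\<bar> \<le> E\<^sup>2"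
        unfolding eq by (simp add: power_mono)
    qed
    then show ?thesis by linarith
  qed
  finally show ?thesis by (simp add: m_def power_divide divide_right_mono)
qed

text \<open>
  The value \<open>q xs \<psi>\<close> decreases when more kernels are applied, so its limit over all finite lists
  of kernels is an upper semicontinuous affine functional on the positive definite functions. Its
  maximizers form a closed extremal set. The maximum is positive, because at the normalized
  autocorrelation the functional is at least the mean of the squared autocorrelation, up to the
  normalizing factor.
\<close>

lemma character_with_positive_fejer_means:
  fixes D :: "'g::ab_group_add set"
  assumes D: "add_subgroup D" and M: "invariant_mean D M" and g: "bounded (range g)"
    and ap: "almost_periodic_on D g" and nz: "g 0 \<noteq> 0"
  shows "\<exists>\<gamma> c. is_character \<gamma> \<and> 0 < c \<and>
     (\<forall>y\<in>D. \<forall>n. c \<le> Re (fejer (y, n) (\<lambda>r. \<gamma> r * of_real (autocorr M g r)) 0))"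
proof -
  define \<theta> where "\<theta> = autocorr M g"
  define q where "q xs \<psi> = Re (foldr fejer xs (\<lambda>r. \<psi> r * of_real (\<theta> r)) 0)" for xs and \<psi> :: "'g \<Rightarrow> complex"
  define X where "X = {xs :: ('g \<times> nat) list. fst ` set xs \<subseteq> D}"
  \<comment> \<open>\<open>S c\<close> is the set where the limit functional, the infimum of all \<open>q xs\<close>, is at least \<open>c\<close>.\<close>
  define S where "S c = {\<psi>. \<forall>xs\<in>X. c \<le> q xs \<psi>}" for c
  have zero: "0 \<in> D" by (rule add_subgroup_0[OF D])
  have pd_sub: "pd_on D \<psi>" if "\<psi> \<in> normalized_pd" for \<psi> using that by (auto simp: normalized_pd_def pd_on_def)
  have pd: "pd_on D (\<lambda>r. \<psi> r * of_real (\<theta> r))" if "\<psi> \<in> normalized_pd" for \<psi>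
    unfolding \<theta>_def by (rule pd_on_times_autocorr[OF M g pd_sub[OF that]])
  have \<theta>0: "\<theta> 0 = M (\<lambda>t. g t * g t)" by (simp add: \<theta>_def autocorr_def)
  have \<theta>0_pos: "0 < \<theta> 0" unfolding \<theta>0 by (rule mean_square_pos[OF D M g ap nz])
  obtain C where C: "\<And>t. \<bar>g t\<bar> \<le> C" using g by (auto simp: bounded_range_real)
  have \<theta>_bdd: "bounded (range \<theta>)"
    using autocorr_abs_le[where g = g, OF M C] unfolding bounded_range_real \<theta>_def by blast
  have \<theta>2: "0 < M (\<lambda>t. \<theta> t * \<theta> t)"
    using \<theta>0_pos by (intro mean_square_pos[OF D M \<theta>_bdd]) (auto simp: \<theta>_def almost_periodic_on_autocorr[OF D M g ap])
  have q_mono: "q (xs @ ys) \<psi> \<le> q ys \<psi>" "q (xs @ ys) \<psi> \<le> q xs \<psi>" 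
    if "xs \<in> X" "ys \<in> X" "\<psi> \<in> normalized_pd" for xs ys \<psi>
  proof -
    have *: "q (xs @ ys) \<psi> \<le> q ys \<psi>" if "xs \<in> X" "ys \<in> X" for xs ys
      unfolding q_def foldr_append
      using that by (intro foldr_fejer_zero_le[OF D] pd_on_foldr_fejer[OF D] pd \<open>\<psi> \<in> normalized_pd\<close>) (auto simp: X_def)
    show "q (xs @ ys) \<psi> \<le> q ys \<psi>" using * that by blast
    have "q (xs @ ys) \<psi> = q (ys @ xs) \<psi>" by (simp add: q_def foldr_fejer_commute[of xs])
    then show "q (xs @ ys) \<psi> \<le> q xs \<psi>" using *[of ys xs] that by simp
  qed
  have q_affine: "q xs (\<lambda>y. of_real t * \<psi>1 y + of_real (1 - t) * \<psi>2 y) = t * q xs \<psi>1 + (1 - t) * q xs \<psi>2" for xs t \<psi>1 \<psi>2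
  proof -
    have "(\<lambda>r. (of_real t * \<psi>1 r + of_real (1 - t) * \<psi>2 r) * of_real (\<theta> r)) =
       (\<lambda>r. of_real t * (\<psi>1 r * of_real (\<theta> r)) + of_real (1 - t) * (\<psi>2 r * of_real (\<theta> r)))"
      by (simp add: fun_eq_iff algebra_simps)
    then show ?thesis unfolding q_def by (simp only: foldr_fejer_linear) simp
  qed
  have q_cont: "continuous_on UNIV (q xs)" for xs
    unfolding q_def
    by (intro continuous_intros continuous_on_foldr_fejer continuous_on_product_coordinates)
  have closed_S: "closed (S c)" for c
    unfolding S_def Ball_def by (intro closed_Collect_all closed_Collect_imp closed_Collect_le 
      continuous_on_const q_cont) simp
  have S_antimono: "S c \<subseteq> S d" if "d \<le> c" for c d using that by (auto simp: S_def intro: order.trans)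
  define K where "K = {c. normalized_pd \<inter> S c \<noteq> {}}"
  have K_bdd: "c \<le> \<theta> 0" if "c \<in> K" for c
  proof -
    have "normalized_pd \<inter> S c \<noteq> {}" using that by (simp add: K_def)
    then obtain \<psi> where "\<psi> \<in> normalized_pd \<inter> S c" unfolding ex_in_conv[symmetric] by (rule exE)
    then have "c \<le> q [] \<psi>" "\<psi> 0 = 1" by (simp_all add: S_def X_def normalized_pd_def)
    then show ?thesis by (simp add: q_def)
  qed
  \<comment> \<open>The autocorrelation, extended by zero outside \<open>D\<close>, provides a positive lower bound.\<close>
  have K_in: "M (\<lambda>t. \<theta> t * \<theta> t) / \<theta> 0 \<in> K"
  proof -
    define \<psi> where "\<psi> y = (if y \<in> D then of_real (1 / \<theta> 0) * complex_of_real (\<theta> y) else 0)" for y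
    have "pd_on D (\<lambda>y. of_real (1 / \<theta> 0) * complex_of_real (\<theta> y))"
      using \<theta>0_pos unfolding \<theta>_def by (intro pd_on_scale pd_on_autocorr[OF M g]) simp
    then have "pd_on UNIV \<psi>" unfolding \<psi>_def by (rule pd_on_extend_zero[OF D])
    then have \<psi>: "\<psi> \<in> normalized_pd" using \<theta>0_pos zero by (simp add: normalized_pd_def \<psi>_def)
    have "M (\<lambda>t. \<theta> t * \<theta> t) / \<theta> 0 \<le> q xs \<psi>" if xs: "xs \<in> X" for xs
    proof -
      have bt: "bounded (range (\<lambda>t. (1 / \<theta> 0) * (\<theta> t * \<theta> t)))" by (intro bounded_range_intros \<theta>_bdd)
      then obtain C' where C': "\<And>t. \<bar>(1 / \<theta> 0) * (\<theta> t * \<theta> t)\<bar> \<le> C'" unfolding bounded_range_real by blast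
      have C'0: "0 \<le> C'" using C'[of 0] by linarith
      have eq: "\<psi> r * of_real (\<theta> r) = of_real (if r \<in> D then (1 / \<theta> 0) * (\<theta> r * \<theta> r) else 0)" for r
        by (simp add: \<psi>_def)
      have "norm (\<psi> r * of_real (\<theta> r)) \<le> C'" for r
        unfolding eq norm_of_real using C'[of r] C'0 by simp
      then have b: "bounded (range (\<lambda>r. \<psi> r * of_real (\<theta> r)))" unfolding bounded_iff by blast
      have "M (\<lambda>t. (1 / \<theta> 0) * (\<theta> t * \<theta> t)) \<le> M (\<lambda>r. Re (\<psi> r * of_real (\<theta> r)))"
        by (rule mean_mono[OF mean_on_invariant_mean[OF M] bt bounded_Re[OF b]]) (simp add: \<psi>_def)
      also have "\<dots> \<le> q xs \<psi>"
        unfolding q_def using xs by (intro mean_le_foldr_fejer[OF D M b pd[OF \<psi>]]) (simp add: X_def)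
      finally show ?thesis
        by (simp add: mean_scale[OF mean_on_invariant_mean[OF M] bounded_range_mult[OF \<theta>_bdd \<theta>_bdd]] divide_inverse mult.commute)
    qed
    then have "\<psi> \<in> S (M (\<lambda>t. \<theta> t * \<theta> t) / \<theta> 0)" by (simp add: S_def)
    then show ?thesis using \<psi> unfolding K_def by blast
  qed
  define c where "c = Sup K"
  have K_above: "bdd_above K" using K_bdd by (auto simp: bdd_above_def)
  have c_pos: "0 < c"
  proof -
    have "0 < M (\<lambda>t. \<theta> t * \<theta> t) / \<theta> 0" using \<theta>2 \<theta>0_pos by simp
    also have "\<dots> \<le> c" unfolding c_def by (rule cSup_upper[OF K_in K_above])
    finally show ?thesis .
  qed
  have "normalized_pd \<inter> (\<Inter>d\<in>{..<c}. S d) \<noteq> {}"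
  proof (rule compact_imp_fip_image[OF compact_normalized_pd closed_S])
    fix I assume I: "finite I" "I \<subseteq> {..<c}"
    have "\<exists>d\<in>K. Max (insert (c - 1) I) < d"
      using less_cSup_iff[of K, OF _ K_above] K_in I unfolding c_def[symmetric]
      by (subst less_cSup_iff[symmetric]) (auto simp: K_above c_def[symmetric])
    then obtain d where d: "d \<in> K" "Max (insert (c - 1) I) < d" by blast
    have "S d \<subseteq> S i" if "i \<in> I" for i
      using d(2) I that by (intro S_antimono) (auto intro: less_imp_le)
    then show "normalized_pd \<inter> (\<Inter>d\<in>I. S d) \<noteq> {}" using d(1) unfolding K_def by blast
  qed
  moreover have "(\<Inter>d\<in>{..<c}. S d) \<subseteq> S c" 
    unfolding S_def by (auto intro: dense_le)
  ultimately have ne: "normalized_pd \<inter> S c \<noteq> {}" by blast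
  have ext: "extremal normalized_pd (normalized_pd \<inter> S c)"
    unfolding extremal_def
  proof (intro conjI ballI allI impI)
    fix \<psi> \<psi>1 \<psi>2 t assume \<psi>: "\<psi> \<in> normalized_pd \<inter> S c" and \<psi>12: "\<psi>1 \<in> normalized_pd" "\<psi>2 \<in> normalized_pd" and t: "0 < t" "t < 1"
      and eq: "\<psi> = (\<lambda>y. of_real t * \<psi>1 y + of_real (1 - t) * \<psi>2 y)"
    have "\<psi>1 \<in> S c"
    proof (rule ccontr)
      assume "\<psi>1 \<notin> S c"
      then obtain xs where xs: "xs \<in> X" "q xs \<psi>1 < c" unfolding S_def by force
      \<comment> \<open>If the functional is below \<open>c\<close> at \<open>\<psi>1\<close>, it must exceed \<open>c\<close> by at least \<open>d\<close> at \<open>\<psi>2\<close>,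
          which contradicts the choice of \<open>c\<close>.\<close>
      define d where "d = t * (c - q xs \<psi>1) / (1 - t)"
      have d: "0 < d" using xs t by (simp add: d_def)
      have "c + d \<le> q ys \<psi>2" if ys: "ys \<in> X" for ys
      proof -
        have "xs @ ys \<in> X" using xs ys by (auto simp: X_def)
        then have "c \<le> q (xs @ ys) \<psi>" using \<psi> by (simp add: S_def)
        also have "\<dots> = t * q (xs @ ys) \<psi>1 + (1 - t) * q (xs @ ys) \<psi>2" unfolding eq by (rule q_affine)
        also have "\<dots> \<le> t * q xs \<psi>1 + (1 - t) * q ys \<psi>2"
          using t by (intro add_mono mult_left_mono q_mono xs ys \<psi>12) auto
        finally have "c - t * q xs \<psi>1 \<le> (1 - t) * q ys \<psi>2" by simp
        moreover have "(1 - t) * d = t * (c - q xs \<psi>1)" using t by (simp add: d_def)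
        then have "(1 - t) * (c + d) = c - t * q xs \<psi>1" by (simp add: algebra_simps)
        ultimately have "(1 - t) * (c + d) \<le> (1 - t) * q ys \<psi>2" by linarith
        then show ?thesis using t by simp
      qed
      then have "\<psi>2 \<in> S (c + d)" by (simp add: S_def)
      then have "c + d \<in> K" using \<psi>12 unfolding K_def by blast
      then have "c + d \<le> c" unfolding c_def by (rule cSup_upper[OF _ K_above])
      then show False using d by simp
    qed
    then show "\<psi>1 \<in> normalized_pd \<inter> S c" using \<psi>12 by simp
  qed simp
  have "closed (normalized_pd :: ('g \<Rightarrow> complex) set)" by (rule closed_normalized_pd)
  then have "closed (normalized_pd \<inter> S c)" using closed_S by (rule closed_Int)
  then obtain \<gamma> where \<gamma>: "\<gamma> \<in> normalized_pd \<inter> S c" "extremal normalized_pd {\<gamma>}"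
    using extreme_point_exists[OF compact_normalized_pd _ ne ext] by blast
  have "c \<le> Re (fejer (y, n) (\<lambda>r. \<gamma> r * of_real (autocorr M g r)) 0)" if "y \<in> D" for y n
  proof -
    have "c \<le> q [(y, n)] \<gamma>" using \<gamma>(1) that by (simp add: S_def X_def)
    then show ?thesis by (simp add: q_def \<theta>_def)
  qed
  then show ?thesis using extreme_pd_is_character[OF \<gamma>(2)] c_pos by blast
qed

text \<open>
  The character comes from the preceding lemma for \<open>g t = f t - f (t + x)\<close>. If \<open>\<gamma> x = 1\<close>, the sums of
  \<open>\<gamma> (i x) * g (t + i x)\<close> telescope and remain bounded, contrary to the lower bound on their
  averages. If \<open>g\<close> changes by at most \<open>2 e\<close> under translation by \<open>y\<close>, then multiplying the average
  \<open>v\<close> of \<open>\<gamma> (i y) * g (t + i y)\<close> by \<open>\<gamma> y\<close> changes it by little more than \<open>2 e\<close>; as \<open>v\<close> has modulus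
  at least \<open>sqrt c\<close> for some \<open>t\<close>, this bounds \<open>\<gamma> y - 1\<close>.
\<close>

theorem almost_periodic_separation:
  fixes D :: "'g::ab_group_add set"
  assumes D: "add_subgroup D" and f: "\<And>t. \<bar>f t\<bar> \<le> C" and ap: "almost_periodic_on D f"
    and x: "x \<in> D" "f x \<noteq> f 0"
  shows "\<exists>\<gamma> K. is_character \<gamma> \<and> \<gamma> x \<noteq> 1 \<and>
    (\<forall>y\<in>D. \<forall>e. (\<forall>t\<in>D. \<bar>f (t + y) - f t\<bar> \<le> e) \<longrightarrow> norm (\<gamma> y - 1) \<le> K * e)"
proof -
  define g where "g t = f t - f (t + x)" for t
  have gC: "\<bar>g t\<bar> \<le> 2 * C" for t using f[of t] f[of "t + x"] unfolding g_def by linarith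
  have g: "bounded (range g)" using gC by (auto simp: bounded_range_real)
  have apg: "almost_periodic_on D g"
    unfolding almost_periodic_on_def
  proof (intro allI impI)
    fix e :: real assume "e > 0"
    then obtain B where B: "finite B" "B \<subseteq> D" 
        "\<And>t. t \<in> D \<Longrightarrow> \<exists>b\<in>B. \<forall>s\<in>D. \<bar>f (s + t) - f (s + b)\<bar> \<le> e / 2"
      using ap[unfolded almost_periodic_on_def, rule_format, of "e / 2"] by auto
    have "\<exists>b\<in>B. \<forall>s\<in>D. \<bar>g (s + t) - g (s + b)\<bar> \<le> e" if "t \<in> D" for t
    proof -
      obtain b where b: "b \<in> B" "\<And>s. s \<in> D \<Longrightarrow> \<bar>f (s + t) - f (s + b)\<bar> \<le> e / 2" using B(3)[OF \<open>t \<in> D\<close>] by blast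
      have "\<bar>g (s + t) - g (s + b)\<bar> \<le> e" if s: "s \<in> D" for s
      proof -
        have eq: "s + t + x = s + x + t" "s + b + x = s + x + b" by (simp_all add: algebra_simps)
        have "\<bar>f (s + t) - f (s + b)\<bar> \<le> e / 2" "\<bar>f (s + t + x) - f (s + b + x)\<bar> \<le> e / 2"
          unfolding eq using b(2)[OF s] b(2)[OF add_subgroup_add[OF D s x(1)]] by auto
        then show ?thesis unfolding g_def by linarith
      qed
      then show ?thesis using b(1) by blast
    qed
    then show "\<exists>B. finite B \<and> B \<subseteq> D \<and> (\<forall>t\<in>D. \<exists>b\<in>B. \<forall>s\<in>D. \<bar>g (s + t) - g (s + b)\<bar> \<le> e)" using B(1,2) by blast
  qed
  have g0: "g 0 \<noteq> 0" using x by (simp add: g_def)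
  obtain M where M: "invariant_mean D M" using invariant_mean_exists[OF D] by blast
  obtain \<gamma> c where \<gamma>: "is_character \<gamma>" and c: "0 < c" 
    and cle: "\<And>y n. y \<in> D \<Longrightarrow> c \<le> Re (fejer (y, n) (\<lambda>r. \<gamma> r * of_real (autocorr M g r)) 0)"
    using character_with_positive_fejer_means[OF D M g apg g0] by blast
  have C0: "0 \<le> C" using f[of 0] by linarith
  have key: "sqrt c \<le> E / Suc n" if "y \<in> D" 
    and "\<And>t. t \<in> D \<Longrightarrow> norm (\<Sum>i<Suc n. \<gamma> (int_mult (int i) y) * of_real (g (t + int_mult (int i) y))) \<le> E" for y n E
  proof -
    have "c \<le> (E / Suc n)\<^sup>2"
      using cle[OF that(1)] fejer_character_autocorr_le[OF D M g \<gamma> that(1), of n E] that(2) order.trans by blast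
    then have "sqrt c \<le> \<bar>E / Suc n\<bar>" using real_sqrt_le_mono by fastforce
    moreover have "0 \<le> E" using that(2)[OF add_subgroup_0[OF D]] norm_ge_zero order.trans by blast
    ultimately show ?thesis by simp
  qed
  have gx: "\<gamma> x \<noteq> 1"
  proof
    assume 1: "\<gamma> x = 1"
    have "sqrt c \<le> (2 * C) / Suc n" for n
    proof (rule key[OF x(1)])
      fix t assume "t \<in> D"
      have \<gamma>1: "\<gamma> (int_mult (int i) x) = 1" for i by (simp add: character_int_mult[OF \<gamma>] 1)
      have tele: "(\<Sum>i<Suc n. g (t + int_mult (int i) x)) = f t - f (t + int_mult (int (Suc n)) x)"
      proof -
        have "g (t + int_mult (int i) x) = f (t + int_mult (int i) x) - f (t + int_mult (int (Suc i)) x)" for i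
          using int_mult_plus_1[of "int i" x] by (simp add: g_def add.assoc add.commute add.left_commute)
        then show ?thesis 
          using sum_lessThan_telescope'[of "\<lambda>i. f (t + int_mult (int i) x)" "Suc n"] by simp
      qed
      have "norm (\<Sum>i<Suc n. \<gamma> (int_mult (int i) x) * of_real (g (t + int_mult (int i) x))) =
            \<bar>\<Sum>i<Suc n. g (t + int_mult (int i) x)\<bar>"
        by (simp only: \<gamma>1 mult_1 flip: of_real_sum) (simp only: norm_of_real)
      also have "\<dots> \<le> 2 * C" unfolding tele using f[of t] f[of "t + int_mult (int (Suc n)) x"] by linarith
      finally show "norm (\<Sum>i<Suc n. \<gamma> (int_mult (int i) x) * of_real (g (t + int_mult (int i) x))) \<le> 2 * C" .
    qed
    moreover have "(\<lambda>n. (2 * C) / Suc n) \<longlonglongrightarrow> 0" by (intro LIMSEQ_Suc lim_const_over_n)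
    ultimately have "sqrt c \<le> 0" by (intro LIMSEQ_le_const) auto
    then show False using c by simp
  qed
  have "norm (\<gamma> y - 1) \<le> (2 / sqrt c) * e" if y: "y \<in> D" and e: "\<forall>t\<in>D. \<bar>f (t + y) - f t\<bar> \<le> e" for y e
  proof (cases "\<gamma> y = 1")
    case True
    have "0 \<le> e" using e[rule_format, OF add_subgroup_0[OF D]] by linarith
    then show ?thesis using True c by simp
  next
    case False
    define d where "d = norm (\<gamma> y - 1)"
    have d: "0 < d" using False by (simp add: d_def)
    have ge: "\<bar>g (t + y) - g t\<bar> \<le> 2 * e" if "t \<in> D" for t
    proof -
      have eq: "t + y + x = t + x + y" by (simp add: algebra_simps)
      have "\<bar>f (t + y) - f t\<bar> \<le> e" "\<bar>f (t + y + x) - f (t + x)\<bar> \<le> e"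
        unfolding eq using e that add_subgroup_add[OF D that x(1)] by auto
      then show ?thesis unfolding g_def by linarith
    qed
    have "sqrt c * d \<le> 4 * C / Suc n + 2 * e" for n
    proof -
      have "sqrt c \<le> ((4 * C + Suc n * (2 * e)) / d) / Suc n"
      proof (rule key[OF y])
        fix t assume t: "t \<in> D"
        define G where "G i = \<gamma> (int_mult (int i) y) * complex_of_real (g (t + int_mult (int i) y))" for i
        define R where "R i = \<gamma> (int_mult (int i) y) * complex_of_real (g (t + int_mult (int i) y + y) - g (t + int_mult (int i) y))" for i
        have n1: "norm (\<gamma> z) = 1" for z using \<gamma> by (simp add: is_character_def)
        \<comment> \<open>Shifting the summation index multiplies by \<open>\<gamma> y\<close>, up to the error terms \<open>R i\<close>.\<close>
        have GS: "G (Suc i) = \<gamma> y * (G i + R i)" for i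
        proof -
          have "int_mult (int (Suc i)) y = int_mult (int i) y + y"
            using int_mult_plus_1[of "int i" y] by (simp add: add.commute)
          moreover have "\<gamma> (int_mult (int i) y + y) = \<gamma> (int_mult (int i) y) * \<gamma> y"
            using \<gamma> by (simp add: is_character_def)
          ultimately show ?thesis by (simp add: G_def R_def algebra_simps)
        qed
        have "G (Suc n) - G 0 = (\<Sum>i<Suc n. G (Suc i) - G i)" by (rule sum_lessThan_telescope[symmetric])
        also have "\<dots> = (\<Sum>i<Suc n. (\<gamma> y - 1) * G i + \<gamma> y * R i)"
          by (intro sum.cong refl) (simp add: GS algebra_simps)
        also have "\<dots> = (\<gamma> y - 1) * (\<Sum>i<Suc n. G i) + \<gamma> y * (\<Sum>i<Suc n. R i)"
          by (simp only: sum.distrib sum_distrib_left)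
        finally have eq: "(\<gamma> y - 1) * (\<Sum>i<Suc n. G i) = (G (Suc n) - G 0) - \<gamma> y * (\<Sum>i<Suc n. R i)" by simp
        have "norm (\<gamma> y * (\<Sum>i<Suc n. R i)) \<le> (\<Sum>i<Suc n. 2 * e)"
          unfolding norm_mult n1 mult_1 R_def
        proof (intro order.trans[OF norm_sum] sum_mono)
          fix i
          have "t + int_mult (int i) y \<in> D" by (rule add_subgroup_add[OF D t add_subgroup_int_mult[OF D y]])
          then show "norm (\<gamma> (int_mult (int i) y) * complex_of_real (g (t + int_mult (int i) y + y) - g (t + int_mult (int i) y))) \<le> 2 * e"
            unfolding norm_mult n1 mult_1 norm_of_real by (rule ge)
        qed
        also have "(\<Sum>i<Suc n. 2 * e) = Suc n * (2 * e)" by simp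
        finally have 1: "norm (\<gamma> y * (\<Sum>i<Suc n. R i)) \<le> Suc n * (2 * e)" .
        have nG: "norm (G i) \<le> 2 * C" for i unfolding G_def norm_mult n1 mult_1 norm_of_real by (rule gC)
        have "d * norm (\<Sum>i<Suc n. G i) \<le> norm (G (Suc n) - G 0) + norm (\<gamma> y * (\<Sum>i<Suc n. R i))"
          unfolding d_def norm_mult[symmetric] eq by (rule norm_triangle_ineq4)
        also have "\<dots> \<le> 4 * C + Suc n * (2 * e)"
          using norm_triangle_ineq4[of "G (Suc n)" "G 0"] nG[of "Suc n"] nG[of 0] 1 by linarith
        finally have "norm (\<Sum>i<Suc n. G i) \<le> (4 * C + Suc n * (2 * e)) / d"
          using d by (simp add: pos_le_divide_eq mult.commute)
        then show "norm (\<Sum>i<Suc n. \<gamma> (int_mult (int i) y) * of_real (g (t + int_mult (int i) y))) \<le> (4 * C + Suc n * (2 * e)) / d"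
          unfolding G_def .
      qed
      then have "sqrt c \<le> ((4 * C + Suc n * (2 * e)) / Suc n) / d"
        by (simp only: divide_divide_eq_left mult.commute)
      then have "sqrt c * d \<le> (4 * C + Suc n * (2 * e)) / Suc n"
        by (simp only: pos_le_divide_eq[OF d])
      also have "\<dots> = 4 * C / Suc n + 2 * e" by (simp add: add_divide_distrib)
      finally show ?thesis .
    qed
    moreover have "(\<lambda>n. 4 * C / Suc n + 2 * e) \<longlonglongrightarrow> 0 + 2 * e" by (intro tendsto_intros LIMSEQ_Suc lim_const_over_n)
    ultimately have "sqrt c * d \<le> 0 + 2 * e" by (intro LIMSEQ_le_const) auto
    then show ?thesis using c by (simp add: d_def field_simps)
  qed
  then show ?thesis using \<gamma> gx by blast
qed

section \<open>Subgroups that are compact modulo a maximal subgroup\<close>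

lemma small_symmetric_nbhd:
  fixes U :: "'g::topological_ab_group_add set"
  assumes "open U" "0 \<in> U"
  obtains V where "open V" "0 \<in> V" "\<And>a. a \<in> V \<Longrightarrow> - a \<in> V"
    "\<And>a b c. a \<in> V \<Longrightarrow> b \<in> V \<Longrightarrow> c \<in> V \<Longrightarrow> a + b + c \<in> U"
proof -
  have "open ((\<lambda>p. fst p + fst (snd p) + snd (snd p)) -` U)"
    by (intro open_vimage assms continuous_intros)
  then obtain A B where AB: "open A" "open B" "0 \<in> A" "(0, 0) \<in> B"
      "A \<times> B \<subseteq> (\<lambda>p. fst p + fst (snd p) + snd (snd p)) -` U"
    using assms(2) by (elim open_prod_elim[where x = "(0, 0, 0)"]) auto
  obtain B1 B2 where B: "open B1" "open B2" "0 \<in> B1" "0 \<in> B2" "B1 \<times> B2 \<subseteq> B"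
    using AB(2,4) by (elim open_prod_elim) auto
  define V0 where "V0 = A \<inter> B1 \<inter> B2"
  define V where "V = V0 \<inter> uminus -` V0"
  have "open V0" using AB B by (auto simp: V0_def)
  then have "open V" unfolding V_def by (intro open_Int open_vimage continuous_intros)
  moreover have "0 \<in> V" using AB B by (auto simp: V_def V0_def)
  moreover have "- a \<in> V" if "a \<in> V" for a using that by (auto simp: V_def)
  moreover have "a + b + c \<in> U" if "a \<in> V" "b \<in> V" "c \<in> V" for a b c
  proof -
    have "(a, b, c) \<in> A \<times> B" using that B by (auto simp: V_def V0_def)
    then show ?thesis using AB(5) by force
  qed
  ultimately show ?thesis using that by blast
qed

lemma compact_finite_net:
  fixes C V :: "'g::topological_ab_group_add set"
  assumes "compact C" "open V" "0 \<in> V"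
  obtains F where "finite F" "F \<subseteq> C" "\<And>a. a \<in> C \<Longrightarrow> \<exists>p\<in>F. a - p \<in> V"
proof -
  obtain F where "F \<subseteq> C" "finite F" "C \<subseteq> (\<Union>p\<in>F. (\<lambda>a. a - p) -` V)"
    by (rule compactE_image[OF assms(1), of C "\<lambda>p. (\<lambda>a. a - p) -` V"])
       (use assms in \<open>auto intro!: open_vimage continuous_intros\<close>)
  then show ?thesis by (intro that[of F]) auto
qed

lemma compact_sums:
  fixes A B :: "'g::topological_ab_group_add set"
  assumes "compact A" "compact B"
  shows "compact ((\<lambda>p. fst p + snd p) ` (A \<times> B))"
  by (intro compact_continuous_image compact_Times assms continuous_intros)

text \<open>
  The image of \<open>S\<close> in the quotient by \<open>H\<close> is contained in the image of a compact set.
\<close>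

definition rel_compact_mod :: "'g::topological_ab_group_add set \<Rightarrow> 'g set \<Rightarrow> bool" where
  "rel_compact_mod H S \<longleftrightarrow> (\<exists>C. compact C \<and> (\<forall>a\<in>S. \<exists>h\<in>H. a - h \<in> C))"

lemma rel_compact_mod_add:
  assumes H: "add_subgroup H" and S: "rel_compact_mod H S" and T: "rel_compact_mod H T"
  shows "rel_compact_mod H {a + b |a b. a \<in> S \<and> b \<in> T}"
proof -
  obtain C where C: "compact C" "\<And>a. a \<in> S \<Longrightarrow> \<exists>h\<in>H. a - h \<in> C" using S unfolding rel_compact_mod_def by blast
  obtain E where E: "compact E" "\<And>a. a \<in> T \<Longrightarrow> \<exists>h\<in>H. a - h \<in> E" using T unfolding rel_compact_mod_def by blast
  have "\<exists>h\<in>H. a + b - h \<in> (\<lambda>p. fst p + snd p) ` (C \<times> E)" if ab: "a \<in> S" "b \<in> T" for a b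
  proof -
    obtain h k where hk: "h \<in> H" "k \<in> H" "a - h \<in> C" "b - k \<in> E" using C(2)[OF ab(1)] E(2)[OF ab(2)] by blast
    have "a + b - (h + k) = (a - h) + (b - k)" by (simp add: algebra_simps)
    then have "a + b - (h + k) \<in> (\<lambda>p. fst p + snd p) ` (C \<times> E)" using hk by force
    then show ?thesis using add_subgroup_add[OF H hk(1,2)] by blast
  qed
  then show ?thesis using compact_sums[OF C(1) E(1)] unfolding rel_compact_mod_def by blast
qed

lemma add_subgroup_adjoin:
  assumes H: "add_subgroup H" shows "add_subgroup {h + int_mult k y |h k. h \<in> H}"
  unfolding add_subgroup_def
proof (intro conjI ballI)
  show "0 \<in> {h + int_mult k y |h k. h \<in> H}" using add_subgroup_0[OF H] by (auto intro!: exI[of _ 0])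
  fix a b assume "a \<in> {h + int_mult k y |h k. h \<in> H}" "b \<in> {h + int_mult k y |h k. h \<in> H}"
  then obtain h k h' k' where a: "a = h + int_mult k y" "h \<in> H" and b: "b = h' + int_mult k' y" "h' \<in> H" by blast
  have "a - b = (h - h') + int_mult (k - k') y" by (simp add: a b int_mult_diff_left algebra_simps)
  then show "a - b \<in> {h + int_mult k y |h k. h \<in> H}" using add_subgroup_diff[OF H a(2) b(2)] by blast
qed

lemma subset_adjoin: "H \<subseteq> {h + int_mult k y |h k. h \<in> H}"
proof
  fix h assume "h \<in> H"
  moreover have "h = h + int_mult 0 y" by simp
  ultimately show "h \<in> {h + int_mult k y |h k. h \<in> H}" by blast
qed

lemma mem_adjoin: assumes "add_subgroup H" shows "y \<in> {h + int_mult k y |h k. h \<in> H}"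
proof -
  have "y = 0 + int_mult 1 y" by simp
  then show ?thesis using add_subgroup_0[OF assms] by blast
qed

text \<open>
  Weil's argument on monothetic groups, carried out modulo \<open>H\<close>: if \<open>n y\<close> returns to every
  neighbourhood of \<open>0\<close> for arbitrarily large \<open>n\<close>, then by compactness of \<open>W\<close> the return times to \<open>W\<close> have
  bounded gaps. So every multiple of \<open>y\<close> differs from one in \<open>W\<close> by a multiple with bounded
  coefficient.
\<close>

lemma cyclic_rel_compact_if_recurrent:
  fixes H W V0 :: "'g::topological_ab_group_add set" and y :: 'g
  assumes H: "add_subgroup H" and W: "compact W" "open V0" "0 \<in> V0" "V0 \<subseteq> W"
    and rec: "\<And>V N. open V \<Longrightarrow> 0 \<in> V \<Longrightarrow> \<exists>n::int. n \<ge> N \<and> (\<exists>h\<in>H. int_mult n y - h \<in> V)"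
  shows "rel_compact_mod H (range (\<lambda>k. int_mult k y))"
proof -
  define R where "R = {j. \<exists>h\<in>H. int_mult j y - h \<in> W}"
  obtain V where V: "open V" "0 \<in> V" "\<And>a. a \<in> V \<Longrightarrow> - a \<in> V"
    "\<And>a b c. a \<in> V \<Longrightarrow> b \<in> V \<Longrightarrow> c \<in> V \<Longrightarrow> a + b + c \<in> V0"
    using small_symmetric_nbhd[OF W(2,3)] by blast
  obtain F where F: "finite F" "F \<subseteq> W" "\<And>a. a \<in> W \<Longrightarrow> \<exists>p\<in>F. a - p \<in> V"
    using compact_finite_net[OF W(1) V(1,2)] by blast
  have "\<exists>n\<ge>1. \<forall>j. \<forall>h\<in>H. int_mult j y - h - p \<in> V \<longrightarrow> j - n \<in> R" for p
  proof (cases "\<exists>j. \<exists>h\<in>H. int_mult j y - h - p \<in> V")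
    case False
    then show ?thesis by (intro exI[of _ 1]) auto
  next
    case True
    then obtain i h1 where i: "h1 \<in> H" "int_mult i y - h1 - p \<in> V" by blast
    obtain m h2 where m: "m \<ge> 1 - i" "h2 \<in> H" "int_mult m y - h2 \<in> V" using rec[OF V(1,2), of "1 - i"] by blast
    have "j - (i + m) \<in> R" if h: "h \<in> H" "int_mult j y - h - p \<in> V" for j h
    proof -
      have "int_mult (j - (i + m)) y - (h - h1 - h2) = 
         (int_mult j y - h - p) + - (int_mult i y - h1 - p) + - (int_mult m y - h2)"
        by (simp add: int_mult_diff_left int_mult_add_left algebra_simps)
      also have "\<dots> \<in> W" using V(4)[OF h(2) V(3)[OF i(2)] V(3)[OF m(3)]] W(4) by blast
      finally show ?thesis using add_subgroup_diff[OF H add_subgroup_diff[OF H h(1) i(1)] m(2)] unfolding R_def by blast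
    qed
    then show ?thesis using m by (intro exI[of _ "i + m"]) auto
  qed
  then obtain n where n: "\<And>p. n p \<ge> 1" "\<And>p j h. h \<in> H \<Longrightarrow> int_mult j y - h - p \<in> V \<Longrightarrow> j - n p \<in> R"
    by metis
  \<comment> \<open>Any common upper bound of the finitely many return times will do.\<close>
  define N where "N = (\<Sum>p\<in>F. n p)"
  have step: "\<exists>m. 1 \<le> m \<and> m \<le> N \<and> j - m \<in> R" if j: "j \<in> R" for j
  proof -
    obtain h where h: "h \<in> H" "int_mult j y - h \<in> W" using j by (auto simp: R_def)
    obtain p where p: "p \<in> F" "int_mult j y - h - p \<in> V" using F(3)[OF h(2)] by blast
    have "n p \<le> N" unfolding N_def using n(1) F(1) p(1) by (intro member_le_sum) (auto intro: order.trans[of 0 1])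
    then show ?thesis using n(1) n(2)[OF h(1) p(2)] by blast
  qed
  have R0: "0 \<in> R" unfolding R_def using add_subgroup_0[OF H] W by (auto intro!: bexI[of _ 0])
  have N0: "0 \<le> N" unfolding N_def using n(1) by (intro sum_nonneg) (meson order.trans zero_le_one)
  \<comment> \<open>Starting at \<open>0\<close>, return times can be followed downwards with steps between \<open>1\<close> and \<open>N\<close>.\<close>
  have down: "\<exists>i. 0 \<le> i \<and> i \<le> N \<and> - int m - i \<in> R" for m
  proof (induction m)
    case 0
    then show ?case using R0 N0 by (intro exI[of _ 0]) simp
  next
    case (Suc m)
    then obtain i where i: "0 \<le> i" "i \<le> N" "- int m - i \<in> R" by blast
    show ?case
    proof (cases "i = 0")
      case False
      then show ?thesis using i by (intro exI[of _ "i - 1"]) (auto simp: algebra_simps)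
    next
      case True
      then obtain k where "1 \<le> k" "k \<le> N" "- int m - k \<in> R" using step[OF i(3)] by auto
      then show ?thesis by (intro exI[of _ "k - 1"]) (auto simp: algebra_simps)
    qed
  qed
  define E where "E = (\<lambda>i. int_mult i y) ` {- N..N}"
  define C where "C = (\<lambda>p. fst p + snd p) ` ((W \<union> uminus ` W) \<times> E)"
  have "compact C" unfolding C_def E_def
    by (intro compact_sums compact_Un W(1) compact_continuous_image continuous_intros finite_imp_compact finite_imageI) simp
  have CI: "w + int_mult i y \<in> C" if "w \<in> W \<union> uminus ` W" "i \<in> {- N..N}" for w i
    unfolding C_def E_def using that by (intro image_eqI[of _ _ "(w, int_mult i y)"]) auto
  have "\<exists>h\<in>H. int_mult k y - h \<in> C" for k
  proof (cases "k \<le> 0")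
    case True
    obtain i where i: "0 \<le> i" "i \<le> N" "k - i \<in> R" using down[of "nat (- k)"] True by auto
    obtain h where h: "h \<in> H" "int_mult (k - i) y - h \<in> W" using i(3) by (auto simp: R_def)
    have "int_mult k y - h = (int_mult (k - i) y - h) + int_mult i y" by (simp add: int_mult_diff_left)
    also have "\<dots> \<in> C" using h i by (intro CI) auto
    finally have "int_mult k y - h \<in> C" .
    then show ?thesis using h by blast
  next
    case False
    obtain i where i: "0 \<le> i" "i \<le> N" "- k - i \<in> R" using down[of "nat k"] False by auto
    obtain h where h: "h \<in> H" "int_mult (- k - i) y - h \<in> W" using i(3) by (auto simp: R_def)
    have "int_mult k y - (- h) = - (int_mult (- k - i) y - h) + int_mult (- i) y"
      by (simp add: int_mult_diff_left int_mult_minus_left)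
    also have "\<dots> \<in> C" using i by (intro CI UnI2 imageI h(2)) simp
    finally have "int_mult k y - (- h) \<in> C" .
    then show ?thesis using add_subgroup_minus[OF H h(1)] by blast
  qed
  then show ?thesis using \<open>compact C\<close> unfolding rel_compact_mod_def by blast
qed

text \<open>
  If no positive multiple of \<open>y\<close> lies in \<open>H\<close>, then for every \<open>m > 0\<close> the subgroup generated by \<open>H\<close> and
  \<open>m y\<close> is larger than \<open>H\<close> and meets \<open>U\<close>. So infinitely many multiples of \<open>y\<close> lie in \<open>U\<close>
  modulo \<open>H\<close>. Since \<open>U\<close> is contained in a compact set, two of them with far apart coefficients
  are close to each other modulo \<open>H\<close>, and their difference is a return to a neighbourhood of \<open>0\<close>.
\<close>

lemma cyclic_rel_compact_mod_maximal:
  fixes H W V0 U C :: "'g::topological_ab_group_add set" and y :: 'g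
  assumes H: "add_subgroup H" and W: "compact W" "open V0" "0 \<in> V0" "V0 \<subseteq> W"
    and U: "U \<subseteq> C" "compact C" "H \<inter> U = {}"
    and max: "\<And>H'. add_subgroup H' \<Longrightarrow> H \<subseteq> H' \<Longrightarrow> H' \<inter> U = {} \<Longrightarrow> H' = H"
  shows "rel_compact_mod H (range (\<lambda>k. int_mult k y))"
proof (cases "\<exists>m>0. int_mult m y \<in> H")
  case True
  then obtain m where m: "m > 0" "int_mult m y \<in> H" by blast
  have cell: "int_mult k y - int_mult (k div m * m) y \<in> (\<lambda>i. int_mult i y) ` {0..<m}" for k
  proof -
    have "int_mult k y - int_mult (k div m * m) y = int_mult (k mod m) y"
      by (simp add: int_mult_diff_left[symmetric] minus_div_mult_eq_mod)
    then show ?thesis using m(1) by auto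
  qed
  have multH: "int_mult (k div m * m) y \<in> H" for k
    unfolding int_mult_mult by (rule add_subgroup_int_mult[OF H m(2)])
  have "\<forall>a\<in>range (\<lambda>k. int_mult k y). \<exists>h\<in>H. a - h \<in> (\<lambda>i. int_mult i y) ` {0..<m}"
  proof (intro ballI, elim rangeE)
    fix a k assume a: "a = int_mult k y"
    show "\<exists>h\<in>H. a - h \<in> (\<lambda>i. int_mult i y) ` {0..<m}" 
      unfolding a by (rule bexI[where x = "int_mult (k div m * m) y"], rule cell, rule multH)
  qed
  moreover have "compact ((\<lambda>i. int_mult i y) ` {0..<m})" by (intro finite_imp_compact) simp
  ultimately show ?thesis unfolding rel_compact_mod_def by (intro exI conjI)
next
  case False
  define S where "S = {j. \<exists>h\<in>H. h + int_mult j y \<in> U}"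
  have unb: "\<exists>j\<in>S. m \<le> \<bar>j\<bar>" if m: "m > 0" for m
  proof -
    define H' where "H' = {h + int_mult k (int_mult m y) |h k. h \<in> H}"
    have "add_subgroup H'" unfolding H'_def by (rule add_subgroup_adjoin[OF H])
    moreover have "H \<subseteq> H'" unfolding H'_def by (rule subset_adjoin)
    moreover have "int_mult m y \<in> H'" unfolding H'_def by (rule mem_adjoin[OF H])
    then have "H' \<noteq> H" using False m by blast
    ultimately have "H' \<inter> U \<noteq> {}" using max by blast
    then obtain h k where hk: "h \<in> H" "h + int_mult k (int_mult m y) \<in> U" unfolding H'_def by blast
    have "k \<noteq> 0" using hk U(3) by auto
    then have "m * 1 \<le> m * \<bar>k\<bar>" using m by (intro mult_left_mono) auto
    then have "m \<le> \<bar>k * m\<bar>" using m by (simp add: abs_mult mult.commute)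
    moreover have "k * m \<in> S" using hk unfolding S_def by (auto simp: int_mult_mult)
    ultimately show ?thesis by blast
  qed
  have inf: "infinite S"
  proof
    assume "finite S"
    then obtain b where b: "\<And>j. j \<in> S \<Longrightarrow> \<bar>j\<bar> \<le> b"
      by (metis finite_imageI finite_imp_Sup_less imageI less_imp_le linorder_not_less bdd_above_finite bdd_above.unfold)
    then show False using unb[of "max 1 (b + 1)"] by force
  qed
  show ?thesis
  proof (rule cyclic_rel_compact_if_recurrent[OF H W])
    fix V :: "'g set" and N :: int assume V: "open V" "0 \<in> V"
    obtain V' where V': "open V'" "0 \<in> V'" "\<And>a. a \<in> V' \<Longrightarrow> - a \<in> V'"
      "\<And>a b c. a \<in> V' \<Longrightarrow> b \<in> V' \<Longrightarrow> c \<in> V' \<Longrightarrow> a + b + c \<in> V"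
      using small_symmetric_nbhd[OF V] by blast
    obtain F where F: "finite F" "F \<subseteq> C" "\<And>a. a \<in> C \<Longrightarrow> \<exists>p\<in>F. a - p \<in> V'"
      using compact_finite_net[OF U(2) V'(1,2)] by blast
    have "\<exists>p\<in>F. \<exists>h\<in>H. h + int_mult j y - p \<in> V'" if "j \<in> S" for j
      using that F(3) U(1) unfolding S_def by blast
    then obtain P where P: "\<And>j. j \<in> S \<Longrightarrow> P j \<in> F" "\<And>j. j \<in> S \<Longrightarrow> \<exists>h\<in>H. h + int_mult j y - P j \<in> V'"
      by metis
    have "finite (P ` S)" using P(1) F(1) by (meson finite_subset image_subsetI)
    then obtain j0 where j0: "j0 \<in> S" "infinite {j\<in>S. P j = P j0}" using pigeonhole_infinite[OF inf] by blast
    have "\<not> {j\<in>S. P j = P j0} \<subseteq> {j0 - \<bar>N\<bar>..j0 + \<bar>N\<bar>}"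
      using j0(2) finite_subset[OF _ finite_atLeastAtMost_int] by blast
    then obtain j where j: "j \<in> S" "P j = P j0" "\<bar>j - j0\<bar> \<ge> N" by force
    have diff: "\<exists>h\<in>H. int_mult (a - b) y - h \<in> V" if ab: "a \<in> S" "b \<in> S" "P a = P b" for a b
    proof -
      obtain h1 h2 where h: "h1 \<in> H" "h1 + int_mult a y - P a \<in> V'" "h2 \<in> H" "h2 + int_mult b y - P b \<in> V'"
        using P(2) ab by blast
      have "int_mult (a - b) y - (h2 - h1) = (h1 + int_mult a y - P a) + - (h2 + int_mult b y - P b) + 0"
        by (simp add: ab(3) int_mult_diff_left algebra_simps)
      also have "\<dots> \<in> V" by (rule V'(4)[OF h(2) V'(3)[OF h(4)] V'(2)])
      finally show ?thesis using add_subgroup_diff[OF H h(3,1)] by blast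
    qed
    show "\<exists>n\<ge>N. \<exists>h\<in>H. int_mult n y - h \<in> V"
    proof (cases "j \<ge> j0")
      case True
      then show ?thesis using j diff[OF j(1) j0(1) j(2)] by (intro exI[of _ "j - j0"]) auto
    next
      case False
      then show ?thesis using j diff[OF j0(1) j(1)] by (intro exI[of _ "j0 - j"]) auto
    qed
  qed
qed

lemma maximal_subgroup_avoiding:
  assumes "(0::'g::ab_group_add) \<notin> U"
  obtains H where "add_subgroup H" "H \<inter> U = {}" 
    "\<And>H'. add_subgroup H' \<Longrightarrow> H \<subseteq> H' \<Longrightarrow> H' \<inter> U = {} \<Longrightarrow> H' = (H::'g set)"
proof -
  define \<A> where "\<A> = {H. add_subgroup H \<and> H \<inter> U = {}}"
  have "\<exists>M\<in>\<A>. \<forall>X\<in>\<A>. M \<subseteq> X \<longrightarrow> X = M"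
  proof (rule subset_Zorn_nonempty)
    have "{0} \<in> \<A>" using assms by (simp add: \<A>_def add_subgroup_def)
    then show "\<A> \<noteq> {}" by blast
    fix \<C> assume C: "\<C> \<noteq> {}" "subset.chain \<A> \<C>"
    have sub: "add_subgroup X" "X \<inter> U = {}" if "X \<in> \<C>" for X
      using C(2) that unfolding subset_chain_def \<A>_def by auto
    have "add_subgroup (\<Union>\<C>)" unfolding add_subgroup_def
    proof (intro conjI ballI)
      show "0 \<in> \<Union>\<C>" using C(1) sub(1) add_subgroup_0 by blast
      fix a b assume "a \<in> \<Union>\<C>" "b \<in> \<Union>\<C>"
      then obtain X Y where XY: "X \<in> \<C>" "Y \<in> \<C>" "a \<in> X" "b \<in> Y" by blast
      then have "X \<subseteq> Y \<or> Y \<subseteq> X" using C(2) unfolding subset_chain_def by blast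
      then show "a - b \<in> \<Union>\<C>" 
      proof
        assume "X \<subseteq> Y"
        then show ?thesis using XY add_subgroup_diff[OF sub(1)[OF XY(2)]] by blast
      next
        assume "Y \<subseteq> X"
        then show ?thesis using XY add_subgroup_diff[OF sub(1)[OF XY(1)]] by blast
      qed
    qed
    then show "\<Union>\<C> \<in> \<A>" using sub(2) by (auto simp: \<A>_def)
  qed
  then obtain H where H: "H \<in> \<A>" "\<And>X. X \<in> \<A> \<Longrightarrow> H \<subseteq> X \<Longrightarrow> X = H" by blast
  show ?thesis
  proof (rule that[of H])
    show "add_subgroup H" "H \<inter> U = {}" using H(1) by (simp_all add: \<A>_def)
    fix X assume "add_subgroup X" "H \<subseteq> X" "X \<inter> U = {}"
    then show "X = H" using H(2)[of X] by (simp add: \<A>_def)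
  qed
qed

lemma rel_compact_subgroup_containing_finite:
  assumes H: "add_subgroup H" and cyc: "\<And>y. rel_compact_mod H (range (\<lambda>k. int_mult k y))"
    and "finite F"
  shows "\<exists>D. add_subgroup D \<and> H \<subseteq> D \<and> F \<subseteq> D \<and> rel_compact_mod H D"
  using assms(3)
proof (induction F rule: finite_induct)
  case empty
  have "rel_compact_mod H H" unfolding rel_compact_mod_def by (intro exI[of _ "{0}"]) auto
  then show ?case using H by blast
next
  case (insert y F)
  then obtain D where D: "add_subgroup D" "H \<subseteq> D" "F \<subseteq> D" "rel_compact_mod H D" by blast
  define D' where "D' = {d + int_mult k y |d k. d \<in> D}"
  have "D' = {a + b |a b. a \<in> D \<and> b \<in> range (\<lambda>k. int_mult k y)}" unfolding D'_def by blast
  then have "rel_compact_mod H D'" using rel_compact_mod_add[OF H D(4) cyc] by simp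
  moreover have "add_subgroup D'" unfolding D'_def by (rule add_subgroup_adjoin[OF D(1)])
  moreover have "D \<subseteq> D'" unfolding D'_def by (rule subset_adjoin)
  moreover have "y \<in> D'" unfolding D'_def by (rule mem_adjoin[OF D(1)])
  ultimately show ?case using D by (intro exI[of _ D']) auto
qed

text \<open>
  For a compact symmetric neighbourhood \<open>Z\<close> of \<open>0\<close>, the set \<open>Z + Z\<close> is covered by finitely many
  translates of \<open>Z\<close>. If the subgroup \<open>D\<close> contains the translating elements, then \<open>Z + D\<close> is closed under
  subtraction, hence already a subgroup.
\<close>

lemma open_rel_compact_subgroup:
  fixes H W V0 :: "'g::topological_ab_group_add set" and x :: 'g
  assumes H: "add_subgroup H" and W: "compact W" "open V0" "0 \<in> V0" "V0 \<subseteq> W"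
    and cyc: "\<And>y. rel_compact_mod H (range (\<lambda>k. int_mult k y))"
  shows "\<exists>D. add_subgroup D \<and> open D \<and> H \<subseteq> D \<and> x \<in> D \<and> rel_compact_mod H D"
proof -
  define Z where "Z = W \<union> uminus ` W \<union> {x, - x}"
  have Z: "compact Z" unfolding Z_def
    by (intro compact_Un W(1) compact_continuous_image continuous_intros finite_imp_compact) simp
  have Zm: "- a \<in> Z" if "a \<in> Z" for a using that by (auto simp: Z_def)
  obtain F where F: "finite F" "\<And>a. a \<in> (\<lambda>p. fst p + snd p) ` (Z \<times> Z) \<Longrightarrow> \<exists>p\<in>F. a - p \<in> V0"
    using compact_finite_net[OF compact_sums[OF Z Z] W(2,3)] by metis
  obtain D where D: "add_subgroup D" "H \<subseteq> D" "F \<subseteq> D" "rel_compact_mod H D"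
    using rel_compact_subgroup_containing_finite[OF H cyc F(1)] by blast
  define G where "G = {a + b |a b. a \<in> Z \<and> b \<in> D}"
  have V0Z: "V0 \<subseteq> Z" using W(4) by (auto simp: Z_def)
  have ZG: "Z \<subseteq> G" unfolding G_def using add_subgroup_0[OF D(1)] by force
  have G: "add_subgroup G" unfolding add_subgroup_def
  proof (intro conjI ballI)
    show "0 \<in> G" using ZG V0Z W(3) by blast
    fix a b assume "a \<in> G" "b \<in> G"
    then obtain z d z' d' where ab: "a = z + d" "b = z' + d'" "z \<in> Z" "z' \<in> Z" "d \<in> D" "d' \<in> D"
      unfolding G_def by blast
    have "z - z' \<in> (\<lambda>p. fst p + snd p) ` (Z \<times> Z)" using ab(3) Zm[OF ab(4)] by force
    then obtain p where p: "p \<in> F" "z - z' - p \<in> V0" using F(2) by blast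
    have "a - b = (z - z' - p) + (p + (d - d'))" by (simp add: ab algebra_simps)
    moreover have "p + (d - d') \<in> D" using p(1) D(3) ab by (intro add_subgroup_add[OF D(1)] add_subgroup_diff[OF D(1)]) auto
    ultimately show "a - b \<in> G" unfolding G_def using p(2) V0Z by blast
  qed
  have "open G"
  proof (rule topological_space_class.openI)
    fix a assume a: "a \<in> G"
    have "open ((\<lambda>b. b - a) -` V0)" by (intro open_vimage W(2) continuous_intros)
    moreover have "a \<in> (\<lambda>b. b - a) -` V0" using W(3) by simp
    moreover have "(\<lambda>b. b - a) -` V0 \<subseteq> G"
    proof
      fix b assume "b \<in> (\<lambda>b. b - a) -` V0"
      then have "b - a \<in> G" using V0Z ZG by auto
      then show "b \<in> G" using add_subgroup_add[OF G _ a, of "b - a"] by simp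
    qed
    ultimately show "\<exists>T. open T \<and> a \<in> T \<and> T \<subseteq> G" by blast
  qed
  moreover have "H \<subseteq> G" 
  proof
    fix h assume "h \<in> H"
    then have "0 + h \<in> G" unfolding G_def using D(2) V0Z W(3) by blast
    then show "h \<in> G" by simp
  qed
  moreover have "x \<in> G" using ZG by (auto simp: Z_def)
  moreover have "rel_compact_mod H G" unfolding G_def
  proof (rule rel_compact_mod_add[OF H _ D(4)])
    have "\<forall>a\<in>Z. \<exists>h\<in>H. a - h \<in> Z" using add_subgroup_0[OF H] by (auto intro!: bexI[of _ 0])
    then show "rel_compact_mod H Z" using Z unfolding rel_compact_mod_def by blast
  qed
  ultimately show ?thesis using G by blast
qed

section \<open>Continuous characters separate points\<close>

text \<open>
  Complete regularity gives the bump; a continuous function vanishing outside a compact set is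
  uniformly continuous by the tube lemma. A translation leading into the compact set is
  read backwards.
\<close>

lemma uniformly_continuous_bump:
  fixes U C :: "'g::{topological_ab_group_add, t2_space} set"
  assumes lc: "locally_compact_space (euclidean :: 'g topology)"
    and U: "open U" "U \<subseteq> C" "compact C" "0 \<in> U"
  obtains f :: "'g \<Rightarrow> real" where "\<And>t. 0 \<le> f t" "\<And>t. f t \<le> 1" "f 0 = 1" "\<And>t. t \<notin> U \<Longrightarrow> f t = 0"
    "\<And>e. e > 0 \<Longrightarrow> \<exists>V. open V \<and> 0 \<in> V \<and> (\<forall>y\<in>V. \<forall>t. \<bar>f (t + y) - f t\<bar> \<le> e)"
proof -
  have "Hausdorff_space (euclidean :: 'g topology)"
    unfolding Hausdorff_space_def using hausdorff[where 'a = 'g] by (simp add: disjnt_def)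
  then have "completely_regular_space (euclidean :: 'g topology)"
    using lc locally_compact_Hausdorff_imp_regular_space locally_compact_regular_imp_completely_regular_space by blast
  then obtain k where k: "continuous_map euclidean (top_of_set {0..1}) k" "k (0::'g) = (0::real)" "k ` (- U) \<subseteq> {1}"
    unfolding completely_regular_space_def using U by (metis Diff_iff UNIV_I closed_Compl closed_closedin ComplD topspace_euclidean)
  define f where "f t = 1 - k t" for t
  have k01: "0 \<le> k t" "k t \<le> 1" for t
    using continuous_map_image_subset_topspace[OF k(1)] by (auto simp: image_subset_iff)
  have kc: "continuous_on UNIV k" using k(1) by (simp add: continuous_map_in_subtopology)
  have fU: "f t = 0" if "t \<notin> U" for t using k(3) that by (auto simp: f_def)
  have "\<exists>V. open V \<and> 0 \<in> V \<and> (\<forall>y\<in>V. \<forall>t. \<bar>f (t + y) - f t\<bar> \<le> e)" if e: "e > 0" for e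
  proof -
    have "continuous_on (UNIV \<times> C) (\<lambda>p. f (snd p + fst p))"
      unfolding f_def by (intro continuous_intros continuous_on_compose2[OF kc]) auto
    then obtain X where X: "0 \<in> X" "open X" "\<forall>y\<in>X \<inter> UNIV. \<forall>t\<in>C. dist (f (t + y)) (f (t + 0)) \<le> e"
      using continuous_on_prod_compactE[of UNIV C "\<lambda>p. f (snd p + fst p)" 0 e] U(3) e by auto
    define V where "V = X \<inter> uminus -` X"
    have "open V" unfolding V_def by (intro open_Int X(2) open_vimage continuous_intros)
    moreover have "0 \<in> V" using X by (simp add: V_def)
    moreover have "\<bar>f (t + y) - f t\<bar> \<le> e" if y: "y \<in> V" for y t
    proof (cases "t \<in> C")
      case True
      then show ?thesis using X(3) y by (auto simp: V_def dist_real_def)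
    next
      case False
      then have ft: "f t = 0" using fU U(2) by blast
      show ?thesis
      proof (cases "t + y \<in> C")
        case True
        then have "dist (f (t + y + - y)) (f (t + y + 0)) \<le> e" 
          using X(3)[rule_format, of "- y" "t + y"] y by (simp add: V_def)
        then show ?thesis by (simp add: dist_real_def abs_minus_commute)
      next
        case False
        then have "f (t + y) = 0" using fU U(2) by blast
        then show ?thesis using ft \<open>e > 0\<close> by simp
      qed
    qed
    ultimately show ?thesis by blast
  qed
  then show ?thesis using that[of f] k k01 fU by (simp add: f_def)
qed

text \<open>
  The supremum of the bump over the cosets of \<open>H\<close> is still uniformly continuous and is periodic
  under \<open>H\<close>; it vanishes at \<open>x\<close> because \<open>H\<close> avoids \<open>U\<close>. Compactness of \<open>D\<close> modulo \<open>H\<close> makes it almost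
  periodic on \<open>D\<close>. The resulting character is continuous at \<open>0\<close> because \<open>D\<close> is open, hence
  everywhere.
\<close>

theorem continuous_characters_separate_points:
  fixes x :: "'g::{topological_ab_group_add, t2_space}"
  assumes lc: "locally_compact_space (euclidean :: 'g topology)" and x: "x \<noteq> 0"
  shows "\<exists>\<gamma>. is_character \<gamma> \<and> continuous_on UNIV \<gamma> \<and> \<gamma> x \<noteq> 1"
proof -
  obtain V0 W :: "'g set" where W: "open V0" "compact W" "0 \<in> V0" "V0 \<subseteq> W"
    using lc unfolding locally_compact_space_def by (metis UNIV_I compactin_euclidean_iff open_openin topspace_euclidean)
  define U where "U = {a. x - a \<in> V0} - {0}"
  define C where "C = (\<lambda>a. x - a) ` W"
  have "open {a. x - a \<in> V0}" using open_vimage[OF W(1), of "\<lambda>a. x - a"] by (simp add: vimage_def continuous_intros)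
  then have U: "open U" unfolding U_def by (intro open_delete)
  have xU: "x \<in> U" using x W(3) by (simp add: U_def)
  have C: "compact C" unfolding C_def by (intro compact_continuous_image W(2) continuous_intros)
  have UC: "U \<subseteq> C"
  proof
    fix a assume "a \<in> U"
    then have "x - a \<in> W" using W(4) by (auto simp: U_def)
    then have "x - (x - a) \<in> C" unfolding C_def by blast
    then show "a \<in> C" by simp
  qed
  have "0 \<notin> U" by (simp add: U_def)
  then obtain H where H: "add_subgroup H" "H \<inter> U = {}" 
    "\<And>H'. add_subgroup H' \<Longrightarrow> H \<subseteq> H' \<Longrightarrow> H' \<inter> U = {} \<Longrightarrow> H' = H"
    using maximal_subgroup_avoiding by metis
  have cyc: "rel_compact_mod H (range (\<lambda>k. int_mult k y))" for y
    by (rule cyclic_rel_compact_mod_maximal[OF H(1) W(2,1,3,4) UC C H(2,3)])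
  obtain D where D: "add_subgroup D" "open D" "H \<subseteq> D" "x \<in> D" "rel_compact_mod H D"
    using open_rel_compact_subgroup[OF H(1) W(2,1,3,4) cyc] by blast
  have U1: "open {a. x - a \<in> U}" using open_vimage[OF U, of "\<lambda>a. x - a"] by (simp add: vimage_def continuous_intros)
  have U2: "{a. x - a \<in> U} \<subseteq> W" using W(4) by (auto simp: U_def)
  have U3: "0 \<in> {a. x - a \<in> U}" using xU by simp
  obtain f0 :: "'g \<Rightarrow> real" where f0: "\<And>t. 0 \<le> f0 t" "\<And>t. f0 t \<le> 1" "f0 0 = 1" 
    "\<And>t. t \<notin> {a. x - a \<in> U} \<Longrightarrow> f0 t = 0"
    "\<And>e. e > 0 \<Longrightarrow> \<exists>V. open V \<and> 0 \<in> V \<and> (\<forall>y\<in>V. \<forall>t. \<bar>f0 (t + y) - f0 t\<bar> \<le> e)"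
    by (rule uniformly_continuous_bump[OF lc U1 U2 W(2) U3]) (rule that)
  define f where "f t = (SUP h\<in>H. f0 (t + h))" for t
  have Hne: "H \<noteq> {}" using add_subgroup_0[OF H(1)] by blast
  have up: "f0 (t + h) \<le> f t" if "h \<in> H" for t h
    unfolding f_def using that f0(2) by (intro cSUP_upper bdd_aboveI[of _ 1]) auto
  have lub: "f t \<le> b" if "\<And>h. h \<in> H \<Longrightarrow> f0 (t + h) \<le> b" for t b
    unfolding f_def using that by (rule cSUP_least[OF Hne])
  have f0t: "0 \<le> f t" for t using up[OF add_subgroup_0[OF H(1)], of t] f0(1)[of "t + 0"] by linarith
  have f1t: "f t \<le> 1" for t by (rule lub) (rule f0(2))
  have per: "f (t + h) = f t" if h: "h \<in> H" for t h
  proof (rule antisym)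
    show "f (t + h) \<le> f t"
      by (rule lub) (use up[OF add_subgroup_add[OF H(1) h]] in \<open>simp add: add.assoc\<close>)
    show "f t \<le> f (t + h)"
    proof (rule lub)
      fix k assume "k \<in> H"
      then show "f0 (t + k) \<le> f (t + h)" using up[OF add_subgroup_diff[OF H(1) _ h], of k "t + h"] by simp
    qed
  qed
  have unif: "\<exists>V. open V \<and> 0 \<in> V \<and> (\<forall>y\<in>V. \<forall>t. \<bar>f (t + y) - f t\<bar> \<le> e)" if e: "e > 0" for e
  proof -
    obtain V where V: "open V" "0 \<in> V" "\<And>y t. y \<in> V \<Longrightarrow> \<bar>f0 (t + y) - f0 t\<bar> \<le> e" using f0(5)[OF e] by blast
    have "\<bar>f (t + y) - f t\<bar> \<le> e" if y: "y \<in> V" for y t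
    proof -
      have *: "\<bar>f0 (t + y + h) - f0 (t + h)\<bar> \<le> e" for h
        using V(3)[OF y, of "t + h"] by (simp add: add.assoc add.commute add.left_commute)
      have "f (t + y) \<le> f t + e"
      proof (rule lub)
        fix h assume "h \<in> H"
        then show "f0 (t + y + h) \<le> f t + e" using *[of h] up[of h t] by linarith
      qed
      moreover have "f t \<le> f (t + y) + e"
      proof (rule lub)
        fix h assume "h \<in> H"
        then show "f0 (t + h) \<le> f (t + y) + e" using *[of h] up[of h "t + y"] by linarith
      qed
      ultimately show ?thesis by linarith
    qed
    then show ?thesis using V(1,2) by blast
  qed
  have "f 0 \<ge> 1" using up[OF add_subgroup_0[OF H(1)], of 0] f0(3) by simp
  moreover have "f x \<le> 0"
  proof (rule lub)
    fix h assume "h \<in> H"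
    then have "- h \<notin> U" using add_subgroup_minus[OF H(1)] H(2) by blast
    then show "f0 (x + h) \<le> 0" using f0(4)[of "x + h"] by simp
  qed
  ultimately have fx: "f x \<noteq> f 0" by linarith
  have ap: "almost_periodic_on D f" unfolding almost_periodic_on_def
  proof (intro allI impI)
    fix e :: real assume e: "e > 0"
    obtain V where V: "open V" "0 \<in> V" "\<And>y t. y \<in> V \<Longrightarrow> \<bar>f (t + y) - f t\<bar> \<le> e" using unif[OF e] by blast
    obtain C' where C': "compact C'" "\<And>a. a \<in> D \<Longrightarrow> \<exists>h\<in>H. a - h \<in> C'" using D(5) unfolding rel_compact_mod_def by blast
    \<comment> \<open>A net in the intersection with \<open>D\<close> guarantees that the net points used belong to \<open>D\<close>.\<close>
    have "open (V \<inter> D)" "0 \<in> V \<inter> D" using V D(2) add_subgroup_0[OF D(1)] by auto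
    then obtain F where F: "finite F" "\<And>a. a \<in> C' \<Longrightarrow> \<exists>p\<in>F. a - p \<in> V \<inter> D"
      using compact_finite_net[OF C'(1)] by metis
    have "\<exists>b\<in>F \<inter> D. \<forall>s\<in>D. \<bar>f (s + t) - f (s + b)\<bar> \<le> e" if t: "t \<in> D" for t
    proof -
      obtain h p where hp: "h \<in> H" "p \<in> F" "t - h - p \<in> V \<inter> D" using C'(2)[OF t] F(2) by blast
      have "h \<in> D" "t - h - p \<in> D" using hp D(3) by auto
      then have "t - h - (t - h - p) \<in> D" by (rule add_subgroup_diff[OF D(1) add_subgroup_diff[OF D(1) t]])
      then have pD: "p \<in> D" by simp
      have "\<bar>f (s + t) - f (s + p)\<bar> \<le> e" for s
      proof -
        have "f (s + t) = f ((s + p) + (t - h - p) + h)" by (simp add: algebra_simps)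
        also have "\<dots> = f ((s + p) + (t - h - p))" by (rule per[OF hp(1)])
        finally show ?thesis using V(3)[of "t - h - p" "s + p"] hp(3) by simp
      qed
      then show ?thesis using hp(2) pD by blast
    qed
    then show "\<exists>B. finite B \<and> B \<subseteq> D \<and> (\<forall>t\<in>D. \<exists>b\<in>B. \<forall>s\<in>D. \<bar>f (s + t) - f (s + b)\<bar> \<le> e)"
      using F(1) by (intro exI[of _ "F \<inter> D"]) auto
  qed
  have "\<bar>f t\<bar> \<le> 1" for t using f0t[of t] f1t[of t] by simp
  then obtain \<gamma> K where \<gamma>: "is_character \<gamma>" "\<gamma> x \<noteq> 1" and
    K: "\<And>y e. y \<in> D \<Longrightarrow> (\<forall>t\<in>D. \<bar>f (t + y) - f t\<bar> \<le> e) \<Longrightarrow> norm (\<gamma> y - 1) \<le> K * e"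
    using almost_periodic_separation[OF D(1) _ ap D(4) fx] by metis
  have "isCont \<gamma> a" for a
    unfolding isCont_def
  proof (rule tendstoI)
    fix e :: real assume e: "e > 0"
    define d where "d = e / (\<bar>K\<bar> + 1)"
    have d: "d > 0" using e by (simp add: d_def add_nonneg_pos)
    obtain V where V: "open V" "0 \<in> V" "\<And>y t. y \<in> V \<Longrightarrow> \<bar>f (t + y) - f t\<bar> \<le> d" using unif[OF d] by blast
    have "dist (\<gamma> z) (\<gamma> a) < e" if z: "z - a \<in> V \<inter> D" for z
    proof -
      have n1: "norm (\<gamma> a) = 1" using \<gamma>(1) by (simp add: is_character_def)
      have "\<gamma> z = \<gamma> (z - a) * \<gamma> a" using \<gamma>(1) unfolding is_character_def by (metis diff_add_cancel)
      then have "\<gamma> z - \<gamma> a = (\<gamma> (z - a) - 1) * \<gamma> a" by (simp add: algebra_simps)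
      then have "dist (\<gamma> z) (\<gamma> a) = norm (\<gamma> (z - a) - 1)" by (simp add: dist_norm norm_mult n1)
      also have "\<dots> \<le> K * d" using K[of "z - a" d] z V(3) by blast
      also have "\<dots> \<le> \<bar>K\<bar> * d" using d by (intro mult_right_mono) auto
      also have "\<dots> < (\<bar>K\<bar> + 1) * d" using d by simp
      also have "\<dots> = e" by (simp add: d_def add_nonneg_pos)
      finally show ?thesis .
    qed
    moreover have "open ((\<lambda>z. z - a) -` (V \<inter> D))" by (intro open_vimage open_Int V(1) D(2) continuous_intros)
    moreover have "a \<in> (\<lambda>z. z - a) -` (V \<inter> D)" using V(2) add_subgroup_0[OF D(1)] by simp
    ultimately show "\<forall>\<^sub>F z in at a. dist (\<gamma> z) (\<gamma> a) < e"
      unfolding eventually_at_topological by blast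
  qed
  then have "continuous_on UNIV \<gamma>" by (simp add: continuous_at_imp_continuous_on)
  then show ?thesis using \<gamma> by blast
qed

section \<open>Continuous endomorphisms of the torus\<close>

lemma additive_continuous_real_linear:
  fixes A :: "real \<Rightarrow> complex"
  assumes cont: "continuous_on UNIV A" and add: "\<And>s t. A (s + t) = A s + A t"
  shows "A t = of_real t * A 1"
proof -
  have nat: "A (of_nat n * x) = of_nat n * A x" for n x
  proof (induction n)
    case 0
    then show ?case using add[of 0 0] by simp
  next
    case (Suc n)
    then show ?case using add[of x "of_nat n * x"] by (simp add: algebra_simps)
  qed
  have minus: "A (- x) = - A x" for x
    using add[of x "- x"] add[of 0 0] by (simp add: eq_neg_iff_add_eq_0 add.commute)
  have int: "A (of_int n * x) = of_int n * A x" for n x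
  proof (cases "n \<ge> 0")
    case True
    then show ?thesis using nat[of "nat n" x] by simp
  next
    case False
    then show ?thesis using nat[of "nat (- n)" x] minus[of "of_int n * x"] by simp
  qed
  have rat: "A r = of_real r * A 1" if r: "r \<in> \<rat>" for r
  proof -
    obtain a b where ab: "b > 0" "r = of_int a / of_int b" using Rats_cases'[OF r] by metis
    have "of_int b * A r = A (of_int b * r)" by (rule int[symmetric])
    also have "of_int b * r = of_int a * 1" using ab by simp
    also have "A (of_int a * 1) = of_int a * A 1" by (rule int)
    also have "of_int a = of_int b * complex_of_real r"
    proof -
      have "of_int a = of_int b * r" using ab by simp
      then show ?thesis by (metis of_real_mult of_real_of_int_eq)
    qed
    finally have "of_int b * A r = of_int b * (of_real r * A 1)" by (simp only: mult.assoc)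
    moreover have "of_int b \<noteq> (0 :: complex)" using ab by simp
    ultimately show ?thesis by (simp only: mult_cancel_left) simp
  qed
  have "closed {t. A t = of_real t * A 1}"
    by (intro closed_Collect_eq cont continuous_intros)
  then have "closure \<rat> \<subseteq> {t. A t = of_real t * A 1}"
    by (rule closure_minimal[rotated]) (intro subsetI CollectI rat)
  then have "t \<in> {t. A t = of_real t * A 1}" unfolding Rats_closure_real by (rule subsetD) simp
  then show ?thesis by (rule CollectD)
qed

text \<open>
  A continuous logarithm of \<open>t \<mapsto> \<phi> (cis t)\<close> is additive up to multiples of \<open>2 \<pi> \<i>\<close>, which depend
  continuously on \<open>t\<close> and hence are constant. After normalization at \<open>0\<close> it is therefore additive,
  thus linear, and periodicity of \<open>cis\<close> makes its slope an integer multiple of \<open>\<i>\<close>.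
\<close>

lemma circle_endomorphism_is_power:
  fixes \<phi> :: "complex \<Rightarrow> complex"
  assumes cont: "continuous_on (sphere 0 1) \<phi>" and nz: "\<And>z. norm z = 1 \<Longrightarrow> \<phi> z \<noteq> 0"
    and mult: "\<And>z w. norm z = 1 \<Longrightarrow> norm w = 1 \<Longrightarrow> \<phi> (z * w) = \<phi> z * \<phi> w"
  shows "\<exists>k. \<forall>z. norm z = 1 \<longrightarrow> \<phi> z = z powi k"
proof -
  have "continuous_on UNIV (\<lambda>t. \<phi> (cis t))"
    by (intro continuous_on_compose2[OF cont] continuous_intros) auto
  then obtain g where g: "continuous_on UNIV g" "\<And>t::real. \<phi> (cis t) = exp (g t)"
    by (rule continuous_logarithm_on_contractible) (auto simp: nz contractible_UNIV)
  define A where "A t = g t - g 0" for t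
  have "\<phi> 1 * \<phi> 1 = \<phi> 1" using mult[of 1 1] by simp
  then have "\<phi> 1 = 1" using nz[of 1] by simp
  then have g0: "exp (g 0) = 1" using g(2)[of 0] by simp
  have expA: "\<phi> (cis t) = exp (A t)" for t by (simp add: g(2) A_def exp_diff g0)
  have "A (s + t) = A s + A t" for s t
  proof -
    define d where "d t = A (s + t) - A s - A t" for t
    have d1: "\<exists>n::int. d t = of_real (of_int (2 * n) * pi) * \<i>" for t
    proof -
      have "exp (d t) = 1" unfolding d_def exp_diff using mult[of "cis s" "cis t"] 
        by (simp add: expA[symmetric] cis_mult nz)
      then obtain n :: int where "Re (d t) = 0" "Im (d t) = of_int (2 * n) * pi" unfolding exp_eq_1 by blast
      then have "d t = of_real (of_int (2 * n) * pi) * \<i>" by (simp add: complex_eq_iff)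
      then show ?thesis by blast
    qed
    have "d constant_on UNIV"
    proof (rule continuous_discrete_range_constant)
      show "continuous_on UNIV d" unfolding d_def A_def
        by (intro continuous_intros continuous_on_compose2[OF g(1)]) auto
      fix x
      have "2 * pi \<le> norm (d y - d x)" if ne: "d y \<noteq> d x" for y
      proof -
        obtain m n :: int where mn: "d x = of_real (of_int (2 * m) * pi) * \<i>" "d y = of_real (of_int (2 * n) * pi) * \<i>"
          using d1 by blast
        have "d y - d x = of_real (of_int (2 * (n - m)) * pi) * \<i>" by (simp add: mn algebra_simps)
        then have "norm (d y - d x) = \<bar>of_int (2 * (n - m)) * pi\<bar>"
          by (simp only: norm_mult norm_of_real norm_ii mult_1_right)
        also have "\<bar>of_int (2 * x) * pi\<bar> = 2 * pi * of_int \<bar>x\<bar>" for x :: int by (simp add: abs_mult)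
        finally have 1: "norm (d y - d x) = 2 * pi * of_int \<bar>n - m\<bar>" .
        have "n \<noteq> m" using ne mn by auto
        then have "1 \<le> real_of_int \<bar>n - m\<bar>" by linarith
        then have "2 * pi * 1 \<le> 2 * pi * of_int \<bar>n - m\<bar>" by (intro mult_left_mono) auto
        then show ?thesis using 1 by simp
      qed
      then show "\<exists>e>0. \<forall>y. y \<in> UNIV \<and> d y \<noteq> d x \<longrightarrow> e \<le> norm (d y - d x)"
        by (intro exI[of _ "2 * pi"]) auto
    qed simp
    then have "d t = d 0" unfolding constant_on_def by (metis UNIV_I)
    moreover have "A 0 = 0" by (simp add: A_def)
    ultimately have "A (s + t) - (A s + A t) = 0" by (simp add: d_def diff_diff_eq)
    then show ?thesis by simp
  qed
  then have lin: "A t = of_real t * A 1" for t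
    by (rule additive_continuous_real_linear[rotated]) (unfold A_def, intro continuous_intros g(1))
  have "exp (A (2 * pi)) = 1" using expA[of "2 * pi"] \<open>\<phi> 1 = 1\<close> by simp
  then obtain k :: int where "Re (A (2 * pi)) = 0" "Im (A (2 * pi)) = of_int (2 * k) * pi"
    unfolding exp_eq_1 by blast
  then have k: "A (2 * pi) = of_real (of_int (2 * k) * pi) * \<i>" by (simp add: complex_eq_iff)
  have "of_real (2 * pi) * A 1 = of_real (2 * pi) * (of_int k * \<i>)" using k lin[of "2 * pi"] by simp
  then have A1: "A 1 = of_int k * \<i>" by (simp only: mult_cancel_left) simp
  have "\<phi> z = z powi k" if z: "norm z = 1" for z
  proof -
    have "z \<noteq> 0" using z by auto
    then have zc: "z = cis (Arg z)" using cis_Arg[of z] z by (simp add: sgn_eq)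
    have "\<phi> (cis (Arg z)) = exp (\<i> * of_real (of_int k * Arg z))" 
      unfolding expA lin[of "Arg z"] A1 by (simp add: mult_ac)
    also have "\<dots> = cis (of_int k * Arg z)" by (simp add: cis_conv_exp)
    also have "\<dots> = cis (Arg z) powi k" by (simp add: cis_power_int)
    finally show ?thesis using zc by simp
  qed
  then show ?thesis by blast
qed

definition torus_axis :: "'n \<Rightarrow> complex \<Rightarrow> complex ^ 'n" where
  "torus_axis j w = (\<chi> i. if i = j then w else 1)"

lemma continuous_on_vec_mult:
  fixes f g :: "'a::topological_space \<Rightarrow> complex ^ 'n"
  assumes "continuous_on S f" "continuous_on S g"
  shows "continuous_on S (\<lambda>x. f x * g x)"
proof -
  have "continuous_on S (\<lambda>x. \<chi> i. f x $ i * g x $ i)"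
    by (intro continuous_on_vec_lambda continuous_intros assms)
  then show ?thesis by (simp add: times_vec_def)
qed

lemma torus_axis_in_torus: "norm w = 1 \<Longrightarrow> torus_axis j w \<in> torus"
  by (simp add: torus_axis_def torus_def)

lemma torus_mult: "z \<in> torus \<Longrightarrow> w \<in> torus \<Longrightarrow> z * w \<in> torus"
  by (simp add: torus_def norm_mult)

lemma torus_one: "1 \<in> torus"
  by (simp add: torus_def)

lemma torus_nz: "z \<in> torus \<Longrightarrow> z $ i \<noteq> 0"
  unfolding torus_def by (metis (mono_tags, lifting) mem_Collect_eq norm_zero zero_neq_one)

lemma closed_torus: "closed (torus :: (complex ^ 'n) set)"
  unfolding torus_def by (intro closed_Collect_all closed_Collect_eq continuous_intros)

text \<open>
  A point of the torus is the product of its coordinates, each placed on its own axis.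
\<close>

lemma torus_character_is_monomial:
  fixes \<phi> :: "complex ^ 'n \<Rightarrow> complex"
  assumes cont: "continuous_on torus \<phi>" and nz: "\<And>z. z \<in> torus \<Longrightarrow> \<phi> z \<noteq> 0"
    and mult: "\<And>z w. z \<in> torus \<Longrightarrow> w \<in> torus \<Longrightarrow> \<phi> (z * w) = \<phi> z * \<phi> w"
  shows "\<exists>k. \<forall>z\<in>torus. \<phi> z = (\<Prod>j\<in>UNIV. (z $ j) powi k j)"
proof -
  have "\<exists>k. \<forall>w. norm w = 1 \<longrightarrow> \<phi> (torus_axis j w) = w powi k" for j
  proof (rule circle_endomorphism_is_power)
    have "continuous_on (sphere 0 1) (torus_axis j)"
      unfolding torus_axis_def by (intro continuous_on_vec_lambda, case_tac "i = j") simp_all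
    then show "continuous_on (sphere 0 1) (\<lambda>w. \<phi> (torus_axis j w))"
      by (rule continuous_on_compose2[OF cont]) (auto intro: torus_axis_in_torus)
    fix z w :: complex assume zw: "norm z = 1" "norm w = 1"
    have "torus_axis j (z * w) = torus_axis j z * torus_axis j w"
      by (simp add: torus_axis_def vec_eq_iff)
    then show "\<phi> (torus_axis j (z * w)) = \<phi> (torus_axis j z) * \<phi> (torus_axis j w)"
      using mult[OF torus_axis_in_torus[OF zw(1)] torus_axis_in_torus[OF zw(2)]] by simp
  qed (simp add: nz torus_axis_in_torus)
  then obtain k where k: "\<And>j w. norm w = 1 \<Longrightarrow> \<phi> (torus_axis j w) = w powi k j" by metis
  have "\<phi> z = (\<Prod>j\<in>UNIV. (z $ j) powi k j)" if z: "z \<in> torus" for z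
  proof -
    have nz1: "norm (z $ i) = 1" for i using z by (simp add: torus_def)
    have "\<phi> (\<chi> i. if i \<in> S then z $ i else 1) = (\<Prod>j\<in>S. (z $ j) powi k j)" if "finite S" for S
      using that
    proof (induction S rule: finite_induct)
      case empty
      have "(\<chi> i. 1) = (1 :: complex ^ 'n)" by (simp add: vec_eq_iff)
      moreover have "\<phi> 1 * \<phi> 1 = \<phi> 1" using mult[OF torus_one torus_one] by simp
      ultimately show ?case using nz[OF torus_one] by simp
    next
      case (insert a S)
      have "(\<chi> i. if i \<in> insert a S then z $ i else 1) = torus_axis a (z $ a) * (\<chi> i. if i \<in> S then z $ i else 1)"
        using insert(2) by (auto simp: vec_eq_iff torus_axis_def)
      moreover have "(\<chi> i. if i \<in> S then z $ i else 1) \<in> torus" by (simp add: torus_def nz1)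
      ultimately show ?case
        using insert mult[OF torus_axis_in_torus[OF nz1]] k[OF nz1] by simp
    qed
    from this[of UNIV] show ?thesis by simp
  qed
  then show ?thesis by blast
qed

lemma Psi_in_torus: "z \<in> torus \<Longrightarrow> Psi P z \<in> torus"
  by (simp add: Psi_def torus_def norm_power_int flip: prod_norm)

lemma Psi_mult: "Psi P (z * w) = Psi P z * Psi P w"
  by (simp add: Psi_def vec_eq_iff power_int_mult_distrib prod.distrib)

lemma continuous_on_Psi: "continuous_on torus (Psi P)"
  unfolding Psi_def by (intro continuous_on_vec_lambda continuous_intros) (auto simp: torus_nz)

lemma torus_endomorphism_is_Psi:
  fixes \<theta> :: "complex ^ 'n \<Rightarrow> complex ^ 'n"
  assumes cont: "continuous_on torus \<theta>" and im: "\<And>z. z \<in> torus \<Longrightarrow> \<theta> z \<in> torus"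
    and mult: "\<And>z w. z \<in> torus \<Longrightarrow> w \<in> torus \<Longrightarrow> \<theta> (z * w) = \<theta> z * \<theta> w"
  shows "\<exists>P. \<forall>z\<in>torus. \<theta> z = Psi P z"
proof -
  have "\<exists>k. \<forall>z\<in>torus. \<theta> z $ i = (\<Prod>j\<in>UNIV. (z $ j) powi k j)" for i
    by (rule torus_character_is_monomial) (auto intro!: continuous_intros cont simp: torus_nz im mult)
  then obtain k where k: "\<And>i z. z \<in> torus \<Longrightarrow> \<theta> z $ i = (\<Prod>j\<in>UNIV. (z $ j) powi k i j)" by metis
  have "\<forall>z\<in>torus. \<theta> z = Psi (\<chi> i j. k i j) z" by (simp add: Psi_def vec_eq_iff k)
  then show ?thesis by blast
qed

lemma Psi_torus_axis: "Psi P (torus_axis j w) $ i = w powi (P $ i $ j)"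
proof -
  have "(\<Prod>l\<in>UNIV. (torus_axis j w $ l) powi (P $ i $ l)) = (\<Prod>l\<in>UNIV. if l = j then w powi (P $ i $ l) else 1)"
    by (intro prod.cong) (auto simp: torus_axis_def)
  then show ?thesis by (simp add: Psi_def)
qed

text \<open>
  If two exponents differ by \<open>d \<noteq> 0\<close>, the point \<open>cis (\<pi> / d)\<close> on the axis tells them apart, since
  its \<open>d\<close>-th power is \<open>-1\<close>.
\<close>

lemma Psi_inject:
  assumes "\<And>z. z \<in> torus \<Longrightarrow> Psi P z = Psi Q z" shows "P = Q"
proof -
  have "P $ i $ j = Q $ i $ j" for i j
  proof (rule ccontr)
    assume ne: "P $ i $ j \<noteq> Q $ i $ j"
    define d where "d = P $ i $ j - Q $ i $ j"
    define w where "w = cis (pi / of_int d)"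
    have d: "d \<noteq> 0" using ne by (simp add: d_def)
    have "w powi (P $ i $ j) = w powi (Q $ i $ j)"
      using assms[OF torus_axis_in_torus, of w j] Psi_torus_axis[of P j w i] Psi_torus_axis[of Q j w i]
      by (simp add: w_def)
    moreover have "w powi (P $ i $ j) = w powi d * w powi (Q $ i $ j)"
      by (subst power_int_add[symmetric]) (auto simp: w_def d_def)
    moreover have "w powi d = -1" using d by (simp add: w_def cis_power_int)
    ultimately have "w powi (Q $ i $ j) = 0" by simp
    then show False by (simp add: w_def)
  qed
  then show ?thesis by (simp add: vec_eq_iff)
qed

lemma power_int_sum:
  fixes x :: complex assumes "x \<noteq> 0" shows "x powi (\<Sum>i\<in>I. f i) = (\<Prod>i\<in>I. x powi f i)"
  by (induction I rule: infinite_finite_induct) (simp_all add: power_int_add assms)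

lemma power_int_prod: "(\<Prod>i\<in>I. f i :: complex) powi n = (\<Prod>i\<in>I. f i powi n)"
  by (induction I rule: infinite_finite_induct) (simp_all add: power_int_mult_distrib)

lemma Psi_matrix_mult:
  assumes z: "z \<in> torus" shows "Psi P (Psi Q z) = Psi (P ** Q) z"
proof -
  have "(\<Prod>k\<in>UNIV. (\<Prod>j\<in>UNIV. (z $ j) powi (Q $ k $ j)) powi (P $ i $ k)) =
     (\<Prod>j\<in>UNIV. (z $ j) powi (\<Sum>k\<in>UNIV. P $ i $ k * Q $ k $ j))" for i
    unfolding power_int_prod power_int_sum[OF torus_nz[OF z]]
    by (subst prod.swap) (simp add: power_int_mult[symmetric] mult.commute)
  then show ?thesis by (simp add: Psi_def vec_eq_iff matrix_matrix_mult_def)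
qed

lemma Psi_mat_1: "Psi (mat 1) z = z"
proof -
  have "(\<Prod>j\<in>UNIV. (z $ j) powi (mat 1 $ i $ j)) = (\<Prod>j\<in>UNIV. if j = i then z $ j else 1)" for i
    by (intro prod.cong) (auto simp: mat_def)
  then show ?thesis by (simp add: Psi_def vec_eq_iff)
qed

definition real_matrix :: "int ^ 'n ^ 'm \<Rightarrow> real ^ 'n ^ 'm" where
  "real_matrix P = (\<chi> i j. of_int (P $ i $ j))"

lemma real_matrix_mult: "real_matrix (P ** Q) = real_matrix P ** real_matrix Q"
  by (simp add: real_matrix_def matrix_matrix_mult_def vec_eq_iff)

lemma real_matrix_mat_1: "real_matrix A = mat 1 \<longleftrightarrow> A = mat 1"
  by (auto simp: real_matrix_def mat_def vec_eq_iff)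

lemma det_real_matrix: "det (real_matrix P) = of_int (det P)"
  by (simp add: det_def real_matrix_def)

text \<open>
  Cramer's rule over the reals: the entries of the inverse are determinants of integer matrices
  divided by the determinant of \<open>P\<close>, and dividing by a determinant \<open>\<plusminus>1\<close> is the same as multiplying by it.
\<close>

lemma GL_int_inverse:
  assumes P: "P \<in> GL_int"
  obtains Q where "P ** Q = mat 1" "Q ** P = mat 1"
proof -
  have dP: "det P * det P = 1" "det P \<noteq> 0" using P by (auto simp: GL_int_def)
  define C where "C l k = (\<chi> i j. if j = l then (if i = k then 1 else 0) else P $ i $ j)" for l k
  define Q where "Q = (\<chi> l k. det (C l k) * det P)"
  have "real_matrix P ** real_matrix Q = mat 1"
  proof -
    have "(real_matrix P *v (\<chi> l. of_int (Q $ l $ k))) = axis k 1" for k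
    proof (subst cramer)
      show "det (real_matrix P) \<noteq> 0" using dP by (simp add: det_real_matrix)
      have "(\<chi> i j. if j = l then axis k 1 $ i else real_matrix P $ i $ j) = real_matrix (C l k)" for l
        by (simp add: vec_eq_iff real_matrix_def C_def axis_def)
      moreover have "of_int (Q $ l $ k) = real_of_int (det (C l k)) / of_int (det P)" for l
      proof -
        have "real_of_int (det P) * of_int (det P) = 1" using dP(1) by (metis of_int_1 of_int_mult)
        then show ?thesis using dP(2) by (simp add: Q_def field_simps)
      qed
      ultimately show "(\<chi> l. of_int (Q $ l $ k)) = (\<chi> l. det (\<chi> i j. if j = l then axis k 1 $ i else real_matrix P $ i $ j) / det (real_matrix P))"
        by (simp add: vec_eq_iff det_real_matrix)
    qed
    then have "(\<Sum>l\<in>UNIV. of_int (P $ i $ l) * of_int (Q $ l $ k)) = (if i = k then 1 else (0::real))" for i k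
      by (simp add: vec_eq_iff matrix_vector_mult_def real_matrix_def axis_def)
    then show ?thesis by (simp add: vec_eq_iff matrix_matrix_mult_def real_matrix_def mat_def)
  qed
  then have "P ** Q = mat 1" "Q ** P = mat 1"
    using matrix_left_right_inverse[of "real_matrix P" "real_matrix Q"]
    by (simp_all add: real_matrix_mat_1[symmetric] real_matrix_mult)
  then show ?thesis by (rule that)
qed

section \<open>Conjugacies are affine\<close>

definition char_vec :: "'g ^ 'n \<Rightarrow> ('g \<Rightarrow> complex) \<Rightarrow> complex ^ 'n" where
  "char_vec g \<gamma> = (\<chi> i. \<gamma> (g $ i))"

lemma Phi_eq: "Phi g \<gamma> z = z * char_vec g \<gamma>"
  by (simp add: Phi_def char_vec_def vec_eq_iff)

lemma dual_group_iff: "\<gamma> \<in> dual_group \<longleftrightarrow> is_character \<gamma> \<and> continuous_on UNIV \<gamma>"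
  by (auto simp: dual_group_def is_character_def)

lemma char_vec_in_torus: "\<gamma> \<in> dual_group \<Longrightarrow> char_vec g \<gamma> \<in> torus"
  by (simp add: char_vec_def torus_def dual_group_def)

text \<open>
  The orbit of \<open>1\<close> consists of the points \<open>char_vec g \<gamma>\<close>, so minimality makes them dense.
\<close>

lemma minimal_dense:
  assumes min: "minimal_action dual_group (Phi g) torus"
    and cont: "continuous_on torus f" "continuous_on torus f'"
    and eq: "\<And>\<gamma>. \<gamma> \<in> dual_group \<Longrightarrow> f (char_vec g \<gamma>) = f' (char_vec g \<gamma>)"
    and z: "z \<in> torus"
  shows "f z = (f' z :: 'b::real_normed_vector)"
proof -
  define S where "S = char_vec g ` dual_group"
  have "torus \<subseteq> closure ((\<lambda>\<gamma>. Phi g \<gamma> 1) ` dual_group)"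
    using min torus_one unfolding minimal_action_def by blast
  also have "(\<lambda>\<gamma>. Phi g \<gamma> 1) ` dual_group = S" by (simp add: S_def Phi_eq)
  finally have "torus \<subseteq> closure S" .
  moreover have "closure S \<subseteq> torus"
    by (rule closure_minimal[OF _ closed_torus]) (auto simp: S_def char_vec_in_torus)
  ultimately have cS: "closure S = torus" by blast
  have "f z - f' z = 0"
  proof (rule continuous_constant_on_closure[of S "\<lambda>z. f z - f' z"])
    show "continuous_on (closure S) (\<lambda>z. f z - f' z)" unfolding cS by (intro continuous_intros cont)
    show "z \<in> closure S" using z cS by simp
    show "\<And>x. x \<in> S \<Longrightarrow> f x - f' x = 0" using eq by (auto simp: S_def)
  qed
  then show ?thesis by simp
qed

lemma char_vec_mat_act:
  assumes "\<gamma> \<in> dual_group" shows "char_vec (mat_act P g) \<gamma> = Psi P (char_vec g \<gamma>)"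
proof -
  have \<gamma>: "is_character \<gamma>" using assms by (simp add: dual_group_iff)
  have "\<gamma> (\<Sum>j\<in>S. f j) = (\<Prod>j\<in>S. \<gamma> (f j))" for S and f :: "'b \<Rightarrow> 'a"
    by (induction S rule: infinite_finite_induct)
       (use \<gamma> in \<open>auto simp: character_0[OF \<gamma>] is_character_def\<close>)
  then show ?thesis by (simp add: char_vec_def mat_act_def Psi_def vec_eq_iff character_int_mult[OF \<gamma>])
qed

lemma mat_act_unique:
  assumes min: "minimal_action dual_group (Phi g) torus" and eq: "mat_act P g = mat_act Q g"
  shows "P = Q"
proof (rule Psi_inject)
  fix z :: "complex ^ 'b" assume z: "z \<in> torus"
  show "Psi P z = Psi Q z"
    by (rule minimal_dense[OF min continuous_on_Psi continuous_on_Psi _ z])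
       (simp add: char_vec_mat_act[symmetric] eq)
qed

lemma conjugacy_of_GL:
  assumes P: "P \<in> GL_int" shows "conjugacy g (mat_act P g) (Psi P)"
proof -
  obtain Q where Q: "P ** Q = mat 1" "Q ** P = mat 1" using GL_int_inverse[OF P] by blast
  have "homeomorphism torus torus (Psi P) (Psi Q)"
    by (rule homeomorphismI)
       (auto simp: continuous_on_Psi Psi_in_torus Psi_matrix_mult Q Psi_mat_1)
  then show ?thesis unfolding conjugacy_def
    by (auto simp: Phi_eq Psi_mult char_vec_mat_act)
qed

text \<open>
  Density upgrades equivariance to the statement that \<open>H\<close> divided by \<open>c = H 1\<close> is multiplicative.
  Its inverse \<open>\<eta>\<close> is a continuous endomorphism as well, so the two integer matrices are inverse to
  each other. Division by \<open>c\<close> is multiplication by the conjugate \<open>d\<close>.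
\<close>

lemma conjugacy_affine:
  fixes g h :: "'g::topological_ab_group_add ^ 'n"
  assumes min: "minimal_action dual_group (Phi g) torus" and H: "conjugacy g h H"
  obtains P where "P \<in> GL_int" "H 1 \<in> torus" "\<And>z. z \<in> torus \<Longrightarrow> H z = H 1 * Psi P z"
    "\<And>\<gamma>. \<gamma> \<in> dual_group \<Longrightarrow> char_vec h \<gamma> = Psi P (char_vec g \<gamma>)"
proof -
  obtain H' where hom: "homeomorphism torus torus H H'" using H by (auto simp: conjugacy_def)
  have eqv: "H (z * char_vec g \<gamma>) = H z * char_vec h \<gamma>" if "\<gamma> \<in> dual_group" "z \<in> torus" for \<gamma> z
    using H that by (simp add: conjugacy_def Phi_eq)
  have Ht: "H z \<in> torus" "H' z \<in> torus" "H' (H z) = z" "H (H' z) = z" if "z \<in> torus" for z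
    using hom that unfolding homeomorphism_def by blast+
  have cH: "continuous_on torus H" "continuous_on torus H'" using hom by (auto simp: homeomorphism_def)
  define c where "c = H 1"
  define d where "d = (\<chi> i. cnj (c $ i))"
  have c: "c \<in> torus" using Ht torus_one by (simp add: c_def)
  have d: "d \<in> torus" using c by (simp add: d_def torus_def)
  have cd: "c * d = 1" using c 
    by (simp add: d_def torus_def vec_eq_iff complex_norm_square[symmetric])
  have mult: "H (z * w) * c = H z * H w" if z: "z \<in> torus" and w: "w \<in> torus" for z w
  proof -
    have "continuous_on torus (\<lambda>w. H (z * w) * c)"
      by (intro continuous_on_vec_mult continuous_intros continuous_on_compose2[OF cH(1)]) (auto intro: torus_mult z)
    moreover have "continuous_on torus (\<lambda>w. H z * H w)" by (intro continuous_on_vec_mult continuous_intros cH)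
    moreover have "H (z * char_vec g \<gamma>) * c = H z * H (char_vec g \<gamma>)" if \<gamma>: "\<gamma> \<in> dual_group" for \<gamma>
      using eqv[OF \<gamma> z] eqv[OF \<gamma> torus_one] by (simp add: c_def mult_ac)
    ultimately show ?thesis by (rule minimal_dense[OF min _ _ _ w])
  qed
  define \<theta> where "\<theta> z = d * H z" for z
  define \<eta> where "\<eta> z = H' (c * z)" for z
  have \<theta>t: "\<theta> z \<in> torus" if "z \<in> torus" for z using that by (simp add: \<theta>_def torus_mult d Ht)
  have \<eta>t: "\<eta> z \<in> torus" if "z \<in> torus" for z using that by (simp add: \<eta>_def torus_mult c Ht)
  have c\<theta>: "c * \<theta> z = H z" for z using cd by (simp add: \<theta>_def mult.assoc[symmetric])
  have \<theta>\<eta>: "\<theta> (\<eta> z) = z" if "z \<in> torus" for z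
  proof -
    have "\<theta> (\<eta> z) = d * (c * z)" using that by (simp add: \<theta>_def \<eta>_def Ht torus_mult c)
    then show ?thesis using cd by (simp add: mult.assoc[symmetric] mult.commute[of d])
  qed
  have \<eta>\<theta>: "\<eta> (\<theta> z) = z" if "z \<in> torus" for z using that by (simp add: \<eta>_def c\<theta> Ht)
  have \<theta>_mult: "\<theta> (z * w) = \<theta> z * \<theta> w" if "z \<in> torus" "w \<in> torus" for z w
  proof -
    have "\<theta> (z * w) = d * H (z * w) * (c * d)" by (simp add: \<theta>_def cd)
    also have "\<dots> = d * (H (z * w) * c) * d" by (simp only: mult_ac)
    also have "\<dots> = \<theta> z * \<theta> w" unfolding mult[OF that] by (simp add: \<theta>_def mult_ac)
    finally show ?thesis .
  qed
  have \<eta>_mult: "\<eta> (z * w) = \<eta> z * \<eta> w" if "z \<in> torus" "w \<in> torus" for z w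
    using \<theta>_mult[OF \<eta>t[OF that(1)] \<eta>t[OF that(2)]] \<eta>\<theta>[OF torus_mult[OF \<eta>t[OF that(1)] \<eta>t[OF that(2)]]]
    by (simp add: \<theta>\<eta> that)
  have "continuous_on torus \<theta>" unfolding \<theta>_def by (intro continuous_on_vec_mult continuous_intros cH)
  then obtain P where P: "\<And>z. z \<in> torus \<Longrightarrow> \<theta> z = Psi P z"
    using torus_endomorphism_is_Psi[of \<theta>] \<theta>t \<theta>_mult by blast
  have "continuous_on torus \<eta>" unfolding \<eta>_def
    by (intro continuous_on_compose2[OF cH(2)] continuous_on_vec_mult continuous_intros) (auto intro: torus_mult c)
  then obtain Q where Q: "\<And>z. z \<in> torus \<Longrightarrow> \<eta> z = Psi Q z"
    using torus_endomorphism_is_Psi[of \<eta>] \<eta>t \<eta>_mult by blast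
  have "P ** Q = mat 1"
  proof (rule Psi_inject)
    fix z :: "complex ^ 'n" assume z: "z \<in> torus"
    have "Psi (P ** Q) z = \<theta> (\<eta> z)" using z by (simp add: P Q \<eta>t Psi_matrix_mult[symmetric] Psi_in_torus)
    then show "Psi (P ** Q) z = Psi (mat 1) z" using z by (simp add: \<theta>\<eta> Psi_mat_1)
  qed
  then have "det P * det Q = 1" by (metis det_I det_mul)
  then have "P \<in> GL_int" by (auto simp: GL_int_def zmult_eq_1_iff)
  moreover have "H z = H 1 * Psi P z" if "z \<in> torus" for z
    using c\<theta>[of z] P[OF that] by (simp add: c_def)
  moreover have "char_vec h \<gamma> = Psi P (char_vec g \<gamma>)" if \<gamma>: "\<gamma> \<in> dual_group" for \<gamma>
  proof -
    have "Psi P (char_vec g \<gamma>) = d * H (char_vec g \<gamma>)"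
      using P[OF char_vec_in_torus[OF \<gamma>]] by (simp add: \<theta>_def)
    also have "H (char_vec g \<gamma>) = c * char_vec h \<gamma>" using eqv[OF \<gamma> torus_one] by (simp add: c_def)
    also have "d * (c * char_vec h \<gamma>) = char_vec h \<gamma>" using cd by (simp add: mult.assoc[symmetric] mult.commute[of d])
    finally show ?thesis by simp
  qed
  moreover have "H 1 \<in> torus" using c by (simp add: c_def)
  ultimately show ?thesis using that by blast
qed

lemma char_vec_inject:
  fixes g h :: "'g::{topological_ab_group_add, t2_space} ^ 'n"
  assumes lc: "locally_compact_space (euclidean :: 'g topology)"
    and eq: "\<And>\<gamma>. \<gamma> \<in> dual_group \<Longrightarrow> char_vec g \<gamma> = char_vec h \<gamma>"
  shows "g = h"
proof -
  have "g $ i = h $ i" for i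
  proof (rule ccontr)
    assume "g $ i \<noteq> h $ i"
    then obtain \<gamma> where \<gamma>: "is_character \<gamma>" "continuous_on UNIV \<gamma>" "\<gamma> (g $ i - h $ i) \<noteq> 1"
      using continuous_characters_separate_points[OF lc, of "g $ i - h $ i"] by auto
    have "\<gamma> (g $ i) = \<gamma> (h $ i)" using eq[of \<gamma>] \<gamma> by (simp add: dual_group_iff char_vec_def vec_eq_iff)
    then have "\<gamma> (g $ i - h $ i) = \<gamma> (h $ i - h $ i)" by (simp only: character_diff[OF \<gamma>(1)])
    then show False using \<gamma> by (simp add: character_0)
  qed
  then show ?thesis by (simp add: vec_eq_iff)
qed

theorem theorem1p3:
  fixes g h :: "'g::{topological_ab_group_add, t2_space} ^ 'n"
  assumes "locally_compact_space (euclidean :: 'g topology)"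
    and "minimal_action dual_group (Phi g) torus"
    and "minimal_action dual_group (Phi h) torus"
  shows "((\<exists>H. conjugacy g h H) \<longleftrightarrow> (\<exists>P\<in>GL_int. h = mat_act P g)) \<and>
         (\<forall>H. conjugacy g h H \<longrightarrow>
            (\<exists>P\<in>GL_int. \<exists>c\<in>torus. \<forall>z\<in>torus. H z = c * Psi P z)) \<and>
         (\<forall>P Q. h = mat_act P g \<longrightarrow> h = mat_act Q g \<longrightarrow> P = Q)"
proof (intro conjI allI impI iffI)
  assume "\<exists>H. conjugacy g h H"
  then obtain H where "conjugacy g h H" by blast
  then obtain P where P: "P \<in> GL_int" "\<And>\<gamma>. \<gamma> \<in> dual_group \<Longrightarrow> char_vec h \<gamma> = Psi P (char_vec g \<gamma>)"
    by (rule conjugacy_affine[OF assms(2)]) blast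
  have "h = mat_act P g" by (rule char_vec_inject[OF assms(1)]) (simp add: P(2) char_vec_mat_act)
  then show "\<exists>P\<in>GL_int. h = mat_act P g" using P(1) by blast
next
  assume "\<exists>P\<in>GL_int. h = mat_act P g"
  then show "\<exists>H. conjugacy g h H" using conjugacy_of_GL by blast
next
  fix H assume "conjugacy g h H"
  then obtain P where "P \<in> GL_int" "H 1 \<in> torus" "\<And>z. z \<in> torus \<Longrightarrow> H z = H 1 * Psi P z"
    by (rule conjugacy_affine[OF assms(2)]) blast
  then show "\<exists>P\<in>GL_int. \<exists>c\<in>torus. \<forall>z\<in>torus. H z = c * Psi P z" by blast
next
  fix P Q assume "h = mat_act P g" "h = mat_act Q g"
  then show "P = Q" using mat_act_unique[OF assms(2), of P Q] by simp
qed

end
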